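(* Let $J,J_1$ be non-infinitesimal intervals of ${}^\bullet\mathbb{R}$, let $u,v\in J_1$, and let $\phi:J_1\to J$ and $f:J\to{}^\bullet\mathbb{R}$ be smooth functions. Then $$\int_{\phi(u)}^{\phi(v)}f(t)\,\mathrm{d}t=\int_u^v f[\phi(s)]\cdot\phi'(s)\,\mathrm{d}s.$$
   Context: Fermat reals: let $\mathbb{R}_o[t]$ be the set of maps $x:\mathbb{R}_{\ge0}\to\mathbb{R}$, $t\mapsto x_t$, of the form $x_t=r+\sum_{i=1}^k\alpha_i t^{a_i}+o(t)$ as $t\to0^+$, with $k\in\mathbb{N}$, $r,\alpha_i\in\mathbb{R}$, $a_i\in\mathbb{R}_{\ge0}$. Write $x\sim y$ iff $x_t=y_t+o(t)$ as $t\to0^+$. The ring of Fermat reals is ${}^\bullet\mathbb{R}:=\mathbb{R}_o[t]/\sim$ with pointwise operations; $\mathbb{R}\subseteq{}^\bullet\mathbb{R}$ via constants. The standard part of $x=[x_t]$ is ${}^\circ x:=x_0$. ${}^\bullet\mathbb{R}$ is totally ordered by: $x\le y$ iff for representatives there is $z\in\mathbb{R}_o[t]$ with $z\sim0$ and $x_t\le y_t+z_t$ for all small $t\ge0$. $\overline{{}^\bullet\mathbb{R}}:={}^\bullet\mathbb{R}\cup\{\pm\infty\}$, ${}^\circ(\pm\infty):=\pm\infty$. An interval is a set $[a,b],(a,b),[a,b),(a,b]$ of points of ${}^\bullet\mathbb{R}$ with $a\le b$ in $\overline{{}^\bullet\mathbb{R}}$; non-infinitesimal if ${}^\circ a<{}^\circ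 b$. The Fermat topology on ${}^\bullet\mathbb{R}^n$ has open sets ${}^\bullet V:=\{x:{}^\circ x\in V\}$, $V\subseteq\mathbb{R}^n$ open. For $\alpha\in C^\infty(W,\mathbb{R}^m)$, $W\subseteq\mathbb{R}^d$ open, ${}^\bullet\alpha([x_t]):=[\alpha(x_t)]$. A map $f:S\to{}^\bullet\mathbb{R}^m$, $S\subseteq{}^\bullet\mathbb{R}^n$, is smooth if for every $x\in S$ there exist open $V\subseteq\mathbb{R}^n$ with $x\in{}^\bullet V$, open $P\subseteq\mathbb{R}^{\mathsf p}$, $p\in{}^\bullet P$, $\alpha\in C^\infty(P\times V,\mathbb{R}^m)$ with $f(y)={}^\bullet\alpha(p,y)$ for $y\in{}^\bullet V\cap S$. For $f$ smooth on a non-infinitesimal interval $J$ and $x\in J$, $f'(x):={}^\bullet(\partial_2\alpha)(p,x)$ for any local representation of $f$ around $x$ (independent of it). Integral: for a non-infinitesimal interval $J$, smooth $f:J\to{}^\bullet\mathbb{R}$ and $u\in J$, $\int_u^{(-)}f$ is the unique smooth $I:J\to{}^\bullet\mathbb{R}$ with $I(u)=0$ and $I'(x)=f(x)$ for all $x\in J$, and $\int_u^v f=\int_u^v f(s)\,\mathrm{d}s:=I(v)$ for $v\in J$. *)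

theory Defs
  imports "HOL-Analysis.Analysis"
begin

definition Rn :: "nat \<Rightarrow> (nat \<Rightarrow> real) set" where
  "Rn d = {x. \<forall>i. d \<le> i \<longrightarrow> x i = 0}"

definition edist :: "nat \<Rightarrow> (nat \<Rightarrow> real) \<Rightarrow> (nat \<Rightarrow> real) \<Rightarrow> real" where
  "edist d x y = sqrt (\<Sum>i<d. (x i - y i)^2)"

definition open_Rn :: "nat \<Rightarrow> (nat \<Rightarrow> real) set \<Rightarrow> bool" where
  "open_Rn d U \<longleftrightarrow> U \<subseteq> Rn d \<and>
     (\<forall>x\<in>U. \<exists>e>0. \<forall>y\<in>Rn d. edist d x y < e \<longrightarrow> y \<in> U)"

definition pdiff :: "nat \<Rightarrow> ((nat \<Rightarrow> real) \<Rightarrow> real) \<Rightarrow> (nat \<Rightarrow> real) \<Rightarrow> real" where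
  "pdiff i g x = deriv (\<lambda>s. g (x(i := x i + s))) 0"

inductive_set pderivs :: "nat \<Rightarrow> ((nat \<Rightarrow> real) \<Rightarrow> real) \<Rightarrow> ((nat \<Rightarrow> real) \<Rightarrow> real) set"
  for d g where
  base: "g \<in> pderivs d g"
| step: "h \<in> pderivs d g \<Longrightarrow> i < d \<Longrightarrow> pdiff i h \<in> pderivs d g"

definition cont_Rn :: "nat \<Rightarrow> (nat \<Rightarrow> real) set \<Rightarrow> ((nat \<Rightarrow> real) \<Rightarrow> real) \<Rightarrow> bool" where
  "cont_Rn d U h \<longleftrightarrow>
     (\<forall>x\<in>U. \<forall>e>0. \<exists>\<delta>>0. \<forall>y\<in>U. edist d x y < \<delta> \<longrightarrow> \<bar>h y - h x\<bar> < e)"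

definition smooth_Rn :: "nat \<Rightarrow> (nat \<Rightarrow> real) set \<Rightarrow> ((nat \<Rightarrow> real) \<Rightarrow> real) \<Rightarrow> bool" where
  "smooth_Rn d U g \<longleftrightarrow> open_Rn d U \<and>
     (\<forall>h\<in>pderivs d g. cont_Rn d U h \<and>
        (\<forall>x\<in>U. \<forall>i<d. (\<lambda>s. h (x(i := x i + s))) differentiable (at 0)))"

definition tpow :: "real \<Rightarrow> real \<Rightarrow> real" where
  "tpow t a = (if t = 0 then (if a = 0 then 1 else 0) else t powr a)"

definition little_o :: "(real \<Rightarrow> real) \<Rightarrow> bool" where
  "little_o h \<longleftrightarrow> h 0 = 0 \<and> ((\<lambda>t. h t / t) \<longlongrightarrow> 0) (at_right 0)"

definition Ro :: "(real \<Rightarrow> real) set" where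
  "Ro = {x. \<exists>(k::nat) (r::real) (\<alpha>::nat \<Rightarrow> real) (a::nat \<Rightarrow> real).
            (\<forall>i<k. 0 \<le> a i) \<and>
            little_o (\<lambda>t. x t - (r + (\<Sum>i<k. \<alpha> i * tpow t (a i))))}"

definition Frel :: "((real \<Rightarrow> real) \<times> (real \<Rightarrow> real)) set" where
  "Frel = {(x, y). x \<in> Ro \<and> y \<in> Ro \<and> little_o (\<lambda>t. x t - y t)}"

lemma zero_in_Ro: "(\<lambda>_. 0) \<in> Ro"
proof -
  have "little_o (\<lambda>t. (\<lambda>_. 0::real) t - (0 + (\<Sum>i<(0::nat). (\<lambda>_. 0) i * tpow t ((\<lambda>_. 0) i))))"
    unfolding little_o_def by simp
  then show ?thesis unfolding Ro_def
    by (intro CollectI exI[of _ "0::nat"] exI[of _ "0::real"] exI[of _ "\<lambda>_. 0::real"]) simp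
qed

typedef fermat = "Ro // Frel"
  by (rule exI[of _ "Frel `` {\<lambda>_. 0}"], rule quotientI, rule zero_in_Ro)

definition fclass :: "(real \<Rightarrow> real) \<Rightarrow> fermat" where
  "fclass x = Abs_fermat (Frel `` {x})"

definition frep :: "fermat \<Rightarrow> (real \<Rightarrow> real)" where
  "frep X = (SOME x. x \<in> Rep_fermat X)"

definition st :: "fermat \<Rightarrow> real" where
  "st X = frep X 0"

definition fconst :: "real \<Rightarrow> fermat" where
  "fconst r = fclass (\<lambda>_. r)"

definition fmult :: "fermat \<Rightarrow> fermat \<Rightarrow> fermat" where
  "fmult X Y = fclass (\<lambda>t. frep X t * frep Y t)"

definition fle :: "fermat \<Rightarrow> fermat \<Rightarrow> bool" where
  "fle X Y \<longleftrightarrow> (\<exists>z\<in>Ro. little_o z \<and>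
      (\<exists>\<delta>>0. \<forall>t. 0 \<le> t \<and> t < \<delta> \<longrightarrow> frep X t \<le> frep Y t + z t))"

datatype xfermat = MInf | Fin fermat | PInf

fun xle :: "xfermat \<Rightarrow> xfermat \<Rightarrow> bool" where
  "xle MInf _ = True"
| "xle _ PInf = True"
| "xle (Fin x) (Fin y) = fle x y"
| "xle _ _ = False"

definition xlt :: "xfermat \<Rightarrow> xfermat \<Rightarrow> bool" where
  "xlt a b \<longleftrightarrow> xle a b \<and> a \<noteq> b"

fun xst :: "xfermat \<Rightarrow> ereal" where
  "xst MInf = -\<infinity>"
| "xst (Fin x) = ereal (st x)"
| "xst PInf = \<infinity>"

definition ninf_interval :: "fermat set \<Rightarrow> bool" where
  "ninf_interval J \<longleftrightarrow> (\<exists>a b. xle a b \<and> xst a < xst b \<and>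
     (J = {x. xle a (Fin x) \<and> xle (Fin x) b} \<or>
      J = {x. xlt a (Fin x) \<and> xlt (Fin x) b} \<or>
      J = {x. xle a (Fin x) \<and> xlt (Fin x) b} \<or>
      J = {x. xlt a (Fin x) \<and> xle (Fin x) b}))"

text \<open>Parameter tuple p in Fermat R^pdim, as nat => fermat (indices < pdim used).
  bext pdim alpha p y is the extension of alpha evaluated at (p,y), where the
  point (p,y) of R^(pdim+1) has the coordinates of p first and y at index pdim.\<close>
definition bext :: "nat \<Rightarrow> ((nat \<Rightarrow> real) \<Rightarrow> real) \<Rightarrow> (nat \<Rightarrow> fermat) \<Rightarrow> fermat \<Rightarrow> fermat" where
  "bext pdim \<alpha> p y =
     fclass (\<lambda>t. \<alpha> ((\<lambda>i. if i < pdim then frep (p i) t else 0)(pdim := frep y t)))"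

definition prodset :: "nat \<Rightarrow> (nat \<Rightarrow> real) set \<Rightarrow> real set \<Rightarrow> (nat \<Rightarrow> real) set" where
  "prodset pdim P V = {z. (\<lambda>i. if i < pdim then z i else 0) \<in> P \<and> z pdim \<in> V \<and>
                          (\<forall>i>pdim. z i = 0)}"

definition local_rep :: "fermat set \<Rightarrow> (fermat \<Rightarrow> fermat) \<Rightarrow> fermat \<Rightarrow> nat \<Rightarrow>
    (nat \<Rightarrow> real) set \<Rightarrow> (nat \<Rightarrow> fermat) \<Rightarrow> real set \<Rightarrow> ((nat \<Rightarrow> real) \<Rightarrow> real) \<Rightarrow> bool" where
  "local_rep S f x pdim P p V \<alpha> \<longleftrightarrow>
     open V \<and> st x \<in> V \<and> open_Rn pdim P \<and>
     (\<lambda>i. if i < pdim then st (p i) else 0) \<in> P \<and>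
     smooth_Rn (Suc pdim) (prodset pdim P V) \<alpha> \<and>
     (\<forall>y\<in>S. st y \<in> V \<longrightarrow> f y = bext pdim \<alpha> p y)"

definition fsmooth :: "fermat set \<Rightarrow> (fermat \<Rightarrow> fermat) \<Rightarrow> bool" where
  "fsmooth S f \<longleftrightarrow> (\<forall>x\<in>S. \<exists>pdim P p V \<alpha>. local_rep S f x pdim P p V \<alpha>)"

definition fderiv :: "fermat set \<Rightarrow> (fermat \<Rightarrow> fermat) \<Rightarrow> fermat \<Rightarrow> fermat" where
  "fderiv S f x = (SOME D. \<exists>pdim P p V \<alpha>. local_rep S f x pdim P p V \<alpha> \<and>
                       D = bext pdim (pdiff pdim \<alpha>) p x)"

definition fint :: "fermat set \<Rightarrow> (fermat \<Rightarrow> fermat) \<Rightarrow> fermat \<Rightarrow> fermat \<Rightarrow> fermat" where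
  "fint J f u v = (THE I. fsmooth J I \<and> I u = fconst 0 \<and>
                       (\<forall>x\<in>J. fderiv J I x = f x) \<and> (\<forall>x. x \<notin> J \<longrightarrow> I x = fconst 0)) v"

end

theory Submission
  imports Defs "HOL-Real_Asymp.Real_Asymp"
begin

text \<open>Expanding in the infinitesimal parameters by Taylor's formula, every smooth function is locally
  a finite sum over exponents b in [0,1] of t^b times the extension of an ordinary smooth
  function c_b of one real variable. The powers t^b with b in [0,1] are linearly independent modulo
  o(t), so the c_b are determined at the real points of a non-infinitesimal interval; at a finite
  endpoint they are determined up to functions that are flat there, whose extensions vanish on the
  whole monad of the endpoint. Hence differentiation acts on the c_b, and existence
  and uniqueness of antiderivatives reduce to the real case, glued along the interval of standard
  parts. If F is the antiderivative of f that vanishes at \<open>\<phi> u\<close>, then by the chain rule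
  \<open>F \<circ> \<phi>\<close> is the antiderivative of the substituted integrand that vanishes at u.\<close>

subsection \<open>Expansions in powers of t, uniform in a real variable\<close>

text \<open>A representation of f carries Fermat parameters of any number, so two representations of
  the same f cannot be compared directly; the powers of t give common coordinates. The expansion is
  kept uniform in the real variable for two reasons: the point at which f is evaluated has a
  representative that moves with t, and the expansion of a derivative has to be integrated before it
  can be compared with that of the function. The exponents stop at 1 because higher powers are o(t),
  and Taylor's formula stops because an infinitesimal is bounded by a multiple of some positive
  power of t, hence nilpotent. Two things keep the antiderivative from being written down at once.
  The exponent sets are finite only locally; over the whole interval infinitely many exponents may
  occur, and finiteness is regained from the compactness of the segment back to the starting point.
  The starting point may itself be non-real, so the constant of integration is a Fermat real with an
  expansion of its own.\<close>

text \<open>The point 0 itself belongs to these neighbourhoods: a bound by e * t forces the value 0 at t = 0,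
  as in the definition of \<open>little_o\<close>.\<close>

definition near0 :: "real filter" where
  "near0 = inf (nhds 0) (principal {0..})"

lemma eventually_near0: "eventually P near0 \<longleftrightarrow> (\<exists>d>0. \<forall>t. 0 \<le> t \<and> t < d \<longrightarrow> P t)"
proof -
  have "(dist t (0::real) < d \<longrightarrow> t \<in> {0..} \<longrightarrow> Q) \<longleftrightarrow> (0 \<le> t \<and> t < d \<longrightarrow> Q)" for t d Q
    by (auto simp: dist_real_def)
  then show ?thesis
    unfolding near0_def eventually_inf_principal eventually_nhds_metric by simp
qed

lemma near0_nonneg: "\<forall>\<^sub>F t in near0. 0 \<le> t"
  unfolding eventually_near0 by (auto intro: exI[of _ 1])

lemma near0_less: "d > 0 \<Longrightarrow> \<forall>\<^sub>F t in near0. t < d"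
  unfolding eventually_near0 by auto

lemma eventually_near0_at0: "eventually P near0 \<Longrightarrow> P 0"
  unfolding eventually_near0 by auto

lemma eventually_near0_at_right: "eventually P near0 \<Longrightarrow> eventually P (at_right 0)"
  unfolding eventually_near0 eventually_at_right_field by (metis less_eq_real_def)

lemma eventually_near0I: "P 0 \<Longrightarrow> eventually P (at_right 0) \<Longrightarrow> eventually P near0"
  unfolding eventually_near0 eventually_at_right_field by (metis less_eq_real_def)

section \<open>Uniform little-o and boundedness for families in a real variable\<close>

definition unif_o :: "real set \<Rightarrow> (real \<Rightarrow> real \<Rightarrow> real) \<Rightarrow> bool" where
  "unif_o K R \<longleftrightarrow> (\<forall>e>0. \<forall>\<^sub>F t in near0. \<forall>y\<in>K. \<bar>R t y\<bar> \<le> e * t)"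

definition unif_bdd :: "real set \<Rightarrow> (real \<Rightarrow> real \<Rightarrow> real) \<Rightarrow> bool" where
  "unif_bdd K G \<longleftrightarrow> (\<exists>M. \<forall>\<^sub>F t in near0. \<forall>y\<in>K. \<bar>G t y\<bar> \<le> M)"

lemma little_o_iff: "little_o h \<longleftrightarrow> (\<forall>e>0. \<forall>\<^sub>F t in near0. \<bar>h t\<bar> \<le> e * t)"
proof
  assume h: "little_o h"
  show "\<forall>e>0. \<forall>\<^sub>F t in near0. \<bar>h t\<bar> \<le> e * t"
  proof (intro allI impI)
    fix e :: real assume e: "e > 0"
    have "\<forall>\<^sub>F t in at_right 0. \<bar>h t / t\<bar> < e"
      using h e unfolding little_o_def tendsto_iff dist_real_def by auto
    moreover have "\<forall>\<^sub>F t in at_right (0::real). 0 < t" by (rule eventually_at_right_less)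
    ultimately have "\<forall>\<^sub>F t in at_right 0. \<bar>h t\<bar> \<le> e * t"
      by eventually_elim (auto simp: field_simps)
    then show "\<forall>\<^sub>F t in near0. \<bar>h t\<bar> \<le> e * t"
      using h unfolding little_o_def by (intro eventually_near0I) auto
  qed
next
  assume h: "\<forall>e>0. \<forall>\<^sub>F t in near0. \<bar>h t\<bar> \<le> e * t"
  have h0: "h 0 = 0" using eventually_near0_at0[OF h[rule_format, of 1]] by auto
  have "((\<lambda>t. h t / t) \<longlongrightarrow> 0) (at_right 0)"
    unfolding tendsto_iff dist_real_def
  proof (intro allI impI)
    fix e :: real assume e: "e > 0"
    have "\<forall>\<^sub>F t in at_right 0. \<bar>h t\<bar> \<le> e / 2 * t"
      using h[rule_format, of "e / 2"] e by (intro eventually_near0_at_right) simp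
    moreover have "\<forall>\<^sub>F t in at_right (0::real). 0 < t" by (rule eventually_at_right_less)
    ultimately show "\<forall>\<^sub>F t in at_right 0. \<bar>h t / t - 0\<bar> < e"
    proof eventually_elim
      case (elim t)
      have "e / 2 * t < e * t" using elim e by simp
      then show ?case using elim by (auto simp: abs_divide pos_divide_less_eq)
    qed
  qed
  then show "little_o h" using h0 unfolding little_o_def by simp
qed

lemma unif_o_const: "K \<noteq> {} \<Longrightarrow> unif_o K (\<lambda>t y. h t) \<longleftrightarrow> little_o h"
  unfolding unif_o_def little_o_iff by (simp add: ex_in_conv)

lemma unif_o_constI: "little_o h \<Longrightarrow> unif_o K (\<lambda>t y. h t)"
  unfolding unif_o_def little_o_iff by simp

lemma unif_o_cong:
  assumes "\<forall>\<^sub>F t in near0. \<forall>y\<in>K. R t y = S t y" and "unif_o K R"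
  shows "unif_o K S"
  unfolding unif_o_def
proof (intro allI impI)
  fix e :: real assume "e > 0"
  then have "\<forall>\<^sub>F t in near0. \<forall>y\<in>K. \<bar>R t y\<bar> \<le> e * t" using assms unfolding unif_o_def by blast
  with assms(1) show "\<forall>\<^sub>F t in near0. \<forall>y\<in>K. \<bar>S t y\<bar> \<le> e * t"
    by eventually_elim simp
qed

lemma unif_o_subset: assumes "unif_o K R" "K' \<subseteq> K" shows "unif_o K' R"
  unfolding unif_o_def
proof (intro allI impI)
  fix e :: real assume "e > 0"
  then have "\<forall>\<^sub>F t in near0. \<forall>y\<in>K. \<bar>R t y\<bar> \<le> e * t" using assms unfolding unif_o_def by blast
  then show "\<forall>\<^sub>F t in near0. \<forall>y\<in>K'. \<bar>R t y\<bar> \<le> e * t"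
    by (rule eventually_mono) (use assms(2) in blast)
qed

lemma unif_o_zero [simp]: "unif_o K (\<lambda>t y. 0)"
  unfolding unif_o_def using near0_nonneg by (auto elim: eventually_mono)

lemma unif_o_add:
  assumes "unif_o K R" "unif_o K S" shows "unif_o K (\<lambda>t y. R t y + S t y)"
  unfolding unif_o_def
proof (intro allI impI)
  fix e :: real assume "e > 0"
  then have "\<forall>\<^sub>F t in near0. \<forall>y\<in>K. \<bar>R t y\<bar> \<le> e/2 * t" "\<forall>\<^sub>F t in near0. \<forall>y\<in>K. \<bar>S t y\<bar> \<le> e/2 * t"
    using assms unfolding unif_o_def by (meson half_gt_zero)+
  then show "\<forall>\<^sub>F t in near0. \<forall>y\<in>K. \<bar>R t y + S t y\<bar> \<le> e * t"
  proof eventually_elim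
    case (elim t)
    show ?case
    proof
      fix y assume "y \<in> K"
      then have "\<bar>R t y\<bar> \<le> e/2 * t" "\<bar>S t y\<bar> \<le> e/2 * t" using elim by auto
      moreover have "e/2 * t + e/2 * t = e * t" by simp
      ultimately show "\<bar>R t y + S t y\<bar> \<le> e * t" by linarith
    qed
  qed
qed

lemma unif_o_mult:
  assumes "unif_bdd K G" "unif_o K R" shows "unif_o K (\<lambda>t y. G t y * R t y)"
  unfolding unif_o_def
proof (intro allI impI)
  fix e :: real assume e: "e > 0"
  obtain M where M: "\<forall>\<^sub>F t in near0. \<forall>y\<in>K. \<bar>G t y\<bar> \<le> M" using assms unfolding unif_bdd_def by blast
  define M' where "M' = max M 1"
  have M': "M' > 0" "M \<le> M'" unfolding M'_def by auto
  have "\<forall>\<^sub>F t in near0. \<forall>y\<in>K. \<bar>R t y\<bar> \<le> e / M' * t"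
    using assms(2) e M' unfolding unif_o_def by (meson divide_pos_pos)
  with M show "\<forall>\<^sub>F t in near0. \<forall>y\<in>K. \<bar>G t y * R t y\<bar> \<le> e * t"
  proof eventually_elim
    case (elim t)
    show ?case
    proof
      fix y assume y: "y \<in> K"
      have "\<bar>G t y * R t y\<bar> = \<bar>G t y\<bar> * \<bar>R t y\<bar>" by (simp add: abs_mult)
      also have "\<dots> \<le> M' * (e / M' * t)"
        using elim y M' by (intro mult_mono) force+
      also have "\<dots> = e * t" using M' by simp
      finally show "\<bar>G t y * R t y\<bar> \<le> e * t" .
    qed
  qed
qed

lemma unif_bdd_bounded: "bounded (g ` K) \<Longrightarrow> unif_bdd K (\<lambda>t y. g y)"
  unfolding unif_bdd_def bounded_iff by (auto intro: always_eventually)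

lemma unif_o_cmult: "unif_o K R \<Longrightarrow> unif_o K (\<lambda>t y. a * R t y)"
proof -
  have "unif_bdd K (\<lambda>t y. a)" unfolding unif_bdd_def by (rule exI[of _ "\<bar>a\<bar>"]) simp
  then show "unif_o K R \<Longrightarrow> ?thesis" by (rule unif_o_mult)
qed

lemma unif_o_minus: "unif_o K R \<Longrightarrow> unif_o K (\<lambda>t y. - R t y)"
  using unif_o_cmult[of K R "-1"] by simp

lemma unif_o_diff: "unif_o K R \<Longrightarrow> unif_o K S \<Longrightarrow> unif_o K (\<lambda>t y. R t y - S t y)"
  using unif_o_add[OF _ unif_o_minus] by simp

lemma unif_o_sum: "(\<And>i. i \<in> I \<Longrightarrow> unif_o K (R i)) \<Longrightarrow> unif_o K (\<lambda>t y. \<Sum>i\<in>I. R i t y)"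
  by (induction I rule: infinite_finite_induct) (auto intro!: unif_o_add)

lemma unif_bdd_add:
  assumes "unif_bdd K G" "unif_bdd K H" shows "unif_bdd K (\<lambda>t y. G t y + H t y)"
proof -
  obtain M M' where "\<forall>\<^sub>F t in near0. \<forall>y\<in>K. \<bar>G t y\<bar> \<le> M" "\<forall>\<^sub>F t in near0. \<forall>y\<in>K. \<bar>H t y\<bar> \<le> M'"
    using assms unfolding unif_bdd_def by blast
  then have "\<forall>\<^sub>F t in near0. \<forall>y\<in>K. \<bar>G t y + H t y\<bar> \<le> M + M'"
    by eventually_elim fastforce
  then show ?thesis unfolding unif_bdd_def by blast
qed

lemma unif_bdd_mult:
  assumes "unif_bdd K G" "unif_bdd K H" shows "unif_bdd K (\<lambda>t y. G t y * H t y)"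
proof -
  obtain M M' where "\<forall>\<^sub>F t in near0. \<forall>y\<in>K. \<bar>G t y\<bar> \<le> M" "\<forall>\<^sub>F t in near0. \<forall>y\<in>K. \<bar>H t y\<bar> \<le> M'"
    using assms unfolding unif_bdd_def by blast
  then have "\<forall>\<^sub>F t in near0. \<forall>y\<in>K. \<bar>G t y * H t y\<bar> \<le> M * M'"
    by eventually_elim (auto simp: abs_mult intro!: mult_mono order_trans[OF abs_ge_zero])
  then show ?thesis unfolding unif_bdd_def by blast
qed

lemma unif_bdd_zero: "unif_bdd K (\<lambda>t y. 0)"
  unfolding unif_bdd_def by (rule exI[of _ 0]) simp

lemma unif_bdd_sum: "(\<And>i. i \<in> I \<Longrightarrow> unif_bdd K (G i)) \<Longrightarrow> unif_bdd K (\<lambda>t y. \<Sum>i\<in>I. G i t y)"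
  by (induction I rule: infinite_finite_induct) (auto intro!: unif_bdd_add unif_bdd_zero)

lemma unif_o_imp_bdd: assumes "unif_o K R" shows "unif_bdd K R"
proof -
  have "\<forall>\<^sub>F t in near0. \<forall>y\<in>K. \<bar>R t y\<bar> \<le> 1 * t" using assms unfolding unif_o_def by (meson zero_less_one)
  moreover have "\<forall>\<^sub>F t in near0. t < 1" by (rule near0_less) simp
  ultimately have "\<forall>\<^sub>F t in near0. \<forall>y\<in>K. \<bar>R t y\<bar> \<le> 1" by eventually_elim fastforce
  then show ?thesis unfolding unif_bdd_def by blast
qed

section \<open>Real powers of t\<close>

lemma tpow_zero [simp]: "tpow t 0 = 1"
  by (auto simp: tpow_def)

lemma tpow_at_zero: "tpow 0 a = (if a = 0 then 1 else 0)"
  by (simp add: tpow_def)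

lemma tpow_nonneg [simp]: "0 \<le> tpow t a"
  by (simp add: tpow_def)

lemma tpow_add: "0 \<le> a \<Longrightarrow> 0 \<le> b \<Longrightarrow> tpow t (a + b) = tpow t a * tpow t b"
  by (auto simp: tpow_def powr_add)

lemma tpow_le_one: "0 \<le> t \<Longrightarrow> t \<le> 1 \<Longrightarrow> 0 \<le> a \<Longrightarrow> tpow t a \<le> 1"
  by (auto simp: tpow_def powr_le1)

lemma tpow_antimono: "0 \<le> t \<Longrightarrow> t \<le> 1 \<Longrightarrow> 0 \<le> a \<Longrightarrow> a \<le> b \<Longrightarrow> tpow t b \<le> tpow t a"
  using tpow_add[of a "b - a" t] tpow_le_one[of t "b - a"] by (simp add: mult_left_le)

lemma tpow_power: "0 \<le> a \<Longrightarrow> tpow t a ^ n = tpow t (n * a)"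
proof (induction n)
  case (Suc n)
  then show ?case using tpow_add[of a "n * a" t] by (simp add: algebra_simps)
qed simp

lemma unif_bdd_tpow: "0 \<le> a \<Longrightarrow> unif_bdd K (\<lambda>t y. tpow t a)"
proof -
  assume a: "0 \<le> a"
  have "\<forall>\<^sub>F t in near0. t < 1" by (rule near0_less) simp
  with near0_nonneg have "\<forall>\<^sub>F t in near0. \<forall>y\<in>K. \<bar>tpow t a\<bar> \<le> 1"
    by eventually_elim (auto intro: tpow_le_one a)
  then show ?thesis unfolding unif_bdd_def by blast
qed

text \<open>This is what confines the exponents to the unit interval: all larger powers are absorbed
  by the remainder.\<close>

lemma little_o_tpow: assumes "1 < a" shows "little_o (\<lambda>t. tpow t a)"
proof -
  have "((\<lambda>t. t powr (a - 1)) \<longlongrightarrow> 0) (at_right 0)"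
    using assms by real_asymp
  moreover have "\<forall>\<^sub>F t in at_right (0::real). t powr (a - 1) = tpow t a / t"
    using eventually_at_right_less[of "0::real"]
    by eventually_elim (auto simp: tpow_def powr_diff)
  ultimately have "((\<lambda>t. tpow t a / t) \<longlongrightarrow> 0) (at_right 0)"
    by (rule Lim_transform_eventually)
  then show ?thesis using assms by (simp add: little_o_def tpow_def)
qed

section \<open>Finite expansions and their algebra\<close>

definition bcont :: "real set \<Rightarrow> (real \<Rightarrow> real) \<Rightarrow> bool" where
  "bcont K g \<longleftrightarrow> continuous_on K g \<and> bounded (g ` K)"

lemma bcont_const [intro]: "bcont K (\<lambda>y. a)"
  by (auto simp: bcont_def bounded_iff)

lemma bcont_iff: "bcont K g \<longleftrightarrow> continuous_on K g \<and> (\<exists>M. \<forall>y\<in>K. \<bar>g y\<bar> \<le> M)"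
  by (simp add: bcont_def bounded_iff)

lemma bcont_subset: "bcont K g \<Longrightarrow> K' \<subseteq> K \<Longrightarrow> bcont K' g"
  unfolding bcont_iff by (blast intro: continuous_on_subset)

lemma bcont_add: assumes "bcont K g" "bcont K h" shows "bcont K (\<lambda>y. g y + h y)"
proof -
  obtain M M' where "\<forall>y\<in>K. \<bar>g y\<bar> \<le> M" "\<forall>y\<in>K. \<bar>h y\<bar> \<le> M'" using assms unfolding bcont_iff by blast
  then have "\<forall>y\<in>K. \<bar>g y + h y\<bar> \<le> M + M'" by fastforce
  then show ?thesis using assms unfolding bcont_iff by (blast intro: continuous_on_add)
qed

lemma bcont_mult: assumes "bcont K g" "bcont K h" shows "bcont K (\<lambda>y. g y * h y)"
proof -
  obtain M M' where "\<forall>y\<in>K. \<bar>g y\<bar> \<le> M" "\<forall>y\<in>K. \<bar>h y\<bar> \<le> M'" using assms unfolding bcont_iff by blast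
  then have "\<forall>y\<in>K. \<bar>g y * h y\<bar> \<le> M * M'" 
    by (auto simp: abs_mult intro!: mult_mono order_trans[OF abs_ge_zero])
  then show ?thesis using assms unfolding bcont_iff by (blast intro: continuous_on_mult)
qed

lemma bcont_sum: "(\<And>i. i \<in> I \<Longrightarrow> bcont K (g i)) \<Longrightarrow> bcont K (\<lambda>y. \<Sum>i\<in>I. g i y)"
  by (induction I rule: infinite_finite_induct) (auto intro!: bcont_add)

text \<open>The coefficients are indexed by the exponents themselves, so that two expansions can be
  compared exponent by exponent without renumbering. Boundedness is part of \<open>bcont\<close>
  because \<open>K\<close> will often be an open ball, where continuity alone would not make
  products with o(t) terms uniformly o(t).\<close>

definition uexp :: "real set \<Rightarrow> (real \<Rightarrow> real \<Rightarrow> real) \<Rightarrow> real set \<Rightarrow> (real \<Rightarrow> real \<Rightarrow> real) \<Rightarrow> bool" where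
  "uexp K G B c \<longleftrightarrow> finite B \<and> B \<subseteq> {0..1} \<and> (\<forall>b\<in>B. bcont K (c b)) \<and>
     unif_o K (\<lambda>t y. G t y - (\<Sum>b\<in>B. c b y * tpow t b))"

definition expandable :: "real set \<Rightarrow> (real \<Rightarrow> real \<Rightarrow> real) \<Rightarrow> bool" where
  "expandable K G \<longleftrightarrow> (\<exists>B c. uexp K G B c)"

text \<open>Sums and products of expansions produce repeated exponents and exponents above 1. Equal
  exponents are collected into one coefficient, and those above 1 go into the remainder.\<close>

lemma expandable_indexed:
  assumes I: "finite I" and a: "\<And>i. i \<in> I \<Longrightarrow> 0 \<le> a i" and g: "\<And>i. i \<in> I \<Longrightarrow> bcont K (g i)"
    and G: "unif_o K (\<lambda>t y. G t y - (\<Sum>i\<in>I. g i y * tpow t (a i)))"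
  shows "expandable K G"
proof -
  define J where "J = {i\<in>I. a i \<le> 1}"
  have J: "finite J" "J \<subseteq> I" using I by (auto simp: J_def)
  define B where "B = a ` J"
  define c where "c b y = (\<Sum>i\<in>{i\<in>J. a i = b}. g i y)" for b y
  have sJ: "(\<Sum>i\<in>J. g i y * tpow t (a i)) = (\<Sum>b\<in>B. c b y * tpow t b)" for t y
    unfolding B_def c_def using sum.image_gen[OF J(1), of "\<lambda>i. g i y * tpow t (a i)" a]
    by (simp add: sum_distrib_right)
  have "unif_o K (\<lambda>t y. \<Sum>i\<in>I-J. g i y * tpow t (a i))"
    using g J by (intro unif_o_sum unif_o_mult unif_bdd_bounded unif_o_constI little_o_tpow)
       (auto simp: J_def bcont_def)
  from unif_o_add[OF G this]
  have "unif_o K (\<lambda>t y. G t y - (\<Sum>b\<in>B. c b y * tpow t b))"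
    using sum.subset_diff[OF J(2) I, of "\<lambda>i. g i _ * tpow _ (a i)"] by (simp add: sJ)
  moreover have "finite B" "B \<subseteq> {0..1}" using J a by (auto simp: B_def J_def)
  moreover have "\<forall>b\<in>B. bcont K (c b)" unfolding c_def using g J by (auto intro!: bcont_sum)
  ultimately show ?thesis unfolding expandable_def uexp_def by blast
qed

lemma expandable_perturb:
  assumes "expandable K G" "unif_o K (\<lambda>t y. H t y - G t y)" shows "expandable K H"
proof -
  obtain B c where "uexp K G B c" using assms unfolding expandable_def by blast
  then have "uexp K H B c" using unif_o_add[OF assms(2), of "\<lambda>t y. G t y - (\<Sum>b\<in>B. c b y * tpow t b)"]
    unfolding uexp_def by simp
  then show ?thesis unfolding expandable_def by blast
qed

lemma expandable_static: "bcont K g \<Longrightarrow> expandable K (\<lambda>t y. g y)"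
  by (rule expandable_indexed[of "{()}" "\<lambda>_. 0" K "\<lambda>_. g"]) auto

lemma expandable_const: "expandable K (\<lambda>t y. a)"
  by (rule expandable_static) auto

lemma expandable_tpow: "0 \<le> b \<Longrightarrow> expandable K (\<lambda>t y. tpow t b)"
  by (rule expandable_indexed[of "{()}" "\<lambda>_. b" K "\<lambda>_ _. 1"]) auto

lemma uexp_bdd: assumes "uexp K G B c" shows "unif_bdd K (\<lambda>t y. \<Sum>b\<in>B. c b y * tpow t b)"
  using assms by (intro unif_bdd_sum unif_bdd_mult unif_bdd_bounded unif_bdd_tpow)
    (auto simp: uexp_def bcont_def)

lemma expandable_bdd: assumes "expandable K G" shows "unif_bdd K G"
proof -
  obtain B c where *: "uexp K G B c" using assms unfolding expandable_def by blast
  then have "unif_o K (\<lambda>t y. G t y - (\<Sum>b\<in>B. c b y * tpow t b))" unfolding uexp_def by blast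
  from unif_bdd_add[OF unif_o_imp_bdd[OF this] uexp_bdd[OF *]] show ?thesis by simp
qed

lemma expandable_add:
  assumes "expandable K G" "expandable K H" shows "expandable K (\<lambda>t y. G t y + H t y)"
proof -
  obtain B c B' c' where 1: "uexp K G B c" and 2: "uexp K H B' c'"
    using assms unfolding expandable_def by blast
  have "unif_o K (\<lambda>t y. (G t y - (\<Sum>b\<in>B. c b y * tpow t b)) + (H t y - (\<Sum>b\<in>B'. c' b y * tpow t b)))"
    using 1 2 unfolding uexp_def by (intro unif_o_add) auto
  then show ?thesis
    using 1 2 unfolding uexp_def
    by (intro expandable_indexed[of "B <+> B'" "case_sum id id" K "case_sum c c'"])
      (auto simp: sum.Plus algebra_simps)
qed

lemma expandable_mult:
  assumes "expandable K G" "expandable K H" shows "expandable K (\<lambda>t y. G t y * H t y)"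
proof -
  obtain B c B' c' where 1: "uexp K G B c" and 2: "uexp K H B' c'"
    using assms unfolding expandable_def by blast
  define P Q where "P t y = (\<Sum>b\<in>B. c b y * tpow t b)" and "Q t y = (\<Sum>b\<in>B'. c' b y * tpow t b)" for t y
  have PQ: "P t y * Q t y = (\<Sum>i\<in>B\<times>B'. (c (fst i) y * c' (snd i) y) * tpow t (fst i + snd i))" for t y
    unfolding P_def Q_def sum_product sum.cartesian_product
    using 1 2 by (intro sum.cong) (auto simp: uexp_def tpow_add subset_iff)
  have "unif_o K (\<lambda>t y. G t y * (H t y - Q t y) + Q t y * (G t y - P t y))"
    using 1 2 uexp_bdd[OF 2] expandable_bdd[OF assms(1)] unfolding P_def Q_def uexp_def
    by (intro unif_o_add unif_o_mult) auto
  then have "unif_o K (\<lambda>t y. G t y * H t y - P t y * Q t y)" by (simp add: algebra_simps)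
  then show ?thesis unfolding PQ
    using 1 2 by (intro expandable_indexed[of "B \<times> B'"]) (auto simp: uexp_def subset_iff intro!: bcont_mult)
qed

lemma expandable_sum: "(\<And>i. i \<in> I \<Longrightarrow> expandable K (G i)) \<Longrightarrow> expandable K (\<lambda>t y. \<Sum>i\<in>I. G i t y)"
  by (induction I rule: infinite_finite_induct) (auto intro!: expandable_add expandable_const)

lemma expandable_power: "expandable K G \<Longrightarrow> expandable K (\<lambda>t y. G t y ^ n)"
  by (induction n) (auto intro!: expandable_mult expandable_const)

lemma expandable_diff: "expandable K G \<Longrightarrow> expandable K H \<Longrightarrow> expandable K (\<lambda>t y. G t y - H t y)"
  using expandable_add[OF _ expandable_mult[OF expandable_const[of K "-1"]]] by simp

lemma expandable_subset: "expandable K G \<Longrightarrow> K' \<subseteq> K \<Longrightarrow> expandable K' G"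
  unfolding expandable_def uexp_def using unif_o_subset bcont_subset by meson

text \<open>The remainder bound \<open>e * t\<close> forces equality at t = 0, where
  \<open>tpow\<close> leaves only the exponent 0.\<close>

lemma uexp_at_zero:
  assumes "uexp K G B c" "y \<in> K" shows "G 0 y = (if 0 \<in> B then c 0 y else 0)"
proof -
  have "\<forall>\<^sub>F t in near0. \<forall>y\<in>K. \<bar>G t y - (\<Sum>b\<in>B. c b y * tpow t b)\<bar> \<le> 1 * t"
    using assms unfolding uexp_def unif_o_def by (meson zero_less_one)
  from eventually_near0_at0[OF this] assms(2)
  have "G 0 y = (\<Sum>b\<in>B. c b y * tpow 0 b)" by simp
  also have "\<dots> = (\<Sum>b\<in>B. if b = 0 then c b y else 0)" by (intro sum.cong) (auto simp: tpow_at_zero)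
  also have "\<dots> = (if 0 \<in> B then c 0 y else 0)" using assms by (simp add: uexp_def)
  finally show ?thesis .
qed

lemma expandable_at_zero: assumes "expandable K G" shows "bcont K (G 0)"
proof -
  obtain B c where 1: "uexp K G B c" using assms unfolding expandable_def by blast
  have "bcont K (if 0 \<in> B then c 0 else (\<lambda>_. 0))" using 1 by (auto simp: uexp_def)
  moreover have "\<And>y. y \<in> K \<Longrightarrow> G 0 y = (if 0 \<in> B then c 0 else (\<lambda>_. 0)) y" using uexp_at_zero[OF 1] by simp
  ultimately show ?thesis unfolding bcont_iff by (metis (no_types, lifting) continuous_on_cong)
qed

lemma expandable_infinitesimal_bound:
  assumes E: "expandable K E" and E0: "\<And>y. y \<in> K \<Longrightarrow> E 0 y = 0"
  obtains M a where "0 < a" "0 \<le> M" "\<forall>\<^sub>F t in near0. \<forall>y\<in>K. \<bar>E t y\<bar> \<le> M * tpow t a"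
proof -
  obtain B c where 1: "uexp K E B c" using E unfolding expandable_def by blast
  define B' where "B' = B - {0}"
  \<comment> \<open>The inserted 1 makes the set nonempty and keeps \<open>a\<close> at most 1, so
    that the remainder, which is below t, is also below \<open>tpow t a\<close>.\<close>
  define a where "a = Min (insert 1 B')"
  have fB': "finite B'" and B': "B' \<subseteq> {0<..1}" using 1 unfolding uexp_def B'_def by (auto simp: subset_iff less_le)
  have a: "0 < a" "a \<le> 1" "\<And>b. b \<in> B' \<Longrightarrow> a \<le> b"
    using fB' B' unfolding a_def by auto
  have "\<forall>b\<in>B. \<exists>M. \<forall>y\<in>K. \<bar>c b y\<bar> \<le> M" using 1 unfolding uexp_def bcont_iff by blast
  then obtain m where m: "\<And>b y. b \<in> B \<Longrightarrow> y \<in> K \<Longrightarrow> \<bar>c b y\<bar> \<le> m b" by metis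
  define M where "M = (\<Sum>b\<in>B'. \<bar>m b\<bar>) + 1"
  have M: "0 \<le> M" unfolding M_def by (simp add: sum_nonneg)
  have "\<forall>\<^sub>F t in near0. \<forall>y\<in>K. \<bar>E t y - (\<Sum>b\<in>B. c b y * tpow t b)\<bar> \<le> 1 * t"
    using 1 unfolding uexp_def unif_o_def by (meson zero_less_one)
  moreover have "\<forall>\<^sub>F t in near0. t < 1" by (rule near0_less) simp
  moreover note near0_nonneg
  ultimately have "\<forall>\<^sub>F t in near0. \<forall>y\<in>K. \<bar>E t y\<bar> \<le> M * tpow t a"
  proof eventually_elim
    case (elim t)
    show ?case
    proof
      fix y assume y: "y \<in> K"
      have "(\<Sum>b\<in>B. c b y * tpow t b) = (\<Sum>b\<in>B'. c b y * tpow t b)"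
        using 1 uexp_at_zero[OF 1 y] E0[OF y] unfolding B'_def uexp_def
        by (intro sum.mono_neutral_right) (auto split: if_splits)
      moreover have "\<bar>\<Sum>b\<in>B'. c b y * tpow t b\<bar> \<le> (\<Sum>b\<in>B'. \<bar>m b\<bar> * tpow t a)"
        using m y elim a
        by (intro order_trans[OF sum_abs] sum_mono)
          (auto simp: abs_mult B'_def intro!: mult_mono tpow_antimono order_trans[OF m abs_ge_self])
      moreover have "t = tpow t 1" using elim by (auto simp: tpow_def)
      moreover have "tpow t 1 \<le> tpow t a" using elim a by (intro tpow_antimono) auto
      moreover have "\<bar>E t y - (\<Sum>b\<in>B. c b y * tpow t b)\<bar> \<le> t" using elim y by simp
      ultimately show "\<bar>E t y\<bar> \<le> M * tpow t a"
        unfolding M_def distrib_right sum_distrib_right by linarith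
    qed
  qed
  with a M show thesis by (auto intro: that)
qed

text \<open>Nilpotency of infinitesimals, uniformly in y: a bound by a multiple of
  \<open>tpow t a\<close> with \<open>a > 0\<close> becomes o(t) once \<open>N * a > 1\<close>. It
  is what makes the Taylor expansions finite.\<close>

lemma expandable_infinitesimal_power:
  assumes E: "expandable K E" and E0: "\<And>y. y \<in> K \<Longrightarrow> E 0 y = 0"
  obtains N where "0 < N" "unif_o K (\<lambda>t y. E t y ^ N)"
proof -
  obtain M a where a: "0 < a" and M: "0 \<le> M" and *: "\<forall>\<^sub>F t in near0. \<forall>y\<in>K. \<bar>E t y\<bar> \<le> M * tpow t a"
    using expandable_infinitesimal_bound[OF assms] by blast
  obtain N :: nat where N: "1 < N * a" using a reals_Archimedean3 by blast
  have "N \<noteq> 0" using N by (intro notI) simp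
  have "unif_o K (\<lambda>t y. E t y ^ N)"
    unfolding unif_o_def
  proof (intro allI impI)
    fix e :: real assume e: "0 < e"
    have "unif_o K (\<lambda>t y. M ^ N * tpow t (N * a))"
      using N by (intro unif_o_cmult unif_o_constI little_o_tpow)
    then have "\<forall>\<^sub>F t in near0. \<forall>y\<in>K. \<bar>M ^ N * tpow t (N * a)\<bar> \<le> e * t" using e unfolding unif_o_def by blast
    with * show "\<forall>\<^sub>F t in near0. \<forall>y\<in>K. \<bar>E t y ^ N\<bar> \<le> e * t"
    proof eventually_elim
      case (elim t)
      show ?case
      proof
        fix y assume y: "y \<in> K"
        have "\<bar>E t y ^ N\<bar> = \<bar>E t y\<bar> ^ N" by (simp add: power_abs)
        also have "\<dots> \<le> (M * tpow t a) ^ N" using elim y by (intro power_mono) auto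
        also have "\<dots> = M ^ N * tpow t (N * a)" using a by (simp add: power_mult_distrib tpow_power)
        also have "\<dots> \<le> e * t" using elim y by force
        finally show "\<bar>E t y ^ N\<bar> \<le> e * t" .
      qed
    qed
  qed
  then show thesis using \<open>N \<noteq> 0\<close> by (intro that[of N]) auto
qed

text \<open>If some coefficient were nonzero, division by the power with the least such exponent
  \<open>m\<close> would leave the limit \<open>a m\<close> as t tends to 0, whereas the little-o
  hypothesis gives the limit 0.\<close>

lemma little_o_tpow_sum_zero:
  assumes B: "finite B" "B \<subseteq> {0..1}" and o: "little_o (\<lambda>t. \<Sum>b\<in>B. a b * tpow t b)" and b: "b \<in> B"
  shows "a b = 0"
proof (rule ccontr)
  assume ab: "a b \<noteq> 0"
  define C where "C = {b\<in>B. a b \<noteq> 0}"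
  define m where "m = Min C"
  have C: "finite C" "C \<noteq> {}" using B b ab by (auto simp: C_def)
  then have m: "m \<in> C" "\<And>b. b \<in> C \<Longrightarrow> m \<le> b" unfolding m_def by auto
  have m01: "0 \<le> m" "m \<le> 1" "m \<in> B" "a m \<noteq> 0" using m B by (auto simp: C_def)
  let ?S = "\<lambda>t. \<Sum>b\<in>B. a b * tpow t b"
  have lim1: "((\<lambda>t. \<Sum>b\<in>C. a b * t powr (b - m)) \<longlongrightarrow> (\<Sum>b\<in>C. if b = m then a m else 0)) (at_right 0)"
  proof (rule tendsto_sum)
    fix b assume b: "b \<in> C"
    show "((\<lambda>t. a b * t powr (b - m)) \<longlongrightarrow> (if b = m then a m else 0)) (at_right 0)"
    proof (cases "b = m")
      case True
      have "\<forall>\<^sub>F t in at_right (0::real). a m = a b * t powr (b - m)"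
        using eventually_at_right_less[of "0::real"] by eventually_elim (simp add: True)
      then show ?thesis using True by (auto intro: tendsto_eventually elim: eventually_mono)
    next
      case False
      then have "0 < b - m" using m(2)[OF b] by simp
      then have "((\<lambda>t. t powr (b - m)) \<longlongrightarrow> 0) (at_right 0)" by real_asymp
      from tendsto_mult[OF tendsto_const this] show ?thesis using False by simp
    qed
  qed
  \<comment> \<open>Here \<open>m \<le> 1\<close> matters: the factor \<open>t powr (1 - m)\<close>
    stays bounded, so division by \<open>t powr m\<close> instead of t still gives the limit
    0.\<close>
  have "((\<lambda>t. (?S t / t) * t powr (1 - m)) \<longlongrightarrow> 0) (at_right 0)"
  proof (cases "m = 1")
    case True
    have "((\<lambda>t. ?S t / t) \<longlongrightarrow> 0) (at_right 0)" using o unfolding little_o_def by blast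
    moreover have "\<forall>\<^sub>F t in at_right (0::real). ?S t / t = (?S t / t) * t powr (1 - m)"
        using eventually_at_right_less[of "0::real"] by eventually_elim (simp add: True)
    ultimately show ?thesis by (rule Lim_transform_eventually)
  next
    case False
    then have "0 < 1 - m" using m01 by simp
    then have "((\<lambda>t. t powr (1 - m)) \<longlongrightarrow> 0) (at_right 0)" by real_asymp
    moreover have "((\<lambda>t. ?S t / t) \<longlongrightarrow> 0) (at_right 0)" using o unfolding little_o_def by blast
    ultimately show ?thesis using tendsto_mult[of "\<lambda>t. ?S t / t" 0 "at_right 0" "\<lambda>t. t powr (1 - m)" 0] by simp
  qed
  moreover have "\<forall>\<^sub>F t in at_right (0::real). (?S t / t) * t powr (1 - m) = (\<Sum>b\<in>C. a b * t powr (b - m))"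
    using eventually_at_right_less[of "0::real"]
  proof eventually_elim
    case (elim t)
    have "?S t = (\<Sum>b\<in>C. a b * tpow t b)" using B by (intro sum.mono_neutral_right) (auto simp: C_def)
    also have "\<dots> = (\<Sum>b\<in>C. a b * t powr (b - m)) * t powr m"
      unfolding sum_distrib_right using elim by (intro sum.cong) (auto simp: tpow_def powr_diff)
    finally show ?case using elim by (simp add: powr_diff)
  qed
  ultimately have "((\<lambda>t. \<Sum>b\<in>C. a b * t powr (b - m)) \<longlongrightarrow> 0) (at_right 0)"
    by (rule Lim_transform_eventually)
  from tendsto_unique[OF _ this lim1] have "(\<Sum>b\<in>C. if b = m then a m else 0) = 0" by simp
  then show False using C m m01 by simp
qed

text \<open>Membership in \<open>Ro\<close> is expandability of a family that does not depend on y;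
  closure of \<open>Ro\<close> under sums, products and smooth functions is inherited in this
  way.\<close>

lemma Ro_iff_expandable:
  assumes "K \<noteq> {}" shows "x \<in> Ro \<longleftrightarrow> expandable K (\<lambda>t y. x t)"
proof
  assume "x \<in> Ro"
  then obtain k :: nat and r \<alpha> a where a: "\<forall>i<k. 0 \<le> a i" and
    o: "little_o (\<lambda>t. x t - (r + (\<Sum>i<k. \<alpha> i * tpow t (a i))))" unfolding Ro_def by blast
  have "expandable K (\<lambda>t y. r + (\<Sum>i<k. \<alpha> i * tpow t (a i)))"
    using a by (intro expandable_add expandable_const expandable_sum expandable_mult expandable_tpow) auto
  then show "expandable K (\<lambda>t y. x t)" by (rule expandable_perturb) (rule unif_o_constI[OF o])
next
  assume "expandable K (\<lambda>t y. x t)"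
  then obtain B c where 1: "uexp K (\<lambda>t y. x t) B c" unfolding expandable_def by blast
  obtain y where y: "y \<in> K" using assms by blast
  have o: "little_o (\<lambda>t. x t - (\<Sum>b\<in>B. c b y * tpow t b))"
    using 1 y unfolding uexp_def unif_o_def little_o_iff
    by (auto elim!: eventually_mono)
  obtain h where h: "bij_betw h {..<card B} B"
    using 1 ex_bij_betw_nat_finite unfolding uexp_def lessThan_atLeast0 by blast
  have "(\<Sum>b\<in>B. c b y * tpow t b) = 0 + (\<Sum>i<card B. c (h i) y * tpow t (h i))" for t
    using sum.reindex_bij_betw[OF h, of "\<lambda>b. c b y * tpow t b"] by simp
  moreover have "\<forall>i<card B. 0 \<le> h i" using h 1 unfolding bij_betw_def uexp_def by force
  ultimately show "x \<in> Ro" using o unfolding Ro_def by (intro CollectI exI[of _ "card B"] exI[of _ 0] exI[of _ "\<lambda>i. c (h i) y"] exI[of _ h]) auto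
qed

subsection \<open>Smooth functions of one variable and smooth families\<close>

lemma unif_o_le:
  assumes "\<forall>\<^sub>F t in near0. \<forall>y\<in>K. \<bar>S t y\<bar> \<le> M * \<bar>R t y\<bar>" and "unif_o K R"
  shows "unif_o K S"
  unfolding unif_o_def
proof (intro allI impI)
  fix e :: real assume e: "e > 0"
  have "unif_o K (\<lambda>t y. M * R t y)" by (rule unif_o_cmult[OF assms(2)])
  then have "\<forall>\<^sub>F t in near0. \<forall>y\<in>K. \<bar>M * R t y\<bar> \<le> e * t" using e unfolding unif_o_def by blast
  with assms(1) show "\<forall>\<^sub>F t in near0. \<forall>y\<in>K. \<bar>S t y\<bar> \<le> e * t"
  proof eventually_elim
    case (elim t)
    show ?case
    proof
      fix y assume "y \<in> K"
      then have 1: "\<bar>S t y\<bar> \<le> M * \<bar>R t y\<bar>" "\<bar>M * R t y\<bar> \<le> e * t" using elim by auto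
      have "M * \<bar>R t y\<bar> \<le> \<bar>M * R t y\<bar>" by (simp add: abs_mult mult_right_mono)
      with 1 show "\<bar>S t y\<bar> \<le> e * t" by linarith
    qed
  qed
qed

text \<open>A chain \<open>D\<close> of derivatives instead of iterated \<open>deriv\<close> lets
  the same bound serve partial derivatives along a coordinate line. The factor
  \<open>1 / fact N\<close> of Lagrange's remainder is estimated by 1.\<close>

lemma Taylor_remainder_bound:
  fixes D :: "nat \<Rightarrow> real \<Rightarrow> real"
  assumes N: "0 < N"
    and D: "\<And>m \<xi>. m < N \<Longrightarrow> \<bar>\<xi> - z\<bar> \<le> \<bar>h\<bar> \<Longrightarrow> (D m has_real_derivative D (Suc m) \<xi>) (at \<xi>)"
    and M: "\<And>\<xi>. \<bar>\<xi> - z\<bar> \<le> \<bar>h\<bar> \<Longrightarrow> \<bar>D N \<xi>\<bar> \<le> M"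
  shows "\<bar>D 0 (z + h) - (\<Sum>m<N. D m z / fact m * h ^ m)\<bar> \<le> M * \<bar>h ^ N\<bar>"
proof (cases "h = 0")
  case True
  have "(\<Sum>m<N. D m z / fact m * h ^ m) = (\<Sum>m<N. if m = 0 then D 0 z else 0)"
    using True by (intro sum.cong) auto
  then show ?thesis using True N by (simp add: power_0_left)
next
  case False
  have "\<exists>t. (if z + h < z then z + h < t \<and> t < z else z < t \<and> t < z + h) \<and>
    D 0 (z + h) = (\<Sum>m<N. (D m z / fact m) * (z + h - z)^m) + (D N t / fact N) * (z + h - z)^N"
    using False by (intro Taylor[where a = "z - \<bar>h\<bar>" and b = "z + \<bar>h\<bar>"] N D allI impI) auto
  then obtain t where t: "if z + h < z then z + h < t \<and> t < z else z < t \<and> t < z + h"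
    and eq: "D 0 (z + h) = (\<Sum>m<N. D m z / fact m * h ^ m) + D N t / fact N * h ^ N" by auto
  have "\<bar>D N t\<bar> \<le> M" using t by (intro M) (auto split: if_splits)
  moreover have "\<bar>D N t\<bar> / fact N \<le> \<bar>D N t\<bar> / 1" by (intro divide_left_mono) (auto simp: fact_ge_1)
  ultimately have "\<bar>D N t / fact N\<bar> \<le> M" by simp
  then have "\<bar>D N t / fact N\<bar> * \<bar>h ^ N\<bar> \<le> M * \<bar>h ^ N\<bar>" by (intro mult_right_mono) auto
  then show ?thesis unfolding eq by (simp only: abs_mult add_diff_cancel_left')
qed

definition smooth1 :: "real set \<Rightarrow> (real \<Rightarrow> real) \<Rightarrow> bool" where
  "smooth1 V c \<longleftrightarrow> (\<forall>n. \<forall>x\<in>V. ((deriv ^^ n) c has_real_derivative (deriv ^^ Suc n) c x) (at x))"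

lemma smooth1D: "smooth1 V c \<Longrightarrow> x \<in> V \<Longrightarrow> ((deriv ^^ n) c has_real_derivative (deriv ^^ Suc n) c x) (at x)"
  unfolding smooth1_def by blast

lemma smooth1_deriv: "smooth1 V c \<Longrightarrow> smooth1 V (deriv c)"
proof -
  have "(deriv ^^ n) (deriv c) = (deriv ^^ Suc n) c" for n by (simp add: funpow_swap1)
  moreover assume "smooth1 V c"
  ultimately show ?thesis unfolding smooth1_def by (simp only:) blast
qed

lemma smooth1_DERIV: "smooth1 V c \<Longrightarrow> x \<in> V \<Longrightarrow> (c has_real_derivative deriv c x) (at x)"
  using smooth1D[of V c x 0] by simp

lemma smooth1_subset: "smooth1 V c \<Longrightarrow> W \<subseteq> V \<Longrightarrow> smooth1 W c"
  unfolding smooth1_def by blast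

lemma smooth1_continuous_on: "smooth1 V c \<Longrightarrow> K \<subseteq> V \<Longrightarrow> continuous_on K ((deriv ^^ n) c)"
  by (meson DERIV_isCont continuous_at_imp_continuous_on smooth1D subsetD)

lemma deriv_cong_open:
  assumes "open V" "x \<in> V" "\<And>y. y \<in> V \<Longrightarrow> f y = g y" shows "deriv f x = deriv g x"
  using assms by (intro deriv_cong_ev eventually_nhds_in_open[THEN eventually_mono]) auto

lemma higher_deriv_cong_open:
  assumes "open V" "\<And>y. y \<in> V \<Longrightarrow> f y = g y"
  shows "x \<in> V \<Longrightarrow> (deriv ^^ n) f x = (deriv ^^ n) g x"
proof (induction n arbitrary: x)
  case (Suc n)
  then show ?case using deriv_cong_open[OF assms(1), of x "(deriv ^^ n) f" "(deriv ^^ n) g"] by simp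
qed (use assms in simp)

lemma smooth1_cong:
  assumes "open V" "\<And>y. y \<in> V \<Longrightarrow> f y = g y" "smooth1 V f" shows "smooth1 V g"
  unfolding smooth1_def
proof (intro allI ballI)
  fix n x assume x: "x \<in> V"
  have "((deriv ^^ n) f has_real_derivative (deriv ^^ Suc n) g x) (at x)"
    using smooth1D[OF assms(3) x, of n] higher_deriv_cong_open[of V f g x "Suc n"] assms(1,2) x by (simp only:)
  then show "((deriv ^^ n) g has_real_derivative (deriv ^^ Suc n) g x) (at x)"
    by (rule has_field_derivative_transform_within_open[OF _ assms(1) x])
      (use assms(2) in \<open>auto intro: higher_deriv_cong_open[OF assms(1)]\<close>)
qed

lemma smooth1_primitive:
  assumes "open V" "\<And>x. x \<in> V \<Longrightarrow> (C has_real_derivative c x) (at x)" "smooth1 V c"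
  shows "smooth1 V C"
  unfolding smooth1_def
proof (intro allI ballI)
  fix n x assume x: "x \<in> V"
  have eq: "deriv C y = c y" if "y \<in> V" for y using assms(2)[OF that] by (rule DERIV_imp_deriv)
  have "smooth1 V (deriv C)" by (rule smooth1_cong[OF assms(1) _ assms(3)]) (simp add: eq)
  then show "((deriv ^^ n) C has_real_derivative (deriv ^^ Suc n) C x) (at x)"
    using smooth1D[of V "deriv C" x "n - 1"] assms(2)[OF x] eq x
    by (cases n) (auto simp: funpow_swap1)
qed

lemma smooth1_const: "smooth1 V (\<lambda>_. a)"
proof -
  have *: "(deriv ^^ n) (\<lambda>_. a) = (\<lambda>_. if n = 0 then a else 0)" for n by (induction n) auto
  show ?thesis unfolding smooth1_def * by simp
qed

text \<open>By nilpotency of \<open>\<phi> t y - \<phi> 0 y\<close>: a distance of at least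
  \<open>\<epsilon>\<close> would have an N-th power of at least \<open>\<epsilon> ^ N\<close>,
  whereas the o(t) bound keeps that power below \<open>\<epsilon> ^ N / 2\<close>.\<close>

lemma expandable_near:
  assumes "expandable K \<phi>" "\<epsilon> > 0"
  shows "\<forall>\<^sub>F t in near0. \<forall>y\<in>K. \<bar>\<phi> t y - \<phi> 0 y\<bar> < \<epsilon>"
proof -
  have "expandable K (\<lambda>t y. \<phi> t y - \<phi> 0 y)"
    by (intro expandable_diff assms expandable_static expandable_at_zero)
  then obtain N where N: "0 < N" and o: "unif_o K (\<lambda>t y. (\<phi> t y - \<phi> 0 y) ^ N)"
    by (rule expandable_infinitesimal_power) auto
  have pos: "\<epsilon> ^ N / 2 > 0" using assms by simp
  have "\<forall>\<^sub>F t in near0. \<forall>y\<in>K. \<bar>(\<phi> t y - \<phi> 0 y) ^ N\<bar> \<le> \<epsilon> ^ N / 2 * t"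
    using o pos unfolding unif_o_def by blast
  moreover have "\<forall>\<^sub>F t in near0. t < 1" by (rule near0_less) simp
  ultimately show ?thesis
  proof eventually_elim
    case (elim t)
    show ?case
    proof (rule ballI, rule ccontr)
      fix y assume y: "y \<in> K" and "\<not> \<bar>\<phi> t y - \<phi> 0 y\<bar> < \<epsilon>"
      then have "\<epsilon> ^ N \<le> \<bar>\<phi> t y - \<phi> 0 y\<bar> ^ N" using assms(2) by (intro power_mono) auto
      also have "\<dots> \<le> \<epsilon> ^ N / 2 * t" using elim(1) y by (simp add: power_abs)
      also have "\<dots> < \<epsilon> ^ N / 2 * 1" using elim(2) pos by (intro mult_strict_left_mono) auto
      finally show False using pos by simp
    qed
  qed
qed

lemma compact_bound:
  assumes "compact Z" "continuous_on Z f" obtains M where "\<And>z. z \<in> Z \<Longrightarrow> \<bar>f z :: real\<bar> \<le> M"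
  using compact_imp_bounded[OF compact_continuous_image[OF assms(2,1)]] unfolding bounded_iff by auto

lemma bcont_compose:
  assumes "bcont K g" "g ` K \<subseteq> Z" "compact Z" "continuous_on Z f" shows "bcont K (\<lambda>y. f (g y))"
proof -
  obtain M where "\<And>z. z \<in> Z \<Longrightarrow> \<bar>f z\<bar> \<le> M" using compact_bound assms by blast
  then show ?thesis using assms unfolding bcont_iff
    by (auto intro!: continuous_on_compose2[of Z f K g])
qed

text \<open>Taylor's formula around the standard part \<open>\<phi> 0 y\<close>, up to an order N
  for which the N-th power of the infinitesimal part is o(t). The coefficients are derivatives of
  \<open>C\<close> at points of the compact set \<open>Z\<close>, hence bounded.\<close>

lemma expandable_compose:
  assumes \<phi>: "expandable K \<phi>" and Z: "compact Z" "\<phi> 0 ` K \<subseteq> Z" and V: "Z \<subseteq> V" "open V"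
    and C: "smooth1 V C"
  shows "expandable K (\<lambda>t y. C (\<phi> t y))"
proof -
  obtain \<epsilon> where \<epsilon>: "\<epsilon> > 0" "(\<Union>x\<in>Z. cball x \<epsilon>) \<subseteq> V"
    using compact_subset_open_imp_cball_epsilon_subset[OF Z(1) V(2,1)] by blast
  \<comment> \<open>The closed \<open>\<epsilon>\<close>-neighbourhood of \<open>Z\<close> is
    compact, lies in \<open>V\<close> and contains the segments from \<open>\<phi> 0 y\<close> to
    \<open>\<phi> t y\<close> for small t, so one bound \<open>M\<close> serves all
    remainders.\<close>
  define Q where "Q = {x + y | x y. x \<in> Z \<and> y \<in> cball 0 \<epsilon>}"
  have Q: "compact Q" unfolding Q_def by (intro compact_sums Z compact_cball)
  have Qi: "z \<in> Q" if "x \<in> Z" "\<bar>z - x\<bar> \<le> \<epsilon>" for x z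
    unfolding Q_def using that by (intro CollectI exI[of _ x] exI[of _ "z - x"]) auto
  have QV: "Q \<subseteq> V" unfolding Q_def using \<epsilon>(2) by (force simp: dist_real_def subset_iff)
  define E where "E t y = \<phi> t y - \<phi> 0 y" for t y
  have E: "expandable K E" unfolding E_def
    by (intro expandable_diff \<phi> expandable_static expandable_at_zero)
  obtain N where N: "0 < N" and o: "unif_o K (\<lambda>t y. E t y ^ N)"
    using expandable_infinitesimal_power[OF E] unfolding E_def by auto
  obtain M where M: "\<And>z. z \<in> Q \<Longrightarrow> \<bar>(deriv ^^ N) C z\<bar> \<le> M"
    using compact_bound[OF Q smooth1_continuous_on[OF C QV]] by blast
  define T where "T t y = (\<Sum>m<N. (deriv ^^ m) C (\<phi> 0 y) / fact m * E t y ^ m)" for t y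
  have T: "expandable K T" unfolding T_def divide_inverse
    by (intro expandable_sum expandable_mult expandable_power E expandable_const expandable_static
       bcont_compose[OF expandable_at_zero[OF \<phi>] Z(2,1)] smooth1_continuous_on[OF C V(1)])
  have "unif_o K (\<lambda>t y. C (\<phi> t y) - T t y)"
  proof (rule unif_o_le[OF _ o])
    show "\<forall>\<^sub>F t in near0. \<forall>y\<in>K. \<bar>C (\<phi> t y) - T t y\<bar> \<le> M * \<bar>E t y ^ N\<bar>"
      using expandable_near[OF \<phi> \<epsilon>(1)]
    proof eventually_elim
      case (elim t)
      show ?case
      proof
        fix y assume y: "y \<in> K"
        have le: "\<bar>E t y\<bar> \<le> \<epsilon>" using elim y unfolding E_def by force
        have "\<phi> 0 y \<in> Z" using y Z by blast
        then have q: "\<bar>\<xi> - \<phi> 0 y\<bar> \<le> \<bar>E t y\<bar> \<Longrightarrow> \<xi> \<in> Q" for \<xi> using le by (intro Qi[of "\<phi> 0 y"]) auto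
        have "\<bar>(deriv ^^ 0) C (\<phi> 0 y + E t y) - T t y\<bar> \<le> M * \<bar>E t y ^ N\<bar>"
          unfolding T_def by (intro Taylor_remainder_bound N M q smooth1D[OF C] subsetD[OF QV])
        then show "\<bar>C (\<phi> t y) - T t y\<bar> \<le> M * \<bar>E t y ^ N\<bar>" by (simp add: E_def)
      qed
    qed
  qed
  then show ?thesis by (rule expandable_perturb[OF T])
qed

section \<open>Families differentiable in the real variable\<close>

lemma Ro_expandable: "x \<in> Ro \<Longrightarrow> expandable K (\<lambda>t y. x t)"
  using Ro_iff_expandable[of UNIV x] expandable_subset[of UNIV "\<lambda>t y. x t" K] by simp

text \<open>The derivative family is asked for only near t = 0, on a neighbourhood that may shrink
  as the order grows; hence a finite order \<open>n\<close>, to be used for every \<open>n\<close>,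
  instead of smoothness of \<open>G t\<close> for fixed t. Each derivative must be expandable again,
  which is what carries smoothness over to the coefficients.\<close>

primrec sfam :: "nat \<Rightarrow> real set \<Rightarrow> (real \<Rightarrow> real \<Rightarrow> real) \<Rightarrow> bool" where
  "sfam 0 V G \<longleftrightarrow> expandable V G"
| "sfam (Suc n) V G \<longleftrightarrow> expandable V G \<and>
     (\<exists>H. (\<forall>\<^sub>F t in near0. \<forall>y\<in>V. (G t has_real_derivative H t y) (at y)) \<and> sfam n V H)"

lemma sfam_expandable: "sfam n V G \<Longrightarrow> expandable V G"
  by (cases n) auto

lemma sfam_SucD: "sfam (Suc n) V G \<Longrightarrow> sfam n V G"
proof (induction n arbitrary: G)
  case (Suc n)
  from Suc.prems obtain H where "\<forall>\<^sub>F t in near0. \<forall>y\<in>V. (G t has_real_derivative H t y) (at y)" "sfam (Suc n) V H"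
    by (subst (asm) sfam.simps(2)) blast
  then show ?case using Suc sfam_expandable[OF Suc.prems] by auto
qed auto

lemma sfam_add: "sfam n V G \<Longrightarrow> sfam n V G' \<Longrightarrow> sfam n V (\<lambda>t y. G t y + G' t y)"
proof (induction n arbitrary: G G')
  case (Suc n)
  obtain H H' where H: "\<forall>\<^sub>F t in near0. \<forall>y\<in>V. (G t has_real_derivative H t y) (at y)" "sfam n V H"
     "\<forall>\<^sub>F t in near0. \<forall>y\<in>V. (G' t has_real_derivative H' t y) (at y)" "sfam n V H'"
    using Suc.prems by auto
  have "\<forall>\<^sub>F t in near0. \<forall>y\<in>V. ((\<lambda>y. G t y + G' t y) has_real_derivative H t y + H' t y) (at y)"
    using H(1,3) by eventually_elim (auto intro!: DERIV_add)
  then show ?case using Suc.IH[OF H(2,4)] Suc.prems by (auto intro!: expandable_add exI[of _ "\<lambda>t y. H t y + H' t y"])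
qed (auto intro: expandable_add)

lemma sfam_mult: "sfam n V G \<Longrightarrow> sfam n V G' \<Longrightarrow> sfam n V (\<lambda>t y. G t y * G' t y)"
proof (induction n arbitrary: G G')
  case (Suc n)
  obtain H H' where H: "\<forall>\<^sub>F t in near0. \<forall>y\<in>V. (G t has_real_derivative H t y) (at y)" "sfam n V H"
     "\<forall>\<^sub>F t in near0. \<forall>y\<in>V. (G' t has_real_derivative H' t y) (at y)" "sfam n V H'"
    using Suc.prems by auto
  have "\<forall>\<^sub>F t in near0. \<forall>y\<in>V. ((\<lambda>y. G t y * G' t y) has_real_derivative H t y * G' t y + H' t y * G t y) (at y)"
    using H(1,3) by eventually_elim (auto intro!: DERIV_mult)
  moreover have "sfam n V (\<lambda>t y. H t y * G' t y + H' t y * G t y)"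
    using H sfam_SucD[OF Suc.prems(1)] sfam_SucD[OF Suc.prems(2)] by (intro sfam_add Suc.IH)
  ultimately show ?case using Suc.prems by (auto intro!: expandable_mult)
qed (auto intro: expandable_mult)

lemma sfam_param: "x \<in> Ro \<Longrightarrow> sfam n V (\<lambda>t y. x t)"
proof (induction n arbitrary: x)
  case (Suc n)
  have "sfam n V (\<lambda>t y. (\<lambda>_. 0) t)" by (intro Suc.IH zero_in_Ro)
  then show ?case using Suc.prems by (auto intro!: Ro_expandable exI[of _ "\<lambda>t y. 0"])
qed (auto intro: Ro_expandable)

lemma sfam_sum: "(\<And>i. i \<in> I \<Longrightarrow> sfam n V (G i)) \<Longrightarrow> sfam n V (\<lambda>t y. \<Sum>i\<in>I. G i t y)"
  by (induction I rule: infinite_finite_induct) (auto intro!: sfam_add sfam_param[OF zero_in_Ro])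

lemma bcont_smooth1: "smooth1 W c \<Longrightarrow> V \<subseteq> K \<Longrightarrow> compact K \<Longrightarrow> K \<subseteq> W \<Longrightarrow> bcont V ((deriv ^^ n) c)"
  unfolding bcont_def
  by (meson bounded_subset compact_continuous_image compact_imp_bounded continuous_on_subset image_mono
      smooth1_continuous_on)

lemma sfam_static:
  "smooth1 W c \<Longrightarrow> V \<subseteq> K \<Longrightarrow> compact K \<Longrightarrow> K \<subseteq> W \<Longrightarrow> sfam n V (\<lambda>t y. c y)"
proof (induction n arbitrary: c)
  case 0
  then show ?case using bcont_smooth1[of W c V K 0] by (auto intro: expandable_static)
next
  case (Suc n)
  have "sfam n V (\<lambda>t y. deriv c y)" using Suc by (intro Suc.IH smooth1_deriv)
  moreover have "\<forall>\<^sub>F t in near0. \<forall>y\<in>V. (c has_real_derivative deriv c y) (at y)"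
    using Suc.prems by (intro always_eventually) (auto intro: smooth1_DERIV)
  ultimately show ?case using Suc.prems bcont_smooth1[of W c V K 0] 
    by (auto intro!: expandable_static exI[of _ "\<lambda>t. deriv c"])
qed

text \<open>The chain rule reduces the next order for \<open>C\<close> to the present order for
  \<open>deriv C\<close>, so the induction varies \<open>C\<close> and keeps \<open>\<phi>\<close>.
  Compactness of \<open>Z\<close> keeps \<open>\<phi> t y\<close> inside \<open>W\<close> for all y
  at once.\<close>

lemma sfam_compose:
  assumes Z: "compact Z" "\<phi> 0 ` V \<subseteq> Z" "Z \<subseteq> W" "open W"
  shows "smooth1 W C \<Longrightarrow> sfam n V \<phi> \<Longrightarrow> sfam n V (\<lambda>t y. C (\<phi> t y))"
proof (induction n arbitrary: C)
  case 0
  then show ?case using expandable_compose[of V \<phi> Z W C] Z by simp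
next
  case (Suc n)
  obtain H where H: "\<forall>\<^sub>F t in near0. \<forall>y\<in>V. (\<phi> t has_real_derivative H t y) (at y)" "sfam n V H"
    using Suc.prems by auto
  have ex: "expandable V \<phi>" using Suc.prems by simp
  obtain \<epsilon> where \<epsilon>: "\<epsilon> > 0" "(\<Union>x\<in>Z. cball x \<epsilon>) \<subseteq> W"
    using compact_subset_open_imp_cball_epsilon_subset[OF Z(1) Z(4,3)] by blast
  have "\<forall>\<^sub>F t in near0. \<forall>y\<in>V. ((\<lambda>y. C (\<phi> t y)) has_real_derivative deriv C (\<phi> t y) * H t y) (at y)"
    using H(1) expandable_near[OF ex \<epsilon>(1)]
  proof eventually_elim
    case (elim t)
    show ?case
    proof
      fix y assume y: "y \<in> V"
      have "\<phi> t y \<in> cball (\<phi> 0 y) \<epsilon>" using elim(2) y by (force simp: dist_real_def)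
      then have "\<phi> t y \<in> W" using \<epsilon>(2) y Z(2) by blast
      then show "((\<lambda>y. C (\<phi> t y)) has_real_derivative deriv C (\<phi> t y) * H t y) (at y)"
        using elim(1) y by (intro DERIV_chain2[of C] smooth1_DERIV[OF Suc.prems(1)]) auto
    qed
  qed
  moreover have "sfam n V (\<lambda>t y. deriv C (\<phi> t y) * H t y)"
    by (rule sfam_mult[OF Suc.IH[OF smooth1_deriv[OF Suc.prems(1)] sfam_SucD[OF Suc.prems(2)]] H(2)])
  moreover have "expandable V (\<lambda>t y. C (\<phi> t y))" using expandable_compose[of V \<phi> Z W C] ex Z Suc.prems(1) by simp
  ultimately show ?case by auto
qed

subsection \<open>Expansion of parametrized smooth functions\<close>

definition vec_snoc :: "nat \<Rightarrow> (nat \<Rightarrow> real) \<Rightarrow> real \<Rightarrow> nat \<Rightarrow> real" where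
  "vec_snoc d q y = (\<lambda>i. if i < d then q i else 0)(d := y)"

lemma vec_snoc_Rn: "vec_snoc d q y \<in> Rn (Suc d)"
  by (auto simp: vec_snoc_def Rn_def)

lemma edist_le_sum: "edist d x y \<le> (\<Sum>i<d. \<bar>x i - y i\<bar>)"
  unfolding edist_def using L2_set_le_sum_abs[of "\<lambda>i. x i - y i" "{..<d}"] by (simp add: L2_set_def)

lemma edist_ge_coord: "i < d \<Longrightarrow> \<bar>x i - y i\<bar> \<le> edist d x y"
  unfolding edist_def using member_le_L2_set[of "{..<d}" i "\<lambda>i. \<bar>x i - y i\<bar>"] by (simp add: L2_set_def)

lemma edist_vec_snoc:
  assumes "\<And>i. i < d \<Longrightarrow> \<bar>q i - p i\<bar> \<le> \<delta>"
  shows "edist (Suc d) (vec_snoc d p z) (vec_snoc d q y) \<le> d * \<delta> + \<bar>z - y\<bar>"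
proof -
  have "edist (Suc d) (vec_snoc d p z) (vec_snoc d q y) \<le> (\<Sum>i<d. \<bar>p i - q i\<bar>) + \<bar>z - y\<bar>"
    by (rule order_trans[OF edist_le_sum]) (simp add: vec_snoc_def)
  also have "(\<Sum>i<d. \<bar>p i - q i\<bar>) \<le> (\<Sum>i<d. \<delta>)"
    using assms by (intro sum_mono) (auto simp: abs_minus_commute)
  finally show ?thesis by simp
qed

text \<open>Openness of \<open>U\<close> and continuity of \<open>h\<close> give a radius at each
  point of the slice over \<open>K\<close>; intervals of half that radius around finitely many
  points cover \<open>K\<close>. The resulting tube provides one remainder bound for all y in
  \<open>K\<close>.\<close>

lemma cont_Rn_bounded_near_compact:
  assumes U: "open_Rn (Suc d) U" and h: "cont_Rn (Suc d) U h" and K: "compact K"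
    and pU: "\<And>y. y \<in> K \<Longrightarrow> vec_snoc d p y \<in> U"
  obtains \<delta> M where "\<delta> > 0"
    "\<And>y q. y \<in> K \<Longrightarrow> (\<And>i. i < d \<Longrightarrow> \<bar>q i - p i\<bar> \<le> \<delta>) \<Longrightarrow> vec_snoc d q y \<in> U \<and> \<bar>h (vec_snoc d q y)\<bar> \<le> M"
proof (cases "K = {}")
  case True then show thesis using that[of 1] by simp
next
  case False
  have "\<exists>e>0. \<forall>x\<in>Rn (Suc d). edist (Suc d) (vec_snoc d p z) x < e \<longrightarrow> x \<in> U \<and> \<bar>h x - h (vec_snoc d p z)\<bar> < 1"
    if z: "z \<in> K" for z
  proof -
    obtain e1 where "e1 > 0" "\<forall>x\<in>Rn (Suc d). edist (Suc d) (vec_snoc d p z) x < e1 \<longrightarrow> x \<in> U"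
      using U pU[OF z] unfolding open_Rn_def by blast
    moreover obtain e2 where "e2 > 0"
        "\<forall>x\<in>U. edist (Suc d) (vec_snoc d p z) x < e2 \<longrightarrow> \<bar>h x - h (vec_snoc d p z)\<bar> < 1"
      using h pU[OF z] unfolding cont_Rn_def by (meson zero_less_one)
    ultimately show ?thesis by (intro exI[of _ "min e1 e2"]) auto
  qed
  then obtain e where e: "\<And>z. z \<in> K \<Longrightarrow> e z > 0" and
    eU: "\<And>z x. z \<in> K \<Longrightarrow> x \<in> Rn (Suc d) \<Longrightarrow> edist (Suc d) (vec_snoc d p z) x < e z \<Longrightarrow>
      x \<in> U \<and> \<bar>h x - h (vec_snoc d p z)\<bar> < 1" by metis
  obtain T where T: "T \<subseteq> K" "finite T" "K \<subseteq> (\<Union>z\<in>T. ball z (e z / 2))"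
    using compactE_image[OF K, of K "\<lambda>z. ball z (e z / 2)"] e by force
  have "T \<noteq> {}" using T False by auto
  \<comment> \<open>Half of the radius \<open>e z\<close> is spent on the last coordinate and the
    other half on the \<open>d\<close> parameters; \<open>Suc d\<close> avoids a zero denominator
    for \<open>d = 0\<close>.\<close>
  define \<delta> where "\<delta> = Min ((\<lambda>z. e z / (2 * Suc d)) ` T)"
  define M where "M = Max ((\<lambda>z. \<bar>h (vec_snoc d p z)\<bar> + 1) ` T)"
  have "\<delta> > 0" unfolding \<delta>_def using T e \<open>T \<noteq> {}\<close> by (subst Min_gr_iff) (auto intro!: divide_pos_pos)
  moreover have "vec_snoc d q y \<in> U \<and> \<bar>h (vec_snoc d q y)\<bar> \<le> M"
    if y: "y \<in> K" and q: "\<And>i. i < d \<Longrightarrow> \<bar>q i - p i\<bar> \<le> \<delta>" for y q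
  proof -
    obtain z where z: "z \<in> T" "\<bar>z - y\<bar> < e z / 2" using T y by (auto simp: dist_real_def)
    have "\<delta> \<le> e z / (2 * Suc d)" unfolding \<delta>_def using T z by (intro Min_le) auto
    then have "d * \<delta> \<le> d * (e z / (2 * Suc d))" by (intro mult_left_mono) auto
    also have "\<dots> \<le> e z / 2" using e[of z] z T by (simp add: divide_simps) (auto simp: algebra_simps)
    finally have "d * \<delta> \<le> e z / 2" .
    then have "edist (Suc d) (vec_snoc d p z) (vec_snoc d q y) < e z"
      using edist_vec_snoc[of d q p \<delta> z y, OF q] z by linarith
    then have *: "vec_snoc d q y \<in> U \<and> \<bar>h (vec_snoc d q y) - h (vec_snoc d p z)\<bar> < 1"
      using z T by (intro eU vec_snoc_Rn) auto
    moreover have "\<bar>h (vec_snoc d p z)\<bar> + 1 \<le> M" unfolding M_def using T z by (intro Max_ge) auto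
    ultimately show ?thesis by linarith
  qed
  ultimately show thesis by (rule that)
qed

lemma smooth_Rn_DERIV:
  assumes g: "smooth_Rn d U g" and h: "h \<in> pderivs d g" and i: "i < d" and x: "x(i := \<xi>) \<in> U"
  shows "((\<lambda>s. h (x(i := s))) has_real_derivative pdiff i h (x(i := \<xi>))) (at \<xi>)"
proof -
  let ?z = "x(i := \<xi>)"
  have "(\<lambda>s. h (?z(i := ?z i + s))) differentiable (at 0)"
    using assms unfolding smooth_Rn_def by blast
  then have "((\<lambda>s. h (?z(i := ?z i + s))) has_real_derivative pdiff i h ?z) (at 0)"
    unfolding pdiff_def by (simp add: DERIV_deriv_iff_real_differentiable)
  then have "((\<lambda>s. h (x(i := s + \<xi>))) has_real_derivative pdiff i h ?z) (at 0)" by (simp add: add.commute)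
  then show ?thesis using DERIV_shift[of "\<lambda>s. h (x(i := s))" "pdiff i h ?z" 0 \<xi>] by simp
qed

lemma pderivs_funpow: "h \<in> pderivs d g \<Longrightarrow> i < d \<Longrightarrow> (pdiff i ^^ m) h \<in> pderivs d g"
  by (induction m) (auto intro: pderivs.step)

lemma Ro_near: assumes "x \<in> Ro" "\<epsilon> > 0" shows "\<forall>\<^sub>F t in near0. \<bar>x t - x 0\<bar> \<le> \<epsilon>"
  using expandable_near[OF Ro_expandable[OF assms(1)] assms(2), of UNIV] by (auto elim: eventually_mono)

lemma Ro_near_all:
  fixes d :: nat
  assumes "\<And>i. i < d \<Longrightarrow> p i \<in> Ro" "\<epsilon> > 0"
  shows "\<forall>\<^sub>F t in near0. \<forall>i<d. \<bar>p i t - p i 0\<bar> \<le> \<epsilon>"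
proof -
  have "\<forall>\<^sub>F t in near0. \<forall>i\<in>{..<d}. \<bar>p i t - p i 0\<bar> \<le> \<epsilon>"
    using assms by (intro eventually_ball_finite ballI Ro_near) auto
  then show ?thesis by (simp add: Ball_def)
qed

text \<open>The standard parameters are replaced by the actual ones one coordinate at a time, so that neither
  the multivariate chain rule nor the symmetry of mixed partial derivatives is needed.\<close>

lemma expandable_multi:
  assumes g: "smooth_Rn (Suc d) U g" and K: "compact K"
    and pU: "\<And>y. y \<in> K \<Longrightarrow> vec_snoc d (\<lambda>i. p i 0) y \<in> U"
    and p: "\<And>i. i < d \<Longrightarrow> p i \<in> Ro"
  shows "j \<le> d \<Longrightarrow> h \<in> pderivs (Suc d) g \<Longrightarrow>
    expandable K (\<lambda>t y. h (vec_snoc d (\<lambda>i. if i < j then p i t else p i 0) y))"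
proof (induction j arbitrary: h)
  case 0
  \<comment> \<open>With all parameters at their standard values the family does not depend on t;
    continuity in y follows from the partial derivative in the last coordinate.\<close>
  have "continuous_on K (\<lambda>y. h (vec_snoc d (\<lambda>i. p i 0) y))"
  proof (rule continuous_at_imp_continuous_on, rule ballI)
    fix y assume y: "y \<in> K"
    have "vec_snoc d (\<lambda>i. p i 0) y = (vec_snoc d (\<lambda>i. p i 0) y)(d := y)" by (simp add: vec_snoc_def)
    then have "((\<lambda>s. h ((vec_snoc d (\<lambda>i. p i 0) y)(d := s))) has_real_derivative
        pdiff d h ((vec_snoc d (\<lambda>i. p i 0) y)(d := y))) (at y)"
      using pU[OF y] by (intro smooth_Rn_DERIV[OF g 0(2)]) auto
    then show "isCont (\<lambda>y. h (vec_snoc d (\<lambda>i. p i 0) y)) y"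
      by (auto simp: vec_snoc_def dest: DERIV_isCont)
  qed
  then have "bcont K (\<lambda>y. h (vec_snoc d (\<lambda>i. p i 0) y))"
    using K unfolding bcont_def by (auto intro: compact_imp_bounded compact_continuous_image)
  then show ?case by (simp add: expandable_static)
next
  case (Suc j)
  then have j: "j < d" by simp
  define x where "x t y = vec_snoc d (\<lambda>i. if i < j then p i t else p i 0) y" for t y
  define E where "E t = p j t - p j 0" for t
  have E: "expandable K (\<lambda>t y. E t)" unfolding E_def
    by (intro expandable_diff expandable_const Ro_expandable p j)
  have E0: "E 0 = 0" by (simp add: E_def)
  obtain N where N: "0 < N" and o: "unif_o K (\<lambda>t y. E t ^ N)"
    using expandable_infinitesimal_power[OF E] E0 by auto
  have upd: "(x t y)(j := \<xi>) = vec_snoc d (\<lambda>i. if i < j then p i t else if i = j then \<xi> else p i 0) y" for t y \<xi>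
    unfolding x_def vec_snoc_def using j by auto
  have pd: "(pdiff j ^^ m) h \<in> pderivs (Suc d) g" for m
    using Suc.prems j by (intro pderivs_funpow) auto
  have op: "open_Rn (Suc d) U" and co: "cont_Rn (Suc d) U ((pdiff j ^^ N) h)"
    using g pd[of N] unfolding smooth_Rn_def by blast+
  obtain \<delta> M where \<delta>: "\<delta> > 0" and M: "\<And>y q. y \<in> K \<Longrightarrow> (\<And>i. i < d \<Longrightarrow> \<bar>q i - p i 0\<bar> \<le> \<delta>) \<Longrightarrow>
      vec_snoc d q y \<in> U \<and> \<bar>(pdiff j ^^ N) h (vec_snoc d q y)\<bar> \<le> M"
    using cont_Rn_bounded_near_compact[OF op co K, of "\<lambda>i. p i 0"] pU by metis
  have near: "\<forall>\<^sub>F t in near0. \<forall>i<d. \<bar>p i t - p i 0\<bar> \<le> \<delta>" by (rule Ro_near_all[OF p \<delta>])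
  define T where "T t y = (\<Sum>m<N. (pdiff j ^^ m) h (x t y) / fact m * E t ^ m)" for t y
  \<comment> \<open>The coefficients are partial derivatives of \<open>h\<close>, again in
    \<open>pderivs\<close>, evaluated with one moving parameter fewer, so the induction hypothesis
    for arbitrary \<open>h\<close> covers them.\<close>
  have T: "expandable K T" unfolding T_def divide_inverse x_def
    using Suc.IH pd j by (intro expandable_sum expandable_mult expandable_const expandable_power E) auto
  have "unif_o K (\<lambda>t y. h (vec_snoc d (\<lambda>i. if i < Suc j then p i t else p i 0) y) - T t y)"
  proof (rule unif_o_le[OF _ o])
    show "\<forall>\<^sub>F t in near0. \<forall>y\<in>K. \<bar>h (vec_snoc d (\<lambda>i. if i < Suc j then p i t else p i 0) y) - T t y\<bar> \<le> M * \<bar>E t ^ N\<bar>"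
      using near
    proof eventually_elim
      case (elim t)
      show ?case
      proof
        fix y assume y: "y \<in> K"
        have *: "(x t y)(j := \<xi>) \<in> U \<and> \<bar>(pdiff j ^^ N) h ((x t y)(j := \<xi>))\<bar> \<le> M"
          if "\<bar>\<xi> - p j 0\<bar> \<le> \<bar>E t\<bar>" for \<xi>
          unfolding upd
        proof (rule M[OF y])
          fix i assume i: "i < d"
          have "\<bar>E t\<bar> \<le> \<delta>" using elim j unfolding E_def by auto
          then show "\<bar>(if i < j then p i t else if i = j then \<xi> else p i 0) - p i 0\<bar> \<le> \<delta>"
            using that elim i \<delta> by auto
        qed
        have "\<bar>(\<lambda>m \<xi>. (pdiff j ^^ m) h ((x t y)(j := \<xi>))) 0 (p j 0 + E t) -
            (\<Sum>m<N. (\<lambda>m \<xi>. (pdiff j ^^ m) h ((x t y)(j := \<xi>))) m (p j 0) / fact m * E t ^ m)\<bar> \<le> M * \<bar>E t ^ N\<bar>"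
        proof (rule Taylor_remainder_bound[OF N])
          fix m \<xi> assume "m < N" and \<xi>: "\<bar>\<xi> - p j 0\<bar> \<le> \<bar>E t\<bar>"
          show "((\<lambda>\<xi>. (pdiff j ^^ m) h ((x t y)(j := \<xi>))) has_real_derivative
              (pdiff j ^^ Suc m) h ((x t y)(j := \<xi>))) (at \<xi>)"
            using smooth_Rn_DERIV[OF g pd[of m], of j "x t y" \<xi>] j *[OF \<xi>] by simp
        qed (use * in blast)
        moreover have "(x t y)(j := p j 0) = x t y" unfolding x_def vec_snoc_def using j by auto
        moreover have "(x t y)(j := p j 0 + E t) = vec_snoc d (\<lambda>i. if i < Suc j then p i t else p i 0) y"
          unfolding x_def vec_snoc_def E_def using j by (auto simp: fun_eq_iff)
        ultimately show "\<bar>h (vec_snoc d (\<lambda>i. if i < Suc j then p i t else p i 0) y) - T t y\<bar> \<le> M * \<bar>E t ^ N\<bar>"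
          unfolding T_def by simp
      qed
    qed
  qed
  then show ?case by (rule expandable_perturb[OF T])
qed

text \<open>Differentiation in y is \<open>pdiff d\<close>, which does not leave
  \<open>pderivs\<close>, so every order reduces to the expansion of another member. The tube around
  \<open>K\<close> keeps the moving parameters inside \<open>U\<close> for all y at once.\<close>

lemma sfam_multi:
  assumes g: "smooth_Rn (Suc d) U g" and K: "compact K" "V \<subseteq> K"
    and pU: "\<And>y. y \<in> K \<Longrightarrow> vec_snoc d (\<lambda>i. p i 0) y \<in> U"
    and p: "\<And>i. i < d \<Longrightarrow> p i \<in> Ro"
  shows "h \<in> pderivs (Suc d) g \<Longrightarrow> sfam n V (\<lambda>t y. h (vec_snoc d (\<lambda>i. p i t) y))"
    and "h \<in> pderivs (Suc d) g \<Longrightarrow> \<forall>\<^sub>F t in near0. \<forall>y\<in>V.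
      (h \<circ> vec_snoc d (\<lambda>i. p i t) has_real_derivative pdiff d h (vec_snoc d (\<lambda>i. p i t) y)) (at y)"
proof -
  have op: "open_Rn (Suc d) U" using g unfolding smooth_Rn_def by blast
  have deriv: "\<forall>\<^sub>F t in near0. \<forall>y\<in>V.
      (h \<circ> vec_snoc d (\<lambda>i. p i t) has_real_derivative pdiff d h (vec_snoc d (\<lambda>i. p i t) y)) (at y)"
    if h: "h \<in> pderivs (Suc d) g" for h
  proof -
    have co: "cont_Rn (Suc d) U h" using g h unfolding smooth_Rn_def by blast
    obtain \<delta> M where \<delta>: "\<delta> > 0" and M: "\<And>y q. y \<in> K \<Longrightarrow> (\<And>i. i < d \<Longrightarrow> \<bar>q i - p i 0\<bar> \<le> \<delta>) \<Longrightarrow>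
        vec_snoc d q y \<in> U \<and> \<bar>h (vec_snoc d q y)\<bar> \<le> M"
      using cont_Rn_bounded_near_compact[OF op co K(1), of "\<lambda>i. p i 0"] pU by metis
    have near: "\<forall>\<^sub>F t in near0. \<forall>i<d. \<bar>p i t - p i 0\<bar> \<le> \<delta>" by (rule Ro_near_all[OF p \<delta>])
    show ?thesis using near
    proof eventually_elim
      case (elim t)
      show ?case
      proof
        fix y assume y: "y \<in> V"
        let ?x = "vec_snoc d (\<lambda>i. p i t) y"
        have x: "?x(d := s) = vec_snoc d (\<lambda>i. p i t) s" for s by (simp add: vec_snoc_def)
        have "?x \<in> U" using M[of y "\<lambda>i. p i t"] elim y K by auto
        then have "((\<lambda>s. h (?x(d := s))) has_real_derivative pdiff d h (?x(d := y))) (at y)"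
          by (intro smooth_Rn_DERIV[OF g h]) (auto simp: x)
        then show "(h \<circ> vec_snoc d (\<lambda>i. p i t) has_real_derivative pdiff d h ?x) (at y)"
          by (simp add: x o_def)
      qed
    qed
  qed
  then show "h \<in> pderivs (Suc d) g \<Longrightarrow> \<forall>\<^sub>F t in near0. \<forall>y\<in>V.
      (h \<circ> vec_snoc d (\<lambda>i. p i t) has_real_derivative pdiff d h (vec_snoc d (\<lambda>i. p i t) y)) (at y)" .
  have ex: "expandable V (\<lambda>t y. h (vec_snoc d (\<lambda>i. p i t) y))" if "h \<in> pderivs (Suc d) g" for h
  proof -
    have "vec_snoc d (\<lambda>i. if i < d then p i t else p i 0) y = vec_snoc d (\<lambda>i. p i t) y" for t y
      by (auto simp: vec_snoc_def)
    then show ?thesis using expandable_multi[OF g K(1) pU p order_refl that] K(2) by (auto intro: expandable_subset)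
  qed
  show "h \<in> pderivs (Suc d) g \<Longrightarrow> sfam n V (\<lambda>t y. h (vec_snoc d (\<lambda>i. p i t) y))"
  proof (induction n arbitrary: h)
    case (Suc n)
    have "sfam n V (\<lambda>t y. pdiff d h (vec_snoc d (\<lambda>i. p i t) y))"
      using Suc.prems by (intro Suc.IH pderivs.step) auto
    then show ?case using ex[OF Suc.prems] deriv[OF Suc.prems] by (auto simp: o_def)
  qed (simp add: ex)
qed

subsection \<open>Coefficients of smooth families\<close>

lemma little_o_unif: "little_o h \<longleftrightarrow> unif_o UNIV (\<lambda>t y. h t)"
  by (simp add: unif_o_const)

lemma little_o_add: "little_o g \<Longrightarrow> little_o h \<Longrightarrow> little_o (\<lambda>t. g t + h t)"
  unfolding little_o_unif by (rule unif_o_add)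

lemma little_o_diff: "little_o g \<Longrightarrow> little_o h \<Longrightarrow> little_o (\<lambda>t. g t - h t)"
  unfolding little_o_unif by (rule unif_o_diff)

lemma little_o_zero: "little_o (\<lambda>t. 0)"
  unfolding little_o_unif by simp

lemma little_o_sum: "(\<And>i. i \<in> I \<Longrightarrow> little_o (h i)) \<Longrightarrow> little_o (\<lambda>t. \<Sum>i\<in>I. h i t)"
  unfolding little_o_unif by (rule unif_o_sum)

lemma little_o_mult: "x \<in> Ro \<Longrightarrow> little_o h \<Longrightarrow> little_o (\<lambda>t. x t * h t)"
  unfolding little_o_unif by (intro unif_o_mult expandable_bdd Ro_expandable)

lemma little_o_at_zero: "little_o h \<Longrightarrow> h 0 = 0"
  by (simp add: little_o_def)

lemma little_o_swap: "little_o (\<lambda>t. x t - y t) \<Longrightarrow> little_o (\<lambda>t. y t - x t)"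
  using little_o_diff[OF little_o_zero, of "\<lambda>t. x t - y t"] by simp

lemma little_o_trans: "little_o (\<lambda>t. x t - y t) \<Longrightarrow> little_o (\<lambda>t. y t - z t) \<Longrightarrow> little_o (\<lambda>t. x t - z t)"
  using little_o_add[of "\<lambda>t. x t - y t" "\<lambda>t. y t - z t"] by simp

text \<open>Uniformity is used here: the point may move with t, as the representative of a Fermat
  real does.\<close>

lemma unif_o_little_o_along:
  assumes "unif_o K R" "\<forall>\<^sub>F t in near0. y t \<in> K" shows "little_o (\<lambda>t. R t (y t))"
  unfolding little_o_iff
proof (intro allI impI)
  fix e :: real assume "e > 0"
  then have "\<forall>\<^sub>F t in near0. \<forall>y\<in>K. \<bar>R t y\<bar> \<le> e * t" using assms unfolding unif_o_def by blast
  with assms(2) show "\<forall>\<^sub>F t in near0. \<bar>R t (y t)\<bar> \<le> e * t" by eventually_elim auto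
qed

lemma unif_o_little_o: "unif_o K R \<Longrightarrow> y \<in> K \<Longrightarrow> little_o (\<lambda>t. R t y)"
  using unif_o_little_o_along[of K R "\<lambda>t. y"] by simp

lemma little_o_le:
  assumes "\<forall>\<^sub>F t in near0. \<bar>g t\<bar> \<le> M * \<bar>h t\<bar>" "little_o h" shows "little_o g"
  using unif_o_le[of UNIV "\<lambda>t y. g t" M "\<lambda>t y. h t"] assms unfolding little_o_unif by simp

text \<open>With coefficients that vanish off the exponent set, two expansions can be moved to the
  union of their sets and then compared by the independence of powers.\<close>

lemma uexp_enlarge:
  assumes "uexp K G B c" "\<And>b. b \<notin> B \<Longrightarrow> c b = (\<lambda>_. 0)" "finite B'" "B \<subseteq> B'" "B' \<subseteq> {0..1}"
  shows "uexp K G B' c"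
proof -
  have "(\<Sum>b\<in>B. c b y * tpow t b) = (\<Sum>b\<in>B'. c b y * tpow t b)" for t y
    using assms by (intro sum.mono_neutral_left) auto
  moreover have "bcont K (c b)" for b using assms(1,2) by (cases "b \<in> B") (auto simp: uexp_def)
  ultimately show ?thesis using assms unfolding uexp_def by simp
qed

lemma uexp_pad:
  assumes "uexp K G B c" shows "uexp K G B (\<lambda>b. if b \<in> B then c b else (\<lambda>_. 0))"
proof -
  have "(\<Sum>b\<in>B. (if b \<in> B then c b else (\<lambda>_. 0)) y * tpow t b) = (\<Sum>b\<in>B. c b y * tpow t b)" for t y
    by (intro sum.cong) auto
  then show ?thesis using assms unfolding uexp_def by simp
qed

text \<open>The expansion of H, being uniform, can be integrated in y; comparing with the expansion of G and
  using the independence of the powers of t shows that \<open>c b\<close> is a primitive of \<open>d b\<close>.\<close>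

lemma uexp_diff_coeffs_DERIV:
  assumes V: "open V" and G: "uexp V G B c" and H: "uexp V H B d"
    and GH: "\<forall>\<^sub>F t in near0. \<forall>y\<in>V. (G t has_real_derivative H t y) (at y)"
    and y: "y \<in> V" and b: "b \<in> B"
  shows "(c b has_real_derivative d b y) (at y)"
proof -
  have B: "finite B" "B \<subseteq> {0..1}" using G unfolding uexp_def by auto
  obtain r where r: "r > 0" "cball y r \<subseteq> V" using V y open_contains_cball by blast
  define A where "A = {y - r..y + r}"
  have AV: "A \<subseteq> V" using r by (auto simp: A_def cball_eq_atLeastAtMost)
  have "\<exists>D. \<forall>z\<in>A. (D has_real_derivative d b z) (at z within A)" if "b \<in> B" for b
  proof -
    have "continuous_on {y - r..y + r} (d b)"
      using H that AV unfolding uexp_def bcont_def A_def by (blast intro: continuous_on_subset)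
    then show ?thesis using antiderivative_continuous[of "y - r" "y + r" "d b"]
      unfolding A_def has_real_derivative_iff_has_vector_derivative by metis
  qed
  then obtain D where D: "\<And>b z. b \<in> B \<Longrightarrow> z \<in> A \<Longrightarrow> (D b has_real_derivative d b z) (at z within A)" by metis
  \<comment> \<open>\<open>D b\<close> is a primitive of \<open>d b\<close> on the closed interval
    \<open>A\<close>, so \<open>R t\<close> differentiates to the remainder of \<open>H\<close>; by
    the mean value inequality its increments are o(t).\<close>
  define R where "R t z = G t z - (\<Sum>b\<in>B. D b z * tpow t b)" for t z
  have RD: "\<forall>\<^sub>F t in near0. \<forall>z\<in>A. (R t has_real_derivative H t z - (\<Sum>b\<in>B. d b z * tpow t b)) (at z within A)"
    using GH
  proof eventually_elim
    case (elim t)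
    show ?case unfolding R_def
      using elim AV by (auto intro!: DERIV_diff DERIV_sum DERIV_cmult_right D intro: has_field_derivative_at_within)
  qed
  have key: "c b z = c b y + D b z - D b y" if z: "z \<in> A" for z
  proof -
    have yA: "y \<in> A" using r by (auto simp: A_def)
    have Ro: "little_o (\<lambda>t. R t z - R t y)"
      unfolding little_o_iff
    proof (intro allI impI)
      fix e :: real assume e: "e > 0"
      \<comment> \<open>The mean value inequality contributes the factor
        \<open>\<bar>z - y\<bar>\<close>; the added 1 covers \<open>z = y\<close>.\<close>
      define e' where "e' = e / (\<bar>z - y\<bar> + 1)"
      have e': "e' > 0" "e' * \<bar>z - y\<bar> \<le> e" using e by (auto simp: e'_def divide_simps)
      have "\<forall>\<^sub>F t in near0. \<forall>z\<in>V. \<bar>H t z - (\<Sum>b\<in>B. d b z * tpow t b)\<bar> \<le> e' * t"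
        using H e' unfolding uexp_def unif_o_def by blast
      with RD near0_nonneg show "\<forall>\<^sub>F t in near0. \<bar>R t z - R t y\<bar> \<le> e * t"
      proof eventually_elim
        case (elim t)
        have "norm (R t z - R t y) \<le> (e' * t) * norm (z - y)"
          by (rule field_differentiable_bound[of A _ "\<lambda>z. H t z - (\<Sum>b\<in>B. d b z * tpow t b)"])
            (use elim AV z yA in \<open>auto simp: A_def\<close>)
        also have "\<dots> = (e' * \<bar>z - y\<bar>) * t" by simp
        also have "\<dots> \<le> e * t" using e' elim by (intro mult_right_mono) auto
        finally show ?case by simp
      qed
    qed
    have Go: "little_o (\<lambda>t. G t x - (\<Sum>b\<in>B. c b x * tpow t b))" if "x \<in> A" for x
      using G AV that unfolding uexp_def by (auto intro: unif_o_little_o)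
    have "little_o (\<lambda>t. (R t z - R t y) - (G t z - (\<Sum>b\<in>B. c b z * tpow t b)) + (G t y - (\<Sum>b\<in>B. c b y * tpow t b)))"
      by (rule little_o_add[OF little_o_diff[OF Ro Go[OF z]] Go[OF yA]])
    then have "little_o (\<lambda>t. \<Sum>b\<in>B. (c b z - c b y - (D b z - D b y)) * tpow t b)"
      by (simp add: R_def sum_subtractf sum.distrib algebra_simps)
    from little_o_tpow_sum_zero[OF B this b] show ?thesis by simp
  qed
  have "(D b has_real_derivative d b y) (at y)"
    using D[OF b, of y] r at_within_Icc_at[of "y - r" y "y + r"] by (auto simp: A_def)
  then have "((\<lambda>z. c b y + D b z - D b y) has_real_derivative d b y) (at y)"
    by (auto intro!: derivative_eq_intros)
  moreover have "z \<in> ball y r \<Longrightarrow> c b y + D b z - D b y = c b z" for z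
    using key[of z] by (auto simp: A_def ball_eq_greaterThanLessThan)
  ultimately show ?thesis using r
    by (intro has_field_derivative_transform_within_open[of "\<lambda>z. c b y + D b z - D b y" _ y "ball y r" "c b"]) auto
qed

text \<open>Each order of the family gives one order of its coefficients: on \<open>V\<close> the
  derivative of \<open>c b\<close> is the coefficient of the derivative family, to which the
  induction hypothesis applies.\<close>

lemma sfam_coeffs_differentiable:
  assumes V: "open V"
  shows "sfam n V G \<Longrightarrow> uexp V G B c \<Longrightarrow> b \<in> B \<Longrightarrow> m < n \<Longrightarrow> x \<in> V \<Longrightarrow>
    ((deriv ^^ m) (c b) has_real_derivative (deriv ^^ Suc m) (c b) x) (at x)"
proof (induction n arbitrary: G B c m x)
  case (Suc n)
  obtain H where H: "\<forall>\<^sub>F t in near0. \<forall>y\<in>V. (G t has_real_derivative H t y) (at y)" "sfam n V H"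
    using Suc.prems by auto
  obtain B' d' where d': "uexp V H B' d'" using sfam_expandable[OF H(2)] unfolding expandable_def by blast
  define d where "d b = (if b \<in> B' then d' b else (\<lambda>_. 0))" for b
  define c' where "c' b = (if b \<in> B then c b else (\<lambda>_. 0))" for b
  have BB: "finite (B \<union> B')" "B \<union> B' \<subseteq> {0..1}" using d' Suc.prems(2) unfolding uexp_def by auto
  have d: "uexp V H (B \<union> B') d"
    by (rule uexp_enlarge[OF uexp_pad[OF d', folded d_def]]) (use BB in \<open>auto simp: d_def\<close>)
  have c': "uexp V G (B \<union> B') c'"
    by (rule uexp_enlarge[OF uexp_pad[OF Suc.prems(2), folded c'_def]]) (use BB in \<open>auto simp: c'_def\<close>)
  have D: "(c b has_real_derivative d b y) (at y)" if "y \<in> V" for y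
    using uexp_diff_coeffs_DERIV[OF V c' d H(1) that, of b] Suc.prems(3) by (simp add: c'_def)
  then have Dd: "deriv (c b) y = d b y" if "y \<in> V" for y using that by (blast intro: DERIV_imp_deriv)
  show ?case
  proof (cases m)
    case 0
    then show ?thesis using D[OF Suc.prems(5)] Dd Suc.prems(5) by simp
  next
    case (Suc m')
    have "((deriv ^^ m') (d b) has_real_derivative (deriv ^^ Suc m') (d b) x) (at x)"
      using Suc.prems Suc by (intro Suc.IH[OF H(2) d]) auto
    moreover have "(deriv ^^ j) (d b) y = (deriv ^^ Suc j) (c b) y" if "y \<in> V" for j y
      using higher_deriv_cong_open[OF V, of "deriv (c b)" "d b" y j] Dd that by (simp add: funpow_swap1)
    ultimately show ?thesis unfolding Suc
      using Suc.prems(5) V by (metis (no_types, lifting) has_field_derivative_transform_within_open)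
  qed
qed simp

text \<open>Both families share one exponent set because the derivative is to be taken
  coefficientwise. An exponent that occurs only in the expansion of \<open>H\<close> gets the
  coefficient 0 in that of \<open>G\<close>, and the comparison forces its coefficient in
  \<open>H\<close> to vanish on \<open>V\<close>.\<close>

lemma sfam_normal_form:
  assumes V: "open V" and G: "\<And>n. sfam n V G" and H: "expandable V H"
    and GH: "\<forall>\<^sub>F t in near0. \<forall>y\<in>V. (G t has_real_derivative H t y) (at y)"
  obtains B c where "\<And>b. smooth1 V (c b)" "\<And>b. b \<notin> B \<Longrightarrow> c b = (\<lambda>_. 0)"
    "uexp V G B c" "uexp V H B (\<lambda>b. deriv (c b))"
proof -
  obtain B1 c1 where c1: "uexp V G B1 c1" using sfam_expandable[OF G[of 0]] unfolding expandable_def by blast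
  obtain B2 d2 where d2: "uexp V H B2 d2" using H unfolding expandable_def by blast
  define d where "d b = (if b \<in> B2 then d2 b else (\<lambda>_. 0))" for b
  define c where "c b = (if b \<in> B1 then c1 b else (\<lambda>_. 0))" for b
  define B where "B = B1 \<union> B2"
  have BB: "finite B" "B \<subseteq> {0..1}" using c1 d2 unfolding uexp_def B_def by auto
  have d: "uexp V H B d"
    by (rule uexp_enlarge[OF uexp_pad[OF d2, folded d_def]]) (use BB in \<open>auto simp: d_def B_def\<close>)
  have c: "uexp V G B c"
    by (rule uexp_enlarge[OF uexp_pad[OF c1, folded c_def]]) (use BB in \<open>auto simp: c_def B_def\<close>)
  have zero: "c b = (\<lambda>_. 0)" if "b \<notin> B" for b using that by (auto simp: c_def B_def)
  have sm: "smooth1 V (c b)" for b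
  proof (cases "b \<in> B")
    case True
    then show ?thesis unfolding smooth1_def using sfam_coeffs_differentiable[OF V G c] by blast
  qed (simp add: zero smooth1_const)
  have eq: "d b y = deriv (c b) y" if "y \<in> V" "b \<in> B" for b y
    using uexp_diff_coeffs_DERIV[OF V c d GH that] by (simp add: DERIV_imp_deriv)
  have "bcont V (deriv (c b))" if "b \<in> B" for b
  proof -
    have "bcont V (d b)" using d that unfolding uexp_def by blast
    then show ?thesis unfolding bcont_def using eq that by (metis (no_types, lifting) continuous_on_cong image_cong)
  qed
  moreover have "unif_o V (\<lambda>t y. H t y - (\<Sum>b\<in>B. deriv (c b) y * tpow t b))"
    by (rule unif_o_cong[of V "\<lambda>t y. H t y - (\<Sum>b\<in>B. d b y * tpow t b)"])
      (use d eq in \<open>auto simp: uexp_def intro!: always_eventually sum.cong\<close>)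
  ultimately have "uexp V H B (\<lambda>b. deriv (c b))" using BB unfolding uexp_def by blast
  then show thesis using that sm zero c by blast
qed

subsection \<open>Representatives of Fermat reals\<close>

lemma Ro_perturb: "x \<in> Ro \<Longrightarrow> little_o (\<lambda>t. y t - x t) \<Longrightarrow> y \<in> Ro"
  using expandable_perturb[of UNIV "\<lambda>t y. x t" "\<lambda>t z. y t"] unfolding little_o_unif
  by (simp add: Ro_iff_expandable[of UNIV])

lemma equiv_Frel: "equiv Ro Frel"
  unfolding Frel_def
  by (rule equivI) (auto simp: refl_on_def sym_def trans_def little_o_zero intro: little_o_swap little_o_trans)

lemma Rep_fclass: "x \<in> Ro \<Longrightarrow> Rep_fermat (fclass x) = Frel `` {x}"
  unfolding fclass_def by (rule Abs_fermat_inverse) (rule quotientI)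

lemma fclass_eqI: assumes "x \<in> Ro" "little_o (\<lambda>t. x t - y t)" shows "fclass x = fclass y"
proof -
  have "(x, y) \<in> Frel" using assms Ro_perturb little_o_swap unfolding Frel_def by blast
  then show ?thesis unfolding fclass_def using equiv_class_eq[OF equiv_Frel] by metis
qed

lemma fclass_eqD: assumes "fclass x = fclass y" "x \<in> Ro" "y \<in> Ro" shows "little_o (\<lambda>t. x t - y t)"
proof -
  have "Frel `` {x} = Frel `` {y}" using assms Rep_fclass by metis
  then have "(x, y) \<in> Frel" using assms eq_equiv_class_iff[OF equiv_Frel] by blast
  then show ?thesis unfolding Frel_def by blast
qed

lemma frep_cases: "frep X \<in> Ro \<and> fclass (frep X) = X"
proof -
  have "Rep_fermat X \<in> Ro // Frel" using Rep_fermat by blast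
  then obtain x where x: "x \<in> Ro" "Rep_fermat X = Frel `` {x}" by (auto elim: quotientE)
  then have "x \<in> Rep_fermat X" using equiv_class_self[OF equiv_Frel] by simp
  then have "frep X \<in> Rep_fermat X" unfolding frep_def by (rule someI[of "\<lambda>x. x \<in> Rep_fermat X" x])
  then have *: "(x, frep X) \<in> Frel" using x by blast
  then have "frep X \<in> Ro" unfolding Frel_def by blast
  moreover have "Frel `` {frep X} = Rep_fermat X" using * x equiv_class_eq[OF equiv_Frel] by metis
  ultimately show ?thesis unfolding fclass_def by (simp add: Rep_fermat_inverse)
qed

lemma frep_Ro [simp, intro]: "frep X \<in> Ro" and fclass_frep [simp]: "fclass (frep X) = X"
  using frep_cases by auto

lemma frep_fclass: "x \<in> Ro \<Longrightarrow> little_o (\<lambda>t. frep (fclass x) t - x t)"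
  by (rule fclass_eqD) auto

lemma st_fclass: "x \<in> Ro \<Longrightarrow> st (fclass x) = x 0"
  using little_o_at_zero[OF frep_fclass[of x]] unfolding st_def by simp

lemma Ro_const: "(\<lambda>_. r) \<in> Ro"
  using Ro_iff_expandable[of UNIV "\<lambda>_. r"] expandable_const by simp

lemma st_fconst [simp]: "st (fconst r) = r"
  unfolding fconst_def by (simp add: st_fclass Ro_const)

lemma Ro_diff: "x \<in> Ro \<Longrightarrow> y \<in> Ro \<Longrightarrow> (\<lambda>t. x t - y t) \<in> Ro"
  by (simp add: Ro_iff_expandable[of UNIV] expandable_diff)

lemma Ro_mult: "x \<in> Ro \<Longrightarrow> y \<in> Ro \<Longrightarrow> (\<lambda>t. x t * y t) \<in> Ro"
  by (simp add: Ro_iff_expandable[of UNIV] expandable_mult)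

lemma Ro_tpow: "0 \<le> a \<Longrightarrow> (\<lambda>t. tpow t a) \<in> Ro"
  by (simp add: Ro_iff_expandable[of UNIV] expandable_tpow)

lemma Ro_sum: "(\<And>i. i \<in> I \<Longrightarrow> x i \<in> Ro) \<Longrightarrow> (\<lambda>t. \<Sum>i\<in>I. x i t) \<in> Ro"
  by (simp add: Ro_iff_expandable[of UNIV] expandable_sum)

lemma Ro_smooth1: assumes "x \<in> Ro" "open V" "smooth1 V c" "x 0 \<in> V" shows "(\<lambda>t. c (x t)) \<in> Ro"
  using expandable_compose[of UNIV "\<lambda>t y. x t" "{x 0}" V c] assms
  by (simp add: Ro_iff_expandable[of UNIV])

lemma Ro_eventually_in: assumes "x \<in> Ro" "open V" "x 0 \<in> V" shows "\<forall>\<^sub>F t in near0. x t \<in> V"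
proof -
  obtain e where e: "e > 0" "cball (x 0) e \<subseteq> V" using assms open_contains_cball by blast
  then show ?thesis using Ro_near[OF assms(1) e(1)]
    by (auto elim!: eventually_mono simp: dist_real_def abs_minus_commute subset_iff)
qed

text \<open>A smooth function is Lipschitz on a closed ball around the standard part, so its
  extension does not depend on the representative.\<close>

lemma little_o_smooth1:
  assumes x: "x \<in> Ro" and o: "little_o (\<lambda>t. x t - y t)" and V: "open V" "smooth1 V c" "x 0 \<in> V"
  shows "little_o (\<lambda>t. c (x t) - c (y t))"
proof -
  obtain r where r: "r > 0" "cball (x 0) r \<subseteq> V" using V open_contains_cball by blast
  obtain M where M: "\<And>z. z \<in> cball (x 0) r \<Longrightarrow> \<bar>(deriv ^^ 1) c z\<bar> \<le> M"
    using compact_bound[OF compact_cball smooth1_continuous_on[OF V(2) r(2)]] by blast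
  have y: "y \<in> Ro" "y 0 = x 0" using Ro_perturb[OF x little_o_swap[OF o]] little_o_at_zero[OF o] by auto
  have ev: "\<forall>\<^sub>F t in near0. x t \<in> ball (x 0) r \<and> y t \<in> ball (x 0) r"
    using r(1) y by (intro eventually_conj Ro_eventually_in x) auto
  show ?thesis
  proof (rule little_o_le[OF _ o])
    show "\<forall>\<^sub>F t in near0. \<bar>c (x t) - c (y t)\<bar> \<le> M * \<bar>x t - y t\<bar>"
      using ev
    proof eventually_elim
      case (elim t)
      have "norm (c (x t) - c (y t)) \<le> M * norm (x t - y t)"
        by (rule field_differentiable_bound[of "cball (x 0) r" c "deriv c"])
          (use elim M r in \<open>auto intro!: has_field_derivative_at_within smooth1_DERIV[OF V(2)]\<close>)
      then show ?case by simp
    qed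
  qed
qed

text \<open>Since the N-th power of the infinitesimal part is o(t), both functions equal the same
  Taylor polynomial up to a multiple of \<open>E t ^ N\<close>. A difference that is flat at the
  standard part therefore vanishes on its monad.\<close>

lemma little_o_same_jet:
  assumes x: "x \<in> Ro" and V: "open V" "smooth1 V c" "x 0 \<in> V" and V': "open V'" "smooth1 V' c'" "x 0 \<in> V'"
    and eq: "\<And>n. (deriv ^^ n) c (x 0) = (deriv ^^ n) c' (x 0)"
  shows "little_o (\<lambda>t. c (x t) - c' (x t))"
proof -
  define E where "E t = x t - x 0" for t
  have E: "expandable UNIV (\<lambda>t y. E t)" unfolding E_def by (intro expandable_diff Ro_expandable x expandable_const)
  obtain N where N: "0 < N" and o: "unif_o UNIV (\<lambda>t y. E t ^ N)"
    using expandable_infinitesimal_power[OF E] unfolding E_def by auto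
  have T: "little_o (\<lambda>t. c (x t) - (\<Sum>m<N. (deriv ^^ m) c (x 0) / fact m * E t ^ m))"
    if V: "open V" "smooth1 V c" "x 0 \<in> V" for V c
  proof -
    obtain r where r: "r > 0" "cball (x 0) r \<subseteq> V" using V open_contains_cball by blast
    obtain M where M: "\<And>z. z \<in> cball (x 0) r \<Longrightarrow> \<bar>(deriv ^^ N) c z\<bar> \<le> M"
      using compact_bound[OF compact_cball smooth1_continuous_on[OF V(2) r(2)]] by blast
    show ?thesis
    proof (rule little_o_le)
      show "little_o (\<lambda>t. E t ^ N)" using o unfolding little_o_unif .
      show "\<forall>\<^sub>F t in near0. \<bar>c (x t) - (\<Sum>m<N. (deriv ^^ m) c (x 0) / fact m * E t ^ m)\<bar> \<le> M * \<bar>E t ^ N\<bar>"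
        using Ro_near[OF x r(1)]
      proof eventually_elim
        case (elim t)
        have in_r: "\<bar>\<xi> - x 0\<bar> \<le> \<bar>E t\<bar> \<Longrightarrow> \<xi> \<in> cball (x 0) r" for \<xi>
          using elim by (auto simp: E_def dist_real_def)
        have "\<bar>(deriv ^^ 0) c (x 0 + E t) - (\<Sum>m<N. (deriv ^^ m) c (x 0) / fact m * E t ^ m)\<bar> \<le> M * \<bar>E t ^ N\<bar>"
          by (intro Taylor_remainder_bound N smooth1D[OF V(2)] M in_r subsetD[OF r(2)])
        then show ?case by (simp add: E_def)
      qed
    qed
  qed
  from little_o_diff[OF T[OF V] T[OF V']] show ?thesis by (simp add: eq)
qed

subsection \<open>Normal forms of smooth functions\<close>

definition nf :: "real set \<Rightarrow> (real \<Rightarrow> real \<Rightarrow> real) \<Rightarrow> fermat \<Rightarrow> fermat" where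
  "nf B c y = fclass (\<lambda>t. \<Sum>b\<in>B. c b (frep y t) * tpow t b)"

definition nf_data :: "real set \<Rightarrow> real set \<Rightarrow> (real \<Rightarrow> real \<Rightarrow> real) \<Rightarrow> bool" where
  "nf_data V B c \<longleftrightarrow> open V \<and> finite B \<and> B \<subseteq> {0..1} \<and> (\<forall>b. smooth1 V (c b)) \<and> (\<forall>b. b \<notin> B \<longrightarrow> c b = (\<lambda>_. 0))"

lemma nf_data_deriv: "nf_data V B c \<Longrightarrow> nf_data V B (\<lambda>b. deriv (c b))"
  unfolding nf_data_def by (auto intro: smooth1_deriv)

lemma nf_data_subset: "nf_data V B c \<Longrightarrow> open W \<Longrightarrow> W \<subseteq> V \<Longrightarrow> nf_data W B c"
  unfolding nf_data_def by (auto intro: smooth1_subset)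

lemma nf_data_enlarge: "nf_data V B c \<Longrightarrow> finite B' \<Longrightarrow> B \<subseteq> B' \<Longrightarrow> B' \<subseteq> {0..1} \<Longrightarrow> nf_data V B' c"
  unfolding nf_data_def by auto

lemma nf_enlarge: "nf_data V B c \<Longrightarrow> finite B' \<Longrightarrow> B \<subseteq> B' \<Longrightarrow> nf B' c = nf B c"
  unfolding nf_def nf_data_def
  by (intro ext arg_cong[where f = fclass] sum.mono_neutral_right) auto

lemma nf_sum_Ro:
  assumes "nf_data V B c" "x \<in> Ro" "x 0 \<in> V" shows "(\<lambda>t. \<Sum>b\<in>B. c b (x t) * tpow t b) \<in> Ro"
proof (rule Ro_sum, rule Ro_mult)
  fix b assume b: "b \<in> B"
  show "(\<lambda>t. c b (x t)) \<in> Ro" using assms by (intro Ro_smooth1[of x V "c b"]) (auto simp: nf_data_def)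
  show "(\<lambda>t. tpow t b) \<in> Ro" using assms b by (intro Ro_tpow) (auto simp: nf_data_def)
qed

lemma nf_fclass:
  assumes "nf_data V B c" "x \<in> Ro" "x 0 \<in> V"
  shows "nf B c (fclass x) = fclass (\<lambda>t. \<Sum>b\<in>B. c b (x t) * tpow t b)"
  unfolding nf_def
proof (rule fclass_eqI)
  have fx: "frep (fclass x) 0 = x 0" using st_fclass[OF assms(2)] by (simp add: st_def)
  then show "(\<lambda>t. \<Sum>b\<in>B. c b (frep (fclass x) t) * tpow t b) \<in> Ro"
    using assms by (intro nf_sum_Ro[of V]) auto
  have "little_o (\<lambda>t. c b (frep (fclass x) t) - c b (x t))" for b
    using assms fx by (intro little_o_smooth1[of _ _ V "c b"] frep_fclass) (auto simp: nf_data_def)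
  then have "little_o (\<lambda>t. \<Sum>b\<in>B. tpow t b * (c b (frep (fclass x) t) - c b (x t)))"
    using assms(1) unfolding nf_data_def by (intro little_o_sum little_o_mult Ro_tpow) auto
  then show "little_o (\<lambda>t. (\<Sum>b\<in>B. c b (frep (fclass x) t) * tpow t b) - (\<Sum>b\<in>B. c b (x t) * tpow t b))"
    by (simp add: sum_subtractf algebra_simps)
qed

lemma nf_uexp:
  assumes V: "open V" and G: "uexp V G B c" and y: "st y \<in> V" and Ro: "(\<lambda>t. \<Sum>b\<in>B. c b (frep y t) * tpow t b) \<in> Ro"
  shows "fclass (\<lambda>t. G t (frep y t)) = nf B c y"
proof -
  have "little_o (\<lambda>t. G t (frep y t) - (\<Sum>b\<in>B. c b (frep y t) * tpow t b))"
    using G y V unfolding uexp_def st_def by (intro unif_o_little_o_along Ro_eventually_in) auto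
  from fclass_eqI[OF Ro little_o_swap[OF this]] show ?thesis by (simp add: nf_def)
qed

lemma vec_snoc_simps: "vec_snoc d q y d = y" "i < d \<Longrightarrow> vec_snoc d q y i = q i" "d < i \<Longrightarrow> vec_snoc d q y i = 0"
  by (auto simp: vec_snoc_def)

lemma bext_vec_snoc: "bext d \<alpha> p y = fclass (\<lambda>t. \<alpha> (vec_snoc d (\<lambda>i. frep (p i) t) (frep y t)))"
  by (simp add: bext_def vec_snoc_def)

text \<open>A closed ball inside \<open>V\<close> is the compact set on which the expansions are
  uniform. The families of \<open>\<alpha>\<close> and of \<open>pdiff d \<alpha>\<close> are
  expanded together, so that the derivative computed from this representation appears as the normal
  form with differentiated coefficients.\<close>

lemma local_rep_imp_nf:
  assumes L: "local_rep S f x d P p V \<alpha>"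
  obtains r B c where "r > 0" "nf_data (ball (st x) r) B c"
    "\<And>y. y \<in> S \<Longrightarrow> st y \<in> ball (st x) r \<Longrightarrow> f y = nf B c y"
    "bext d (pdiff d \<alpha>) p x = nf B (\<lambda>b. deriv (c b)) x"
proof -
  have V: "open V" "st x \<in> V" and sm: "smooth_Rn (Suc d) (prodset d P V) \<alpha>"
    and pP: "(\<lambda>i. if i < d then st (p i) else 0) \<in> P"
    and f: "\<And>y. y \<in> S \<Longrightarrow> st y \<in> V \<Longrightarrow> f y = bext d \<alpha> p y"
    using L unfolding local_rep_def by auto
  obtain r where r: "r > 0" "cball (st x) r \<subseteq> V" using V open_contains_cball by blast
  let ?K = "cball (st x) r" and ?W = "ball (st x) r"
  define G where "G t y = \<alpha> (vec_snoc d (\<lambda>i. frep (p i) t) y)" for t y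
  define H where "H t y = pdiff d \<alpha> (vec_snoc d (\<lambda>i. frep (p i) t) y)" for t y
  have pU: "vec_snoc d (\<lambda>i. frep (p i) 0) y \<in> prodset d P V" if "y \<in> ?K" for y
  proof -
    have "(\<lambda>i. if i < d then vec_snoc d (\<lambda>i. frep (p i) 0) y i else 0) = (\<lambda>i. if i < d then st (p i) else 0)"
      by (auto simp: vec_snoc_def st_def)
    then show ?thesis using pP that r unfolding prodset_def by (auto simp: vec_snoc_simps)
  qed
  note multi = sfam_multi[where d = d and g = \<alpha> and U = "prodset d P V" and K = ?K and V = ?W and p = "\<lambda>i. frep (p i)",
      OF sm compact_cball ball_subset_cball pU frep_Ro]
  have \<alpha>: "\<alpha> \<in> pderivs (Suc d) \<alpha>" "pdiff d \<alpha> \<in> pderivs (Suc d) \<alpha>"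
    by (auto intro: pderivs.intros)
  have G: "sfam n ?W G" and H: "sfam n ?W H" for n
    unfolding G_def H_def by (rule multi(1)[OF _ \<alpha>(1)], assumption) (rule multi(1)[OF _ \<alpha>(2)], assumption)
  have GH: "\<forall>\<^sub>F t in near0. \<forall>y\<in>?W. (G t has_real_derivative H t y) (at y)"
    using multi(2)[OF _ \<alpha>(1)] unfolding G_def H_def o_def .
  obtain B c where c: "\<And>b. smooth1 ?W (c b)" "\<And>b. b \<notin> B \<Longrightarrow> c b = (\<lambda>_. 0)"
    "uexp ?W G B c" "uexp ?W H B (\<lambda>b. deriv (c b))"
    by (rule sfam_normal_form[OF open_ball G sfam_expandable[OF H[of 0]] GH]) (rule that; assumption)
  have nd: "nf_data ?W B c" using c unfolding nf_data_def uexp_def by auto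
  have fy: "f y = nf B c y" if y: "y \<in> S" "st y \<in> ?W" for y
  proof -
    have "f y = fclass (\<lambda>t. G t (frep y t))"
    proof -
      have "st y \<in> V" using y(2) r(2) ball_subset_cball by blast
      then show ?thesis using f[OF y(1)] by (simp only: bext_vec_snoc G_def)
    qed
    also have "\<dots> = nf B c y"
      by (rule nf_uexp[OF open_ball c(3) y(2) nf_sum_Ro[OF nd frep_Ro y(2)[unfolded st_def[of y]]]])
    finally show ?thesis .
  qed
  have "bext d (pdiff d \<alpha>) p x = nf B (\<lambda>b. deriv (c b)) x"
  proof -
    have x: "st x \<in> ?W" using r by simp
    have "bext d (pdiff d \<alpha>) p x = fclass (\<lambda>t. H t (frep x t))"
      by (simp only: bext_vec_snoc H_def)
    also have "\<dots> = nf B (\<lambda>b. deriv (c b)) x"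
      using nf_uexp[where G = H and c = "\<lambda>b. deriv (c b)", OF open_ball c(4) x]
        nf_sum_Ro[OF nf_data_deriv[OF nd], of "frep x"] x by (simp add: st_def)
    finally show ?thesis .
  qed
  then show thesis using that[OF r(1) nd fy] by simp
qed

text \<open>A class of functions that contains the normal forms, with the powers of t as parameters, and is
  closed under partial derivatives.\<close>

definition affine_in_params :: "nat \<Rightarrow> real set \<Rightarrow> ((nat \<Rightarrow> real) \<Rightarrow> real) \<Rightarrow> bool" where
  "affine_in_params k V h \<longleftrightarrow> (\<exists>a a0. (\<forall>j. smooth1 V (a j)) \<and> smooth1 V a0 \<and>
     (\<forall>z\<in>prodset k (Rn k) V. h z = (\<Sum>j<k. z j * a j (z k)) + a0 (z k)))"

lemma prodset_Rn_iff: "z \<in> prodset k (Rn k) V \<longleftrightarrow> z k \<in> V \<and> (\<forall>i>k. z i = 0)"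
  by (auto simp: prodset_def Rn_def)

lemma affine_in_params_pdiff:
  assumes V: "open V" and h: "affine_in_params k V h" and i: "i < Suc k"
  shows "affine_in_params k V (pdiff i h)"
    and "z \<in> prodset k (Rn k) V \<Longrightarrow> (\<lambda>s::real. h (z(i := z i + s))) differentiable (at 0)"
proof -
  obtain a a0 where a: "\<And>j. smooth1 V (a j)" "smooth1 V a0"
    and hz: "\<And>z. z \<in> prodset k (Rn k) V \<Longrightarrow> h z = (\<Sum>j<k. z j * a j (z k)) + a0 (z k)"
    using h unfolding affine_in_params_def by blast
  \<comment> \<open>In the last coordinate the coefficient functions are differentiated; in a
    parameter the derivative is the coefficient \<open>a i\<close> itself, affine with zero linear
    part.\<close>
  define D where "D z = (if i = k then (\<Sum>j<k. z j * deriv (a j) (z k)) + deriv a0 (z k) else a i (z k))" for z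
  have D: "((\<lambda>s. h (z(i := z i + s))) has_real_derivative D z) (at 0)" if z: "z \<in> prodset k (Rn k) V" for z
  proof (cases "i = k")
    case True
    have zV: "z k \<in> V" using z by (simp add: prodset_Rn_iff)
    then obtain r where r: "r > 0" "ball (z k) r \<subseteq> V" using V open_contains_ball by blast
    have sh: "((\<lambda>s::real. g (z k + s)) has_real_derivative deriv g (z k)) (at 0)" if "smooth1 V g" for g
      using DERIV_shift[of g "deriv g (z k)" 0 "z k"] smooth1_DERIV[OF that zV] by (simp add: add.commute)
    have "((\<lambda>s. (\<Sum>j<k. z j * a j (z k + s)) + a0 (z k + s)) has_real_derivative D z) (at 0)"
      unfolding D_def using True by (auto intro!: DERIV_add DERIV_sum DERIV_cmult sh a)
    then show ?thesis
    proof (rule has_field_derivative_transform_within_open[OF _ open_ball[of 0 r]])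
      fix s :: real assume "s \<in> ball 0 r"
      then have "z k + s \<in> V" using r by (auto simp: dist_real_def subset_iff)
      then have "z(k := z k + s) \<in> prodset k (Rn k) V" using z by (simp add: prodset_Rn_iff)
      from hz[OF this] show "(\<Sum>j<k. z j * a j (z k + s)) + a0 (z k + s) = h (z(i := z i + s))"
        using True by simp
    qed (use r in auto)
  next
    case False
    with i have ik: "i < k" by simp
    have "h (z(i := z i + s)) = (\<Sum>j<k. z j * a j (z k)) + a0 (z k) + s * a i (z k)" for s
    proof -
      have "z(i := z i + s) \<in> prodset k (Rn k) V" using z ik by (auto simp: prodset_Rn_iff)
      from hz[OF this] have "h (z(i := z i + s)) = (\<Sum>j<k. z j * a j (z k) + (if j = i then s * a i (z k) else 0)) + a0 (z k)"
        using ik by (auto simp: algebra_simps intro!: sum.cong)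
      then show ?thesis using ik by (simp add: sum.distrib)
    qed
    then show ?thesis using False by (auto simp: D_def intro!: derivative_eq_intros)
  qed
  then show "z \<in> prodset k (Rn k) V \<Longrightarrow> (\<lambda>s::real. h (z(i := z i + s))) differentiable (at 0)"
    unfolding real_differentiable_def by blast
  have eq: "pdiff i h z = D z" if "z \<in> prodset k (Rn k) V" for z
    unfolding pdiff_def by (rule DERIV_imp_deriv[OF D[OF that]])
  show "affine_in_params k V (pdiff i h)"
  proof (cases "i = k")
    case True
    then show ?thesis unfolding affine_in_params_def using a
      by (intro exI[of _ "\<lambda>j. deriv (a j)"] exI[of _ "deriv a0"]) (auto simp: eq[unfolded True] D_def[unfolded True] intro: smooth1_deriv)
  next
    case False
    then show ?thesis unfolding affine_in_params_def using a
      by (intro exI[of _ "\<lambda>j _. 0"] exI[of _ "a i"]) (auto simp: eq D_def smooth1_const)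
  qed
qed

lemma affine_in_params_cont:
  assumes h: "affine_in_params k V h"
  shows "cont_Rn (Suc k) (prodset k (Rn k) V) h"
  unfolding cont_Rn_def
proof (intro ballI allI impI)
  fix x and e :: real assume x: "x \<in> prodset k (Rn k) V" and e: "e > 0"
  let ?U = "prodset k (Rn k) V"
  obtain a a0 where a: "\<And>j. smooth1 V (a j)" "smooth1 V a0"
    and hz: "\<And>z. z \<in> ?U \<Longrightarrow> h z = (\<Sum>j<k. z j * a j (z k)) + a0 (z k)"
    using h unfolding affine_in_params_def by blast
  \<comment> \<open>This filter encodes the \<delta>-condition of \<open>cont_Rn\<close>, so that
    the limit rules for sums and products apply.\<close>
  define F where "F = inf (filtercomap (edist (Suc k) x) (nhds 0)) (principal ?U)"
  have F: "eventually Q F \<longleftrightarrow> (\<exists>\<delta>>0. \<forall>y\<in>?U. edist (Suc k) x y < \<delta> \<longrightarrow> Q y)" for Q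
  proof -
    have nn: "0 \<le> edist (Suc k) x y" for y unfolding edist_def by (simp add: sum_nonneg)
    show ?thesis
    proof
      assume "eventually Q F"
      then obtain R where R: "eventually R (nhds 0)" "\<And>y. R (edist (Suc k) x y) \<Longrightarrow> y \<in> ?U \<Longrightarrow> Q y"
        unfolding F_def eventually_inf_principal eventually_filtercomap by blast
      then obtain \<delta> where "\<delta> > 0" "\<And>s. dist s 0 < \<delta> \<Longrightarrow> R s" unfolding eventually_nhds_metric by blast
      then show "\<exists>\<delta>>0. \<forall>y\<in>?U. edist (Suc k) x y < \<delta> \<longrightarrow> Q y"
        using R(2) nn by (intro exI[of _ \<delta>]) (auto simp: dist_real_def)
    next
      assume "\<exists>\<delta>>0. \<forall>y\<in>?U. edist (Suc k) x y < \<delta> \<longrightarrow> Q y"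
      then obtain \<delta> where "\<delta> > 0" "\<forall>y\<in>?U. edist (Suc k) x y < \<delta> \<longrightarrow> Q y" by blast
      then show "eventually Q F" unfolding F_def eventually_inf_principal eventually_filtercomap
        by (intro exI[of _ "\<lambda>s. s < \<delta>"] conjI) (auto intro: eventually_nhds_in_open[of "{..<\<delta>}", simplified])
    qed
  qed
  have coord: "((\<lambda>y. y i) \<longlongrightarrow> x i) F" if "i < Suc k" for i
    unfolding tendsto_iff
  proof (intro allI impI)
    fix e :: real assume "e > 0"
    then show "\<forall>\<^sub>F y in F. dist (y i) (x i) < e" unfolding F
      using edist_ge_coord[OF that, of x] by (intro exI[of _ e]) (auto simp: dist_real_def abs_minus_commute intro: le_less_trans)
  qed
  have comp: "((\<lambda>y. g (y k)) \<longlongrightarrow> g (x k)) F" if "smooth1 V g" for g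
    using isCont_tendsto_compose[OF DERIV_isCont[OF smooth1_DERIV[OF that]] coord[of k]] x
    by (simp add: prodset_Rn_iff)
  have "((\<lambda>z. (\<Sum>j<k. z j * a j (z k)) + a0 (z k)) \<longlongrightarrow> (\<Sum>j<k. x j * a j (x k)) + a0 (x k)) F"
    by (intro tendsto_intros coord comp a) auto
  moreover have "\<forall>\<^sub>F z in F. (\<Sum>j<k. z j * a j (z k)) + a0 (z k) = h z" unfolding F using hz by (intro exI[of _ 1]) auto
  ultimately have "(h \<longlongrightarrow> h x) F" unfolding hz[OF x] by (rule Lim_transform_eventually)
  then have "\<forall>\<^sub>F y in F. dist (h y) (h x) < e" using e unfolding tendsto_iff by blast
  then show "\<exists>\<delta>>0. \<forall>y\<in>?U. edist (Suc k) x y < \<delta> \<longrightarrow> \<bar>h y - h x\<bar> < e" unfolding F dist_real_def .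
qed

lemma affine_in_params_smooth:
  assumes V: "open V" and h: "affine_in_params k V h"
  shows "smooth_Rn (Suc k) (prodset k (Rn k) V) h"
proof -
  have *: "affine_in_params k V g" if "g \<in> pderivs (Suc k) h" for g
    using that by induction (use affine_in_params_pdiff(1)[OF V] h in auto)
  have "open_Rn (Suc k) (prodset k (Rn k) V)"
    unfolding open_Rn_def
  proof (intro conjI ballI)
    show "prodset k (Rn k) V \<subseteq> Rn (Suc k)" by (intro subsetI) (simp add: prodset_Rn_iff, simp add: Rn_def)
    fix x assume x: "x \<in> prodset k (Rn k) V"
    then obtain r where r: "r > 0" "ball (x k) r \<subseteq> V" using V open_contains_ball unfolding prodset_Rn_iff by blast
    have "y \<in> prodset k (Rn k) V" if "y \<in> Rn (Suc k)" "edist (Suc k) x y < r" for y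
    proof -
      have "\<bar>x k - y k\<bar> < r" using edist_ge_coord[of k "Suc k" x y] that by simp
      then have "y k \<in> V" using r(2) by (auto simp: dist_real_def subset_iff)
      then show ?thesis using that(1) by (simp add: prodset_Rn_iff, simp add: Rn_def)
    qed
    then show "\<exists>e>0. \<forall>y\<in>Rn (Suc k). edist (Suc k) x y < e \<longrightarrow> y \<in> prodset k (Rn k) V" using r(1) by blast
  qed
  then show ?thesis unfolding smooth_Rn_def
    using * affine_in_params_cont affine_in_params_pdiff(2)[OF V] by blast
qed

text \<open>The j-th parameter is the Fermat real of the power with exponent \<open>h j\<close>. The
  normal form is then linear in the parameters, and the parameter domain can be all of
  \<open>Rn k\<close>.\<close>

lemma nf_imp_local_rep:
  assumes nd: "nf_data V B c" and f: "\<And>y. y \<in> S \<Longrightarrow> st y \<in> V \<Longrightarrow> f y = nf B c y" and x: "st x \<in> V"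
  obtains d P p \<alpha> where "local_rep S f x d P p V \<alpha>" "bext d (pdiff d \<alpha>) p x = nf B (\<lambda>b. deriv (c b)) x"
proof -
  have V: "open V" and B: "finite B" "B \<subseteq> {0..1}" and c: "\<And>b. smooth1 V (c b)"
    using nd unfolding nf_data_def by auto
  define k where "k = card B"
  obtain h where h: "bij_betw h {..<k} B"
    using ex_bij_betw_nat_finite[OF B(1)] unfolding k_def lessThan_atLeast0 by blast
  then have hB: "j < k \<Longrightarrow> h j \<in> B" for j unfolding bij_betw_def by auto
  then have h0: "j < k \<Longrightarrow> 0 \<le> h j" for j using B by force
  define \<alpha> where "\<alpha> z = (\<Sum>j<k. z j * c (h j) (z k))" for z
  define p where "p j = fclass (\<lambda>t. tpow t (h j))" for j
  have aff: "affine_in_params k V \<alpha>" unfolding affine_in_params_def \<alpha>_def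
    by (intro exI[of _ "\<lambda>j. c (h j)"] exI[of _ "\<lambda>_. 0"]) (auto simp: c smooth1_const)
  \<comment> \<open>Stated for arbitrary \<open>g\<close> and coefficients \<open>e\<close>, since
    it is applied both to \<open>\<alpha>\<close> and to its partial derivative in the last
    coordinate.\<close>
  have ext: "bext k g p y = nf B e y"
    if g: "\<And>z. z \<in> prodset k (Rn k) V \<Longrightarrow> g z = (\<Sum>j<k. z j * e (h j) (z k))"
      and e: "nf_data V B e" and y: "st y \<in> V" for g e y
  proof -
    have re: "(\<Sum>b\<in>B. e b (frep y t) * tpow t b) = (\<Sum>j<k. tpow t (h j) * e (h j) (frep y t))" for t
      using sum.reindex_bij_betw[OF h, of "\<lambda>b. e b (frep y t) * tpow t b"] by (simp add: mult.commute)
    have "\<forall>\<^sub>F t in near0. frep y t \<in> V" using y V by (intro Ro_eventually_in) (auto simp: st_def)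
    then have 1: "\<forall>\<^sub>F t in near0. g (vec_snoc k (\<lambda>i. frep (p i) t) (frep y t)) = (\<Sum>j<k. frep (p j) t * e (h j) (frep y t))"
      by eventually_elim (subst g, auto simp: prodset_Rn_iff vec_snoc_def)
    have "little_o (\<lambda>t. \<Sum>j<k. e (h j) (frep y t) * (frep (p j) t - tpow t (h j)))"
    proof (intro little_o_sum little_o_mult)
      fix j assume j: "j \<in> {..<k}"
      show "(\<lambda>t. e (h j) (frep y t)) \<in> Ro"
        using e y V by (intro Ro_smooth1[of "frep y" V "e (h j)"]) (auto simp: nf_data_def st_def)
      show "little_o (\<lambda>t. frep (p j) t - tpow t (h j))"
        using j unfolding p_def by (intro frep_fclass Ro_tpow h0) auto
    qed
    then have 2: "little_o (\<lambda>t. (\<Sum>j<k. frep (p j) t * e (h j) (frep y t)) - (\<Sum>b\<in>B. e b (frep y t) * tpow t b))"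
      unfolding re by (simp add: sum_subtractf algebra_simps)
    have 3: "little_o (\<lambda>t. g (vec_snoc k (\<lambda>i. frep (p i) t) (frep y t)) - (\<Sum>b\<in>B. e b (frep y t) * tpow t b))"
      by (rule little_o_le[OF _ 2, of _ 1]) (use 1 in \<open>auto elim: eventually_mono\<close>)
    have 4: "(\<lambda>t. \<Sum>b\<in>B. e b (frep y t) * tpow t b) \<in> Ro" using nf_sum_Ro[OF e] y by (simp add: st_def)
    show ?thesis unfolding bext_vec_snoc nf_def by (rule fclass_eqI[OF 4 little_o_swap[OF 3], symmetric])
  qed
  have "local_rep S f x k (Rn k) p V \<alpha>"
    unfolding local_rep_def
  proof (intro conjI ballI impI)
    show "open_Rn k (Rn k)" unfolding open_Rn_def by (auto intro: exI[of _ 1])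
    show "smooth_Rn (Suc k) (prodset k (Rn k) V) \<alpha>" by (rule affine_in_params_smooth[OF V aff])
    show "f y = bext k \<alpha> p y" if "y \<in> S" "st y \<in> V" for y
      using f[OF that] ext[of \<alpha> c y] nd that by (simp add: \<alpha>_def)
  qed (use V x in \<open>auto simp: Rn_def\<close>)
  moreover have "bext k (pdiff k \<alpha>) p x = nf B (\<lambda>b. deriv (c b)) x"
  proof (rule ext[OF _ nf_data_deriv[OF nd] x])
    fix z assume z: "z \<in> prodset k (Rn k) V"
    then have zk: "z k \<in> V" by (simp add: prodset_Rn_iff)
    have sh: "((\<lambda>s. c b (z k + s)) has_real_derivative deriv (c b) (z k)) (at 0)" for b
      using DERIV_shift[of "c b" "deriv (c b) (z k)" 0 "z k"] smooth1_DERIV[OF c zk] by (simp add: add.commute)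
    have "((\<lambda>s. \<alpha> (z(k := z k + s))) has_real_derivative (\<Sum>j<k. z j * deriv (c (h j)) (z k))) (at 0)"
      unfolding \<alpha>_def by (auto intro!: DERIV_sum DERIV_cmult sh)
    then show "pdiff k \<alpha> z = (\<Sum>j<k. z j * deriv (c (h j)) (z k))"
      unfolding pdiff_def by (rule DERIV_imp_deriv)
  qed
  ultimately show thesis by (rule that)
qed

subsection \<open>Uniqueness of coefficients and derivatives\<close>

text \<open>For a non-infinitesimal interval J, the set A is the open interval between the standard parts
  of the endpoints.\<close>

definition skeleton :: "fermat set \<Rightarrow> real set \<Rightarrow> bool" where
  "skeleton J A \<longleftrightarrow> open A \<and> convex A \<and> A \<noteq> {} \<and> (\<forall>y\<in>A. fconst y \<in> J) \<and> (\<forall>x\<in>J. st x \<in> closure A)"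

section \<open>Intervals and their standard parts\<close>

lemma fle_imp_st: "fle x y \<Longrightarrow> st x \<le> st y"
  unfolding fle_def st_def by (metis little_o_at_zero add.right_neutral order_refl)

lemma st_less_imp_fle: assumes "st x < st y" shows "fle x y"
proof -
  define e where "e = (st y - st x) / 2"
  have e: "e > 0" using assms by (simp add: e_def)
  have "\<forall>\<^sub>F t in near0. frep x t \<le> frep y t + 0"
    using Ro_near[OF frep_Ro[of x] e] Ro_near[OF frep_Ro[of y] e]
  proof eventually_elim
    case (elim t)
    have "st y = st x + 2 * e" by (simp add: e_def field_simps)
    then show ?case using elim by (simp add: st_def abs_le_iff)
  qed
  then show ?thesis unfolding fle_def eventually_near0
    by (intro bexI[of _ "\<lambda>_. 0"] conjI little_o_zero zero_in_Ro) auto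
qed

lemma xle_imp_xst: "xle a b \<Longrightarrow> xst a \<le> xst b"
  by (cases a; cases b) (auto intro: fle_imp_st)

lemma xst_less_imp_xlt: "xst a < xst b \<Longrightarrow> xlt a b"
  by (cases a; cases b) (auto simp: xlt_def intro: st_less_imp_fle)

text \<open>A point below \<open>R\<close> is approached from the right and one equal to
  \<open>R\<close> from the left; \<open>L < R\<close> leaves room in either case.\<close>

lemma in_closure_ereal_interval:
  assumes "L < R" "L \<le> ereal s" "ereal s \<le> R"
  shows "s \<in> closure {y. L < ereal y \<and> ereal y < R}"
proof -
  have "\<exists>y\<in>{y. L < ereal y \<and> ereal y < R}. dist y s < e" if e: "e > 0" for e
  proof (cases "ereal s < R")
    case True
    then have "ereal s < min (ereal (s + e)) R" using e by simp
    then obtain z where z: "ereal s < ereal z" "ereal z < min (ereal (s + e)) R" using ereal_dense2 by blast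
    then have "L < ereal z" using assms(2) by (meson le_less_trans)
    then show ?thesis using z by (intro bexI[of _ z]) (auto simp: dist_real_def)
  next
    case False
    then have "max (ereal (s - e)) L < ereal s" using assms e by auto
    then obtain z where z: "max (ereal (s - e)) L < ereal z" "ereal z < ereal s" using ereal_dense2 by blast
    then have "ereal z < R" using assms(3) by (meson less_le_trans)
    then show ?thesis using z by (intro bexI[of _ z]) (auto simp: dist_real_def)
  qed
  then show ?thesis unfolding closure_approachable by blast
qed

lemma ninf_interval_skeleton:
  assumes "ninf_interval J" obtains A where "skeleton J A"
proof -
  \<comment> \<open>Each of the four kinds of interval lies between the open and the closed one with
    the same endpoints; these two inclusions treat all of them at once.\<close>
  obtain a b where ab: "xst a < xst b" and
    J: "{x. xlt a (Fin x) \<and> xlt (Fin x) b} \<subseteq> J" "J \<subseteq> {x. xle a (Fin x) \<and> xle (Fin x) b}"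
    using assms unfolding ninf_interval_def by (fastforce simp: xlt_def)
  define A where "A = {y. xst a < ereal y \<and> ereal y < xst b}"
  have "open A" unfolding A_def by (intro open_Collect_conj open_Collect_less continuous_intros)
  moreover have "convex A"
    unfolding is_interval_convex_1[symmetric] is_interval_1 A_def
    by (auto intro: less_le_trans le_less_trans simp flip: ereal_less_eq(3))
  moreover have "A \<noteq> {}" using ereal_dense2[OF ab] by (auto simp: A_def)
  moreover have "fconst y \<in> J" if "y \<in> A" for y
    using J(1) that xst_less_imp_xlt[of a "Fin (fconst y)"] xst_less_imp_xlt[of "Fin (fconst y)" b]
    by (auto simp: A_def)
  moreover have "st x \<in> closure A" if "x \<in> J" for x
    unfolding A_def using J(2) that xle_imp_xst[of a "Fin x"] xle_imp_xst[of "Fin x" b]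
    by (intro in_closure_ereal_interval ab) auto
  ultimately show thesis using that unfolding skeleton_def by blast
qed

text \<open>The closure of a convex set is convex and so contains the segment, and an open convex
  set is the interior of its closure.\<close>

lemma open_convex_between_closure:
  fixes A :: "real set"
  assumes "open A" "convex A" "a \<in> closure A" "b \<in> closure A" shows "{a<..<b} \<subseteq> A"
proof -
  have "{a..b} \<subseteq> closure A"
  proof
    fix c assume "c \<in> {a..b}"
    then have "c \<in> closed_segment a b" by (auto simp: closed_segment_eq_real_ivl split: if_splits)
    then show "c \<in> closure A"
      using assms convex_closure[OF assms(2)] by (meson convex_contains_segment subsetD)
  qed
  then have "{a<..<b} \<subseteq> interior (closure A)" by (intro interior_maximal) auto
  then show ?thesis using convex_interior_closure[OF assms(2)] interior_open[OF assms(1)] by simp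
qed

lemma skeleton_image_convex: assumes "skeleton J A" shows "convex (st ` J)" and "A \<subseteq> st ` J"
proof -
  show A: "A \<subseteq> st ` J" using assms unfolding skeleton_def by (metis image_eqI st_fconst subsetI)
  have "c \<in> st ` J" if "a \<in> st ` J" "b \<in> st ` J" "a \<le> c" "c \<le> b" for a b c
  proof (cases "c = a \<or> c = b")
    case False
    have "{a<..<b} \<subseteq> A" using that(1,2) assms unfolding skeleton_def by (intro open_convex_between_closure) auto
    moreover have "c \<in> {a<..<b}" using False that(3,4) by auto
    ultimately show ?thesis using A by blast
  qed (use that in auto)
  then show "convex (st ` J)" unfolding is_interval_convex_1[symmetric] is_interval_1 by blast
qed

section \<open>Determination of the coefficients by values\<close>

lemma nf_fconst:
  assumes "nf_data V B c" "y \<in> V" shows "nf B c (fconst y) = fclass (\<lambda>t. \<Sum>b\<in>B. c b y * tpow t b)"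
  unfolding fconst_def using nf_fclass[OF assms(1) Ro_const] assms(2) .

text \<open>At a real point the coefficients are numbers and the powers of t are independent. At a
  non-real point they are not determined, as an infinitesimal part of the point can stand for a
  power of t.\<close>

lemma nf_fconst_inject:
  assumes c: "nf_data V B c" and c': "nf_data V' B' c'" and y: "y \<in> V" "y \<in> V'"
    and eq: "nf B c (fconst y) = nf B' c' (fconst y)"
  shows "c b y = c' b y"
proof -
  define E where "E = B \<union> B'"
  have E: "finite E" "E \<subseteq> {0..1}" "B \<subseteq> E" "B' \<subseteq> E" using c c' unfolding nf_data_def E_def by auto
  note ce = nf_data_enlarge[OF c E(1,3,2)] nf_data_enlarge[OF c' E(1,4,2)]
  have "fclass (\<lambda>t. \<Sum>b\<in>E. c b y * tpow t b) = fclass (\<lambda>t. \<Sum>b\<in>E. c' b y * tpow t b)"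
    using eq nf_enlarge[OF c E(1,3)] nf_enlarge[OF c' E(1,4)] nf_fconst[OF ce(1) y(1)] nf_fconst[OF ce(2) y(2)] by simp
  then have "little_o (\<lambda>t. (\<Sum>b\<in>E. c b y * tpow t b) - (\<Sum>b\<in>E. c' b y * tpow t b))"
    by (rule fclass_eqD) (use nf_sum_Ro[OF ce(1) Ro_const] nf_sum_Ro[OF ce(2) Ro_const] y in auto)
  then have "little_o (\<lambda>t. \<Sum>b\<in>E. (c b y - c' b y) * tpow t b)"
    by (simp add: sum_subtractf left_diff_distrib)
  from little_o_tpow_sum_zero[OF E(1,2) this] have "b \<in> E \<Longrightarrow> c b y = c' b y" by simp
  moreover have "b \<notin> E \<Longrightarrow> c b y = c' b y" using c c' unfolding nf_data_def E_def by auto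
  ultimately show ?thesis by blast
qed

text \<open>The derivatives agree on the open set \<open>A \<inter> V\<close> and are continuous up
  to \<open>s\<close>. At an endpoint of the skeleton this gives equal jets, although the functions
  may differ beyond it.\<close>

lemma smooth1_jet_closure:
  assumes A: "open A" "s \<in> closure A" and V: "open V" "s \<in> V" and g: "smooth1 V g" "smooth1 V h"
    and eq: "\<And>y. y \<in> A \<Longrightarrow> y \<in> V \<Longrightarrow> g y = h y"
  shows "(deriv ^^ n) g s = (deriv ^^ n) h s"
proof -
  obtain r where r: "r > 0" "cball s r \<subseteq> V" using V open_contains_cball by blast
  \<comment> \<open>Restriction to a ball keeps the closure inside \<open>V\<close>, where the
    derivatives are continuous.\<close>
  define T where "T = A \<inter> ball s r"
  have sT: "s \<in> closure T"
    using open_Int_closure_subset[of "ball s r" A] A(2) r(1) unfolding T_def by (auto simp: Int_commute)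
  have "closure T \<subseteq> cball s r" unfolding T_def by (intro closure_minimal) auto
  then have TV: "closure T \<subseteq> V" using r by blast
  have "T \<subseteq> A \<inter> V" using r ball_subset_cball unfolding T_def by blast
  then have "\<forall>y\<in>T. (deriv ^^ n) g y - (deriv ^^ n) h y = 0"
    using higher_deriv_cong_open[of "A \<inter> V" g h _ n] A V eq by auto
  moreover have "continuous_on (closure T) (\<lambda>y. (deriv ^^ n) g y - (deriv ^^ n) h y)"
    by (intro continuous_on_diff smooth1_continuous_on[OF g(1) TV] smooth1_continuous_on[OF g(2) TV])
  ultimately have "(deriv ^^ n) g s - (deriv ^^ n) h s = 0"
    using continuous_constant_on_closure[of T "\<lambda>y. (deriv ^^ n) g y - (deriv ^^ n) h y" 0] sT by blast
  then show ?thesis by simp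
qed

text \<open>Agreement on \<open>A\<close> gives equal jets at \<open>st x\<close>, and these
  determine the extensions on the monad. The derivatives of the coefficients agree on the open set
  \<open>A \<inter> V \<inter> V'\<close>, so the same argument applies to them.\<close>

lemma nf_cong_closure:
  assumes A: "open A" and c: "nf_data V B c" and c': "nf_data V' B' c'" and x: "st x \<in> V" "st x \<in> V'" "st x \<in> closure A"
    and eq: "\<And>b y. y \<in> A \<Longrightarrow> y \<in> V \<Longrightarrow> y \<in> V' \<Longrightarrow> c b y = c' b y"
  shows "nf B c x = nf B' c' x" "nf B (\<lambda>b. deriv (c b)) x = nf B' (\<lambda>b. deriv (c' b)) x"
proof -
  define E where "E = B \<union> B'"
  define W where "W = V \<inter> V'"
  have E: "finite E" "E \<subseteq> {0..1}" "B \<subseteq> E" "B' \<subseteq> E" using c c' unfolding nf_data_def E_def by auto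
  have W: "open W" "st x \<in> W" "W \<subseteq> V" "W \<subseteq> V'" using c c' x unfolding nf_data_def W_def by auto
  have key: "nf E g x = nf E h x" if g: "nf_data W E g" and h: "nf_data W E h"
      and gh: "\<And>b y. y \<in> A \<Longrightarrow> y \<in> W \<Longrightarrow> g b y = h b y" for g h
    unfolding nf_def
  proof (rule fclass_eqI)
    show "(\<lambda>t. \<Sum>b\<in>E. g b (frep x t) * tpow t b) \<in> Ro" using nf_sum_Ro[OF g] W by (simp add: st_def)
    have sm: "smooth1 W (g b)" "smooth1 W (h b)" for b using g h unfolding nf_data_def by auto
    have "little_o (\<lambda>t. g b (frep x t) - h b (frep x t))" for b
      by (rule little_o_same_jet[OF frep_Ro W(1) sm(1) _ W(1) sm(2)])
        (use W smooth1_jet_closure[OF A x(3) W(1,2) sm gh] in \<open>auto simp: st_def\<close>)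
    then have "little_o (\<lambda>t. \<Sum>b\<in>E. tpow t b * (g b (frep x t) - h b (frep x t)))"
      using E by (intro little_o_sum little_o_mult Ro_tpow) auto
    then show "little_o (\<lambda>t. (\<Sum>b\<in>E. g b (frep x t) * tpow t b) - (\<Sum>b\<in>E. h b (frep x t) * tpow t b))"
      by (simp add: sum_subtractf algebra_simps)
  qed
  have cW: "nf_data W E c" "nf_data W E c'"
    using c c' E W by (auto intro: nf_data_subset nf_data_enlarge)
  have eqW: "c b y = c' b y" if "y \<in> A" "y \<in> W" for b y using eq that unfolding W_def by blast
  show "nf B c x = nf B' c' x"
    using key[OF cW eqW] nf_enlarge[OF c E(1,3)] nf_enlarge[OF c' E(1,4)] by simp
  have "deriv (c b) y = deriv (c' b) y" if "y \<in> A" "y \<in> W" for b y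
    using that eqW A W(1) by (intro deriv_cong_open[of "A \<inter> W"]) auto
  then show "nf B (\<lambda>b. deriv (c b)) x = nf B' (\<lambda>b. deriv (c' b)) x"
    using key[OF nf_data_deriv[OF cW(1)] nf_data_deriv[OF cW(2)]]
      nf_enlarge[OF nf_data_deriv[OF c] E(1,3)] nf_enlarge[OF nf_data_deriv[OF c'] E(1,4)] by simp
qed

section \<open>Local normal forms and the derivative\<close>

definition nf_rep :: "fermat set \<Rightarrow> (fermat \<Rightarrow> fermat) \<Rightarrow> real set \<Rightarrow> real set \<Rightarrow> (real \<Rightarrow> real \<Rightarrow> real) \<Rightarrow> bool" where
  "nf_rep J f V B c \<longleftrightarrow> nf_data V B c \<and> (\<forall>y\<in>J. st y \<in> V \<longrightarrow> f y = nf B c y)"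

lemma nf_rep_subset: "nf_rep J f V B c \<Longrightarrow> open W \<Longrightarrow> W \<subseteq> V \<Longrightarrow> nf_rep J f W B c"
  unfolding nf_rep_def by (auto intro: nf_data_subset)

lemma fsmooth_nf_rep:
  assumes "fsmooth J f" "x \<in> J" obtains r B c where "r > 0" "nf_rep J f (ball (st x) r) B c"
proof -
  obtain d P p V \<alpha> where L: "local_rep J f x d P p V \<alpha>" using assms unfolding fsmooth_def by blast
  show thesis
  proof (rule local_rep_imp_nf[OF L])
    fix r B c assume "r > 0" "nf_data (ball (st x) r) B c"
      "\<And>y. y \<in> J \<Longrightarrow> st y \<in> ball (st x) r \<Longrightarrow> f y = nf B c y"
    then have "nf_rep J f (ball (st x) r) B c" unfolding nf_rep_def by blast
    with \<open>r > 0\<close> show thesis by (rule that)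
  qed
qed

lemma nf_rep_imp_local_rep:
  assumes "nf_rep J f V B c" "st x \<in> V"
  shows "\<exists>d P p \<alpha>. local_rep J f x d P p V \<alpha> \<and> bext d (pdiff d \<alpha>) p x = nf B (\<lambda>b. deriv (c b)) x"
  by (rule nf_imp_local_rep[of V B c J f x]) (use assms in \<open>auto simp: nf_rep_def\<close>)

lemma fsmoothI:
  assumes "\<And>x. x \<in> J \<Longrightarrow> \<exists>V B c. st x \<in> V \<and> nf_rep J f V B c" shows "fsmooth J f"
  unfolding fsmooth_def
proof
  fix x assume "x \<in> J"
  then obtain V B c where "st x \<in> V" "nf_rep J f V B c" using assms by blast
  then show "\<exists>d P p V \<alpha>. local_rep J f x d P p V \<alpha>" using nf_rep_imp_local_rep by blast
qed

lemma nf_rep_unique: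
  assumes J: "skeleton J A" and c: "nf_rep J f V B c" and c': "nf_rep J f V' B' c'"
    and y: "y \<in> A" "y \<in> V" "y \<in> V'"
  shows "c b y = c' b y"
proof -
  have "fconst y \<in> J" using J y unfolding skeleton_def by blast
  then have "nf B c (fconst y) = nf B' c' (fconst y)" using c c' y unfolding nf_rep_def by (metis st_fconst)
  then show ?thesis using nf_fconst_inject[of V B c V' B' c' y] c c' y unfolding nf_rep_def by blast
qed

text \<open>Any local representation has a normal form of its own, whose coefficients agree with
  \<open>c\<close> on the common part of the skeleton; hence every candidate for the choice in
  \<open>fderiv\<close> has the same value.\<close>

lemma fderiv_nf_rep:
  assumes J: "skeleton J A" and c: "nf_rep J f V B c" and x: "x \<in> J" "st x \<in> V"
  shows "fderiv J f x = nf B (\<lambda>b. deriv (c b)) x"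
  unfolding fderiv_def
proof (rule some_equality)
  have *: "nf_data V B c" "\<And>y. y \<in> J \<Longrightarrow> st y \<in> V \<Longrightarrow> f y = nf B c y" using c unfolding nf_rep_def by auto
  show "\<exists>d P p V \<alpha>. local_rep J f x d P p V \<alpha> \<and> nf B (\<lambda>b. deriv (c b)) x = bext d (pdiff d \<alpha>) p x"
    using nf_rep_imp_local_rep[OF c x(2)] by metis
  fix D assume "\<exists>d P p V \<alpha>. local_rep J f x d P p V \<alpha> \<and> D = bext d (pdiff d \<alpha>) p x"
  then obtain d P p V' \<alpha> where L: "local_rep J f x d P p V' \<alpha>" and D: "D = bext d (pdiff d \<alpha>) p x" by blast
  show "D = nf B (\<lambda>b. deriv (c b)) x"
  proof (rule local_rep_imp_nf[OF L])
    fix r B' c' assume r: "r > 0" "nf_data (ball (st x) r) B' c'"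
      "\<And>y. y \<in> J \<Longrightarrow> st y \<in> ball (st x) r \<Longrightarrow> f y = nf B' c' y"
      and D': "bext d (pdiff d \<alpha>) p x = nf B' (\<lambda>b. deriv (c' b)) x"
    have c': "nf_rep J f (ball (st x) r) B' c'" using r unfolding nf_rep_def by blast
    have "open A" "st x \<in> closure A" using J x unfolding skeleton_def by auto
    then show ?thesis unfolding D D'
      using nf_cong_closure(2)[OF _ r(2) *(1)] nf_rep_unique[OF J c' c] r(1) x(2) by simp
  qed
qed

subsection \<open>Antiderivatives\<close>

lemma same_DERIV_imp_diff_const:
  fixes f g :: "real \<Rightarrow> real"
  assumes "convex S" "\<And>z. z \<in> S \<Longrightarrow> (f has_real_derivative d z) (at z within S)"
    "\<And>z. z \<in> S \<Longrightarrow> (g has_real_derivative d z) (at z within S)" "x \<in> S" "y \<in> S"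
  shows "f x - g x = f y - g y"
proof -
  have "((\<lambda>z. f z - g z) has_real_derivative 0) (at z within S)" if "z \<in> S" for z
    using DERIV_diff[OF assms(2,3)[OF that]] by simp
  then show ?thesis using has_field_derivative_zero_constant[OF assms(1), of "\<lambda>z. f z - g z"] assms(4,5) by metis
qed

lemma smooth1_add_const: assumes "open V" "smooth1 V g" shows "smooth1 V (\<lambda>z. a + g z)"
  by (rule smooth1_primitive[OF assms(1) _ smooth1_deriv[OF assms(2)]])
    (auto intro!: derivative_eq_intros smooth1_DERIV[OF assms(2)])

section \<open>Uniqueness of antiderivatives\<close>

definition fdiff :: "fermat \<Rightarrow> fermat \<Rightarrow> fermat" where
  "fdiff X Y = fclass (\<lambda>t. frep X t - frep Y t)"

lemma fdiff_self: "fdiff X X = fconst 0"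
  by (simp add: fdiff_def fconst_def)

lemma fdiff_eq_zero: assumes "fdiff X Y = fconst 0" shows "X = Y"
proof -
  have "little_o (\<lambda>t. frep X t - frep Y t - 0)"
    using assms unfolding fdiff_def fconst_def by (rule fclass_eqD) (auto intro: Ro_diff Ro_const)
  then have "fclass (frep X) = fclass (frep Y)" by (intro fclass_eqI) auto
  then show ?thesis by simp
qed

text \<open>On the interval \<open>A \<inter> V\<close> the coefficients differ by real constants
  \<open>\<kappa> b\<close>; equality of jets extends this to the monads, including that of an
  endpoint. The constant \<open>C\<close> with these coefficients is a Fermat real and need not be
  real.\<close>

lemma antiderivative_diff_locally_constant:
  assumes J: "skeleton J A" and I: "fsmooth J I1" "fsmooth J I2" and x: "x \<in> J"
    and eq: "\<And>y. y \<in> J \<Longrightarrow> fderiv J I1 y = fderiv J I2 y"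
  obtains r C where "r > 0" "\<And>y. y \<in> J \<Longrightarrow> st y \<in> ball (st x) r \<Longrightarrow> fdiff (I1 y) (I2 y) = C"
proof -
  have A: "open A" "convex A" "\<And>y. y \<in> A \<Longrightarrow> fconst y \<in> J" "\<And>y. y \<in> J \<Longrightarrow> st y \<in> closure A"
    using J unfolding skeleton_def by auto
  obtain r1 B1 c1 where 1: "r1 > 0" "nf_rep J I1 (ball (st x) r1) B1 c1" using fsmooth_nf_rep[OF I(1) x] by blast
  obtain r2 B2 c2 where 2: "r2 > 0" "nf_rep J I2 (ball (st x) r2) B2 c2" using fsmooth_nf_rep[OF I(2) x] by blast
  define r where "r = min r1 r2"
  define V where "V = ball (st x) r"
  have r: "r > 0" using 1 2 by (simp add: r_def)
  have V: "open V" "convex V" "st x \<in> V" using r by (auto simp: V_def)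
  have "V \<subseteq> ball (st x) r1" "V \<subseteq> ball (st x) r2" by (auto simp: V_def r_def)
  then have c1: "nf_rep J I1 V B1 c1" and c2: "nf_rep J I2 V B2 c2"
    using nf_rep_subset[OF 1(2) V(1)] nf_rep_subset[OF 2(2) V(1)] by auto
  then have d1: "nf_data V B1 c1" and d2: "nf_data V B2 c2" unfolding nf_rep_def by auto
  have deq: "deriv (c1 b) y = deriv (c2 b) y" if y: "y \<in> A" "y \<in> V" for b y
    using fderiv_nf_rep[OF J c1 A(3)] fderiv_nf_rep[OF J c2 A(3)] eq[OF A(3)] y
    by (intro nf_fconst_inject[OF nf_data_deriv[OF d1] nf_data_deriv[OF d2] y(2) y(2)]) simp
  \<comment> \<open>The point \<open>st x\<close> is only known to lie in the closure of
    \<open>A\<close>, so a base point \<open>w\<close> is picked inside \<open>A\<close>.\<close>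
  have "A \<inter> V \<noteq> {}" using A(4)[OF x] V open_Int_closure_eq_empty[OF V(1), of A] by blast
  then obtain w where w: "w \<in> A" "w \<in> V" by blast
  define \<kappa> where "\<kappa> b = c1 b w - c2 b w" for b
  have sm: "smooth1 V (c1 b)" "smooth1 V (c2 b)" for b using d1 d2 unfolding nf_data_def by auto
  have c12: "c1 b y = \<kappa> b + c2 b y" if y: "y \<in> A" "y \<in> V" for b y
  proof -
    have "c1 b y - c2 b y = c1 b w - c2 b w"
    proof (rule same_DERIV_imp_diff_const[of "A \<inter> V"])
      fix z assume z: "z \<in> A \<inter> V"
      show "(c1 b has_real_derivative deriv (c1 b) z) (at z within A \<inter> V)"
        using has_field_derivative_at_within[OF smooth1_DERIV[OF sm(1)]] z by auto
      show "(c2 b has_real_derivative deriv (c1 b) z) (at z within A \<inter> V)"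
        using has_field_derivative_at_within[OF smooth1_DERIV[OF sm(2)]] z deq by auto
    qed (use y w A V in \<open>auto intro: convex_Int\<close>)
    then show ?thesis by (simp add: \<kappa>_def)
  qed
  define E where "E = B1 \<union> B2"
  have E: "finite E" "E \<subseteq> {0..1}" "B1 \<subseteq> E" "B2 \<subseteq> E" using d1 d2 unfolding nf_data_def E_def by auto
  define C where "C = fclass (\<lambda>t. \<Sum>b\<in>E. \<kappa> b * tpow t b)"
  have CRo: "(\<lambda>t. \<Sum>b\<in>E. \<kappa> b * tpow t b) \<in> Ro" using E by (intro Ro_sum Ro_mult Ro_const Ro_tpow) auto
  have "fdiff (I1 y) (I2 y) = C" if y: "y \<in> J" "st y \<in> ball (st x) r" for y
  proof -
    have yV: "st y \<in> V" using y by (simp add: V_def)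
    have I1: "I1 y = nf E c1 y" and I2: "I2 y = nf E c2 y"
      using c1 c2 y(1) yV nf_enlarge[OF d1 E(1,3)] nf_enlarge[OF d2 E(1,4)] unfolding nf_rep_def by auto
    have dE: "nf_data V E c1" "nf_data V E c2" using nf_data_enlarge[OF d1 E(1,3,2)] nf_data_enlarge[OF d2 E(1,4,2)] .
    define x1 where "x1 t = (\<Sum>b\<in>E. c1 b (frep y t) * tpow t b)" for t
    define x2 where "x2 t = (\<Sum>b\<in>E. c2 b (frep y t) * tpow t b)" for t
    have xRo: "x1 \<in> Ro" "x2 \<in> Ro" unfolding x1_def x2_def
      using nf_sum_Ro[OF dE(1) frep_Ro[of y]] nf_sum_Ro[OF dE(2) frep_Ro[of y]] yV by (auto simp: st_def)
    have "little_o (\<lambda>t. c1 b (frep y t) - (\<kappa> b + c2 b (frep y t)))" for b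
      by (rule little_o_same_jet[OF frep_Ro V(1) sm(1) _ V(1) smooth1_add_const[OF V(1) sm(2)]])
        (use yV smooth1_jet_closure[OF A(1) A(4)[OF y(1)] V(1) yV sm(1) smooth1_add_const[OF V(1) sm(2)] c12]
         in \<open>auto simp: st_def\<close>)
    then have "little_o (\<lambda>t. \<Sum>b\<in>E. tpow t b * (c1 b (frep y t) - (\<kappa> b + c2 b (frep y t))))"
      using E by (intro little_o_sum little_o_mult Ro_tpow) auto
    then have 0: "little_o (\<lambda>t. (x1 t - x2 t) - (\<Sum>b\<in>E. \<kappa> b * tpow t b))"
      by (simp add: x1_def x2_def sum_subtractf sum.distrib algebra_simps)
    have "little_o (\<lambda>t. (frep (I1 y) t - x1 t) - (frep (I2 y) t - x2 t))"
      unfolding I1 I2 nf_def x1_def[symmetric] x2_def[symmetric] by (intro little_o_diff frep_fclass xRo)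
    from little_o_add[OF this 0]
    have "little_o (\<lambda>t. (frep (I1 y) t - frep (I2 y) t) - (\<Sum>b\<in>E. \<kappa> b * tpow t b))" by (simp add: algebra_simps)
    then show ?thesis unfolding fdiff_def C_def by (intro fclass_eqI Ro_diff) auto
  qed
  with r show thesis by (rule that)
qed

lemma antiderivative_unique:
  assumes J: "skeleton J A" and I: "fsmooth J I1" "fsmooth J I2"
    and eq: "\<And>y. y \<in> J \<Longrightarrow> fderiv J I1 y = fderiv J I2 y"
    and u: "u \<in> J" "I1 u = I2 u" and x: "x \<in> J"
  shows "I1 x = I2 x"
proof -
  \<comment> \<open>The difference is constant on monads, so it descends to a locally constant
    function of the standard part; the standard parts form a connected set.\<close>
  define g where "g s = (let y = (SOME y. y \<in> J \<and> st y = s) in fdiff (I1 y) (I2 y))" for s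
  have loc: "\<exists>r>0. \<exists>C. \<forall>y\<in>J. st y \<in> ball (st x) r \<longrightarrow> fdiff (I1 y) (I2 y) = C" if "x \<in> J" for x
    using antiderivative_diff_locally_constant[OF J I that eq] by metis
  have pick: "(SOME z. z \<in> J \<and> st z = st y) \<in> J \<and> st (SOME z. z \<in> J \<and> st z = st y) = st y" if "y \<in> J" for y
    using that by (intro someI[of "\<lambda>z. z \<in> J \<and> st z = st y" y]) auto
  have g: "g (st y) = fdiff (I1 y) (I2 y)" if y: "y \<in> J" for y
  proof -
    obtain r C where "r > 0" "\<And>z. z \<in> J \<Longrightarrow> st z \<in> ball (st y) r \<Longrightarrow> fdiff (I1 z) (I2 z) = C"
      using loc[OF y] by blast
    then show ?thesis using pick[OF y] y unfolding g_def Let_def by simp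
  qed
  have "g (st x) = g (st u)"
  proof (rule connected_local_const[of "st ` J"])
    show "connected (st ` J)" using skeleton_image_convex(1)[OF J] by (rule convex_connected)
    show "\<forall>a\<in>st ` J. \<forall>\<^sub>F b in at a within st ` J. g a = g b"
    proof
      fix a assume "a \<in> st ` J"
      then obtain y where y: "y \<in> J" "a = st y" by blast
      obtain r C where r: "r > 0" "\<And>z. z \<in> J \<Longrightarrow> st z \<in> ball (st y) r \<Longrightarrow> fdiff (I1 z) (I2 z) = C"
        using loc[OF y(1)] by blast
      have "g a = g b" if "b \<in> st ` J" "dist b a < r" for b
        using that g y r by (auto simp: dist_commute)
      then show "\<forall>\<^sub>F b in at a within st ` J. g a = g b"
        unfolding eventually_at using r(1) by blast
    qed
  qed (use x u in auto)
  then have "fdiff (I1 x) (I2 x) = fconst 0" using g x u by (simp add: fdiff_self)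
  then show ?thesis by (rule fdiff_eq_zero)
qed

section \<open>Primitives on real intervals and existence of antiderivatives\<close>

lemma segment_subset_convex:
  assumes "convex T" "s \<in> T" "z \<in> T" shows "{min s z..max s z :: real} \<subseteq> T"
  using closed_segment_subset[OF assms(2,3,1)]
  by (simp add: closed_segment_eq_real_ivl min_def max_def split: if_splits)

text \<open>The set \<open>S\<close> may contain either of its endpoints or none, so the derivative
  is stated within closed subintervals; it is one-sided at their ends.\<close>

lemma interval_primitive:
  fixes k :: "real \<Rightarrow> real"
  assumes S: "convex S" and k: "continuous_on S k" and s0: "s0 \<in> S"
  obtains C where "C s0 = a0"
    "\<And>a b x. {a..b} \<subseteq> S \<Longrightarrow> x \<in> {a..b} \<Longrightarrow> (C has_real_derivative k x) (at x within {a..b})"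
proof (rule that[of "\<lambda>s. a0 + (LBINT y=s0..s. k y)"])
  let ?C = "\<lambda>s. a0 + (LBINT y=s0..s. k y)"
  show "?C s0 = a0" by simp
  fix a b x :: real assume ab: "{a..b} \<subseteq> S" and x: "x \<in> {a..b}"
  \<comment> \<open>The subinterval is enlarged to contain \<open>s0\<close>, because the
    fundamental theorem is applied to the integral that starts there.\<close>
  define a' where "a' = min a s0"
  define b' where "b' = max b s0"
  have "a' \<in> S" "b' \<in> S" using ab x s0 by (auto simp: a'_def b'_def min_def max_def)
  moreover have "a' \<le> b'" using x by (auto simp: a'_def b'_def)
  ultimately have sub: "{a'..b'} \<subseteq> S" using segment_subset_convex[OF S, of a' b'] by simp
  have "((\<lambda>s. LBINT y=s0..s. k y) has_vector_derivative k x) (at x within {a'..b'})"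
  proof (rule interval_integral_FTC2)
    show "continuous_on {a'..b'} k" by (rule continuous_on_subset[OF k sub])
  qed (use x in \<open>auto simp: a'_def b'_def\<close>)
  then have "((\<lambda>s. LBINT y=s0..s. k y) has_real_derivative k x) (at x within {a..b})"
    unfolding has_real_derivative_iff_has_vector_derivative
    by (rule has_vector_derivative_within_subset) (auto simp: a'_def b'_def)
  then show "(?C has_real_derivative k x) (at x within {a..b})"
    by (auto intro!: derivative_eq_intros)
qed

text \<open>The last clause keeps absent exponents absent: a zero coefficient must get the primitive
  that is zero everywhere, as \<open>nf_data\<close> demands.\<close>

lemma ball_primitive:
  assumes c: "smooth1 (ball s r) c" and r: "r > 0"
  obtains P where "P s = 0" "\<And>z. z \<in> ball s r \<Longrightarrow> (P has_real_derivative c z) (at z)"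
    "c = (\<lambda>_. 0) \<Longrightarrow> P = (\<lambda>_. 0)"
proof (cases "c = (\<lambda>_. 0)")
  case True
  then show thesis using that[of "\<lambda>_. 0"] by simp
next
  case False
  obtain P where P: "P s = 0"
    "\<And>a b x. {a..b} \<subseteq> ball s r \<Longrightarrow> x \<in> {a..b} \<Longrightarrow> (P has_real_derivative c x) (at x within {a..b})"
  proof (rule interval_primitive[OF convex_ball, of s r c s 0])
    show "continuous_on (ball s r) c" using smooth1_continuous_on[OF c order_refl, of 0] by simp
  qed (use r in auto)
  have "(P has_real_derivative c z) (at z)" if z: "z \<in> ball s r" for z
  proof -
    obtain e where e: "e > 0" "cball z e \<subseteq> ball s r" using z open_contains_cball[of "ball s r"] open_ball by blast
    then have "{z - e..z + e} \<subseteq> ball s r" by (simp add: cball_eq_atLeastAtMost)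
    from P(2)[OF this, of z] show ?thesis using e at_within_Icc_at[of "z - e" z "z + e"] by simp
  qed
  with P(1) False show thesis by (intro that[of P]) auto
qed

lemma fermat_expansion:
  obtains B \<kappa> where "finite B" "B \<subseteq> {0..1}" "\<And>b. b \<notin> B \<Longrightarrow> \<kappa> b = 0"
    "little_o (\<lambda>t. frep X t - (\<Sum>b\<in>B. \<kappa> b * tpow t b))"
proof -
  obtain B c where "uexp UNIV (\<lambda>t y. frep X t) B c"
    using Ro_expandable[OF frep_Ro] unfolding expandable_def by blast
  from uexp_pad[OF this]
  have c: "uexp UNIV (\<lambda>t y. frep X t) B (\<lambda>b. if b \<in> B then c b else (\<lambda>_. 0))" .
  show thesis
  proof (rule that[of B "\<lambda>b. (if b \<in> B then c b else (\<lambda>_. 0)) 0"])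
    show "little_o (\<lambda>t. frep X t - (\<Sum>b\<in>B. (if b \<in> B then c b else (\<lambda>_. 0)) 0 * tpow t b))"
      using c unif_o_little_o[of UNIV "\<lambda>t y. frep X t - (\<Sum>b\<in>B. (if b \<in> B then c b else (\<lambda>_. 0)) y * tpow t b)" 0]
      unfolding uexp_def by simp
  qed (use c in \<open>auto simp: uexp_def\<close>)
qed

text \<open>The primitives \<open>C b\<close> of the global coefficients exist only on
  \<open>S\<close>, which may contain an endpoint, whereas a normal form needs functions on a full
  ball. Hence \<open>P s b\<close> is a primitive of the local coefficient on the ball around
  \<open>s\<close>, and \<open>C b s\<close> supplies only its additive constant.\<close>

lemma antiderivative_exists:
  assumes J: "skeleton J A" and f: "fsmooth J f" and u: "u \<in> J"
  obtains F where "fsmooth J F" "F u = fconst 0" "\<And>x. x \<in> J \<Longrightarrow> fderiv J F x = f x"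
proof -
  define S where "S = st ` J"
  define s0 where "s0 = st u"
  have A: "open A" "\<And>x. x \<in> J \<Longrightarrow> st x \<in> closure A" using J unfolding skeleton_def by auto
  have S: "convex S" "A \<subseteq> S" "S \<subseteq> closure A" "s0 \<in> S"
    using skeleton_image_convex[OF J] A(2) u unfolding S_def s0_def by auto
  have "\<forall>s\<in>S. \<exists>r B c. r > 0 \<and> nf_rep J f (ball s r) B c"
    using fsmooth_nf_rep[OF f] unfolding S_def by (metis imageE)
  then obtain r B c where r: "\<And>s. s \<in> S \<Longrightarrow> r s > 0" and rep: "\<And>s. s \<in> S \<Longrightarrow> nf_rep J f (ball s (r s)) (B s) (c s)"
    by metis
  define V where "V s = ball s (r s)" for s
  have V: "open (V s)" "convex (V s)" "s \<in> S \<Longrightarrow> s \<in> V s" for s using r by (auto simp: V_def)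
  have nd: "nf_data (V s) (B s) (c s)" if "s \<in> S" for s using rep[OF that] unfolding nf_rep_def V_def by blast
  have B: "finite (B s)" "B s \<subseteq> {0..1}" "b \<notin> B s \<Longrightarrow> c s b = (\<lambda>_. 0)" "smooth1 (V s) (c s b)" if "s \<in> S" for s b
    using nd[OF that] unfolding nf_data_def by auto
  \<comment> \<open>The local coefficients agree on S, so each k b is a global coefficient function.\<close>
  define k where "k b s = c s b s" for b s
  have consistent: "c s b z = k b z" if s: "s \<in> S" and z: "z \<in> S" "z \<in> V s" for s b z
  proof -
    have "c s b y = c z b y" if "y \<in> A" "y \<in> V s \<inter> V z" for y
      using nf_rep_unique[OF J rep[OF s] rep[OF z(1)]] that unfolding V_def by blast
    \<comment> \<open>The point \<open>z\<close> may be an endpoint outside \<open>A\<close>; the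
      values are then compared by continuity, as the jet of order 0 at a point of the
      closure.\<close>
    then have "(deriv ^^ 0) (c s b) z = (deriv ^^ 0) (c z b) z"
      using V S z smooth1_subset[OF B(4)[OF s]] smooth1_subset[OF B(4)[OF z(1)]]
      by (intro smooth1_jet_closure[OF A(1), of z "V s \<inter> V z"]) auto
    then show ?thesis by (simp add: k_def)
  qed
  have k_cont: "continuous_on S (k b)" for b
    unfolding continuous_on_eq_continuous_within
  proof
    fix s assume s: "s \<in> S"
    have "continuous (at s within S) (c s b)"
      using DERIV_isCont[OF smooth1_DERIV[OF B(4)[OF s] V(3)[OF s]]] by (rule continuous_at_imp_continuous_at_within)
    then show "continuous (at s within S) (k b)"
    proof (rule continuous_transform_within[OF _ r[OF s] s])
      fix z assume "z \<in> S" "dist z s < r s"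
      then show "c s b z = k b z" by (intro consistent[OF s]) (auto simp: V_def dist_commute)
    qed
  qed
  have "\<exists>P. P s = 0 \<and> (\<forall>z\<in>V s. (P has_real_derivative c s b z) (at z)) \<and> (c s b = (\<lambda>_. 0) \<longrightarrow> P = (\<lambda>_. 0))"
    if s: "s \<in> S" for s b
    using ball_primitive[OF B(4)[OF s, unfolded V_def] r[OF s], of b] unfolding V_def by metis
  then obtain P where P: "\<And>s b. s \<in> S \<Longrightarrow> P s b s = 0"
    and PD: "\<And>s b z. s \<in> S \<Longrightarrow> z \<in> V s \<Longrightarrow> (P s b has_real_derivative c s b z) (at z)"
    and P0: "\<And>s b. s \<in> S \<Longrightarrow> c s b = (\<lambda>_. 0) \<Longrightarrow> P s b = (\<lambda>_. 0)" by metis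
  have Psm: "smooth1 (V s) (P s b)" if "s \<in> S" for s b
    using smooth1_primitive[OF V(1) PD B(4)] that by blast
  have Pnd: "nf_data (V s) (B s) (P s)" if "s \<in> S" for s
    using B[OF that] V Psm[OF that] P0[OF that] unfolding nf_data_def by blast
  \<comment> \<open>The local primitives vanish at the standard part \<open>s0\<close> of
    \<open>u\<close>, but \<open>u\<close> may differ from it by an infinitesimal, so the value at
    \<open>u\<close> is expanded in powers of t.\<close>
  obtain B\<kappa> \<kappa> where B\<kappa>: "finite B\<kappa>" "B\<kappa> \<subseteq> {0..1}" "\<And>b. b \<notin> B\<kappa> \<Longrightarrow> \<kappa> b = 0"
    and \<kappa>: "little_o (\<lambda>t. frep (nf (B s0) (P s0) u) t - (\<Sum>b\<in>B\<kappa>. \<kappa> b * tpow t b))"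
    using fermat_expansion by blast
  \<comment> \<open>The initial values are chosen to cancel the value at u of the local primitive.\<close>
  have "\<exists>C. C s0 = - \<kappa> b \<and> (\<forall>l h. {l..h} \<subseteq> S \<longrightarrow> (\<forall>x\<in>{l..h}. (C has_real_derivative k b x) (at x within {l..h})))" for b
    by (rule interval_primitive[OF S(1) k_cont[of b] S(4), of "- \<kappa> b"]) blast
  then obtain C where C0: "\<And>b. C b s0 = - \<kappa> b"
    and CD: "\<And>b l h x. {l..h} \<subseteq> S \<Longrightarrow> x \<in> {l..h} \<Longrightarrow> (C b has_real_derivative k b x) (at x within {l..h})" by metis
  have CP: "C b z = C b s + P s b z" if s: "s \<in> S" and z: "z \<in> S" "z \<in> V s" for s b z
  proof -
    let ?I = "{min s z..max s z}"
    have I: "?I \<subseteq> S" "?I \<subseteq> V s" using segment_subset_convex[OF S(1) s z(1)] segment_subset_convex[OF V(2) V(3)[OF s] z(2)] .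
    have "C b z - P s b z = C b s - P s b s"
    proof (rule same_DERIV_imp_diff_const[of ?I _ "k b"])
      fix w assume w: "w \<in> ?I"
      show "(C b has_real_derivative k b w) (at w within ?I)" by (rule CD[OF I(1) w])
      show "(P s b has_real_derivative k b w) (at w within ?I)"
      proof -
        have "w \<in> S" "w \<in> V s" using w I by blast+
        then show ?thesis using has_field_derivative_at_within[OF PD[OF s, of w b]] consistent[OF s, of w b] by simp
      qed
    qed auto
    then show ?thesis using P[OF s] by simp
  qed
  \<comment> \<open>Finitely many of the sets \<open>V z\<close> cover the segment from
    \<open>s0\<close> to \<open>s\<close>. For an exponent outside their sets \<open>B z\<close> and
    outside \<open>B\<kappa>\<close>, the integrand vanishes along the segment and so does the
    initial value.\<close>
  have "\<exists>N. finite N \<and> N \<subseteq> {0..1} \<and> (\<forall>b. b \<notin> N \<longrightarrow> C b s = 0)" if s: "s \<in> S" for s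
  proof -
    let ?I = "{min s0 s..max s0 s}"
    have I: "?I \<subseteq> S" by (rule segment_subset_convex[OF S(1,4) s])
    have cov: "?I \<subseteq> (\<Union>z\<in>?I. V z)" using V(3) I by blast
    obtain T where T: "T \<subseteq> ?I" "finite T" "?I \<subseteq> (\<Union>z\<in>T. V z)"
      by (rule compactE_image[OF compact_Icc V(1) cov])
    define N where "N = (\<Union>z\<in>T. B z) \<union> B\<kappa>"
    have "C b s = 0" if b: "b \<notin> N" for b
    proof -
      have k0: "k b w = 0" if w: "w \<in> ?I" for w
      proof -
        obtain z where z: "z \<in> T" "w \<in> V z" using T w by blast
        then have "z \<in> S" using T I by blast
        then have "c z b w = k b w" using consistent z w I by blast
        moreover have "c z b = (\<lambda>_. 0)" using B(3)[OF \<open>z \<in> S\<close>] b z unfolding N_def by blast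
        ultimately show ?thesis by simp
      qed
      have "C b s - 0 = C b s0 - 0"
      proof (rule same_DERIV_imp_diff_const[of ?I "C b" "\<lambda>_. 0" "\<lambda>_. 0"])
        show "(C b has_real_derivative 0) (at w within ?I)" if "w \<in> ?I" for w
          using CD[OF I that, of b] k0[OF that] by simp
      qed auto
      then show ?thesis using C0 B\<kappa>(3) b unfolding N_def by simp
    qed
    moreover have "finite N" "N \<subseteq> {0..1}" using T B I B\<kappa> unfolding N_def by (blast intro: finite_UN_I)+
    ultimately show ?thesis by blast
  qed
  then obtain N where N: "\<And>s. s \<in> S \<Longrightarrow> finite (N s)" "\<And>s. s \<in> S \<Longrightarrow> N s \<subseteq> {0..1}"
    "\<And>s b. s \<in> S \<Longrightarrow> b \<notin> N s \<Longrightarrow> C b s = 0" by metis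
  define E where "E s = B s \<union> N s" for s
  define D where "D s b = (\<lambda>z. C b s + P s b z)" for s b
  have End: "nf_data (V s) (E s) (D s)" if s: "s \<in> S" for s
    unfolding nf_data_def
  proof (intro conjI allI impI)
    show "smooth1 (V s) (D s b)" for b unfolding D_def by (rule smooth1_add_const[OF V(1) Psm[OF s]])
    show "D s b = (\<lambda>_. 0)" if "b \<notin> E s" for b
      using that N(3)[OF s] P0[OF s B(3)[OF s]] by (simp add: D_def E_def)
  qed (use V B[OF s] N[OF s] in \<open>auto simp: E_def\<close>)
  \<comment> \<open>The normal form used at a point is selected by its standard part; agreement on
    overlaps is shown next and makes this a smooth function.\<close>
  define F where "F y = nf (E (st y)) (D (st y)) y" for y
  have Frep: "nf_rep J F (V s) (E s) (D s)" if s: "s \<in> S" for s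
    unfolding nf_rep_def
  proof (intro conjI ballI impI End[OF s])
    fix y assume y: "y \<in> J" "st y \<in> V s"
    have yS: "st y \<in> S" using y by (simp add: S_def)
    show "F y = nf (E s) (D s) y"
      unfolding F_def
    proof (rule nf_cong_closure(1)[OF A(1) End[OF yS] End[OF s] V(3)[OF yS] y(2) A(2)[OF y(1)]])
      fix b w assume "w \<in> A" "w \<in> V (st y)" "w \<in> V s"
      then show "D (st y) b w = D s b w" using CP[OF yS, of w b] CP[OF s, of w b] S(2) by (auto simp: D_def)
    qed
  qed
  have inS: "st x \<in> S" if "x \<in> J" for x using that by (simp add: S_def)
  show thesis
  proof
    show "fsmooth J F" using Frep inS V(3) by (intro fsmoothI) blast
    show "fderiv J F x = f x" if x: "x \<in> J" for x
    proof -
      note s = inS[OF x]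
      have "fderiv J F x = nf (E (st x)) (\<lambda>b. deriv (D (st x) b)) x"
        by (rule fderiv_nf_rep[OF J Frep[OF s] x V(3)[OF s]])
      also have "\<dots> = nf (B (st x)) (c (st x)) x"
      proof (rule nf_cong_closure(1)[OF A(1) nf_data_deriv[OF End[OF s]] nd[OF s] V(3)[OF s] V(3)[OF s] A(2)[OF x]])
        fix b y assume y: "y \<in> V (st x)"
        have "(D (st x) b has_real_derivative c (st x) b y) (at y)"
          unfolding D_def using PD[OF s y] by (auto intro!: derivative_eq_intros)
        then show "deriv (D (st x) b) y = c (st x) b y" by (rule DERIV_imp_deriv)
      qed
      also have "\<dots> = f x" using rep[OF s] x V(3)[OF s] unfolding nf_rep_def V_def by simp
      finally show ?thesis .
    qed
    let ?p = "\<lambda>t. \<Sum>b\<in>B s0. P s0 b (frep u t) * tpow t b"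
    let ?\<kappa> = "\<lambda>t. \<Sum>b\<in>B\<kappa>. \<kappa> b * tpow t b"
    have uV: "frep u 0 \<in> V s0" using V(3)[OF S(4)] by (simp add: s0_def st_def)
    have fE: "finite (E s0)" using End[OF S(4)] unfolding nf_data_def by blast
    have "?p \<in> Ro" by (rule nf_sum_Ro[OF Pnd[OF S(4)] frep_Ro uV])
    then have "little_o (\<lambda>t. frep (nf (B s0) (P s0) u) t - ?p t)" unfolding nf_def by (rule frep_fclass)
    from little_o_diff[OF \<kappa> this] have o: "little_o (\<lambda>t. ?p t - ?\<kappa> t)" by simp
    have e1: "?p t = (\<Sum>b\<in>E s0. P s0 b (frep u t) * tpow t b)" for t
      using fE P0[OF S(4) B(3)[OF S(4)]] by (intro sum.mono_neutral_left) (auto simp: E_def)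
    \<comment> \<open>The choice of \<open>N\<close> keeps no record of \<open>B\<kappa>\<close>;
      that \<open>\<kappa>\<close> vanishes outside \<open>E s0\<close> is recovered from
      \<open>C b s0 = - \<kappa> b\<close>.\<close>
    have \<kappa>E: "\<kappa> b = 0" if "b \<notin> E s0" for b using N(3)[OF S(4)] C0[of b] that by (auto simp: E_def)
    have "?\<kappa> t = (\<Sum>b\<in>E s0 \<union> B\<kappa>. \<kappa> b * tpow t b)" for t
      using fE B\<kappa> by (intro sum.mono_neutral_left) auto
    also have "\<dots> t = (\<Sum>b\<in>E s0. \<kappa> b * tpow t b)" for t
      using fE B\<kappa> \<kappa>E by (intro sum.mono_neutral_right) auto
    finally have e2: "?\<kappa> t = (\<Sum>b\<in>E s0. \<kappa> b * tpow t b)" for t .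
    have "little_o (\<lambda>t. (\<Sum>b\<in>E s0. D s0 b (frep u t) * tpow t b) - 0)"
      using o unfolding e1 e2 D_def C0 by (simp add: sum_subtractf algebra_simps)
    then show "F u = fconst 0" unfolding F_def s0_def[symmetric] nf_def fconst_def
      by (rule fclass_eqI[rotated]) (rule nf_sum_Ro[OF End[OF S(4)] frep_Ro uV])
  qed
qed

subsection \<open>Chain rule and substitution\<close>

lemma fmult_fclass:
  assumes "x \<in> Ro" "y \<in> Ro" shows "fmult (fclass x) (fclass y) = fclass (\<lambda>t. x t * y t)"
  unfolding fmult_def
proof (rule fclass_eqI)
  let ?X = "frep (fclass x)" and ?Y = "frep (fclass y)"
  show "(\<lambda>t. ?X t * ?Y t) \<in> Ro" by (intro Ro_mult frep_Ro)
  have "little_o (\<lambda>t. ?X t * (?Y t - y t) + y t * (?X t - x t))"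
    using assms by (intro little_o_add little_o_mult frep_fclass frep_Ro)
  then show "little_o (\<lambda>t. ?X t * ?Y t - x t * y t)" by (simp add: algebra_simps)
qed

text \<open>The composite is not expanded coefficient by coefficient. For each small t the real
  chain rule gives the derivative \<open>H t\<close> of \<open>G t\<close>, and the normal form of
  this pair yields the value and the derivative of the composite at once.\<close>

lemma chain_rule:
  assumes J: "skeleton J A" and J1: "skeleton J1 A1" and \<phi>J: "\<phi> ` J1 \<subseteq> J"
    and \<phi>: "fsmooth J1 \<phi>" and F: "fsmooth J F"
  shows "fsmooth J1 (\<lambda>s. F (\<phi> s))"
    and "x \<in> J1 \<Longrightarrow> fderiv J1 (\<lambda>s. F (\<phi> s)) x = fmult (fderiv J F (\<phi> x)) (fderiv J1 \<phi> x)"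
proof -
  have key: "\<exists>V B c. st x \<in> V \<and> nf_rep J1 (\<lambda>s. F (\<phi> s)) V B c \<and>
      nf B (\<lambda>b. deriv (c b)) x = fmult (fderiv J F (\<phi> x)) (fderiv J1 \<phi> x)" if x: "x \<in> J1" for x
  proof -
    have \<phi>x: "\<phi> x \<in> J" using \<phi>J x by blast
    define z where "z = st (\<phi> x)"
    obtain r B c where r: "r > 0" and c: "nf_rep J F (ball z r) B c"
      using fsmooth_nf_rep[OF F \<phi>x] unfolding z_def by blast
    obtain r1 B1 c1 where r1: "r1 > 0" and c1: "nf_rep J1 \<phi> (ball (st x) r1) B1 c1"
      using fsmooth_nf_rep[OF \<phi> x] by blast
    have nd: "nf_data (ball z r) B c" and nd1: "nf_data (ball (st x) r1) B1 c1"
      using c c1 unfolding nf_rep_def by auto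
    have B: "B \<subseteq> {0..1}" "\<And>b. smooth1 (ball z r) (c b)" and B1: "finite B1" "B1 \<subseteq> {0..1}" "\<And>b. smooth1 (ball (st x) r1) (c1 b)"
      using nd nd1 unfolding nf_data_def by auto
    define \<Phi> where "\<Phi> t s = (\<Sum>b\<in>B1. c1 b s * tpow t b)" for t s
    define \<Phi>' where "\<Phi>' t s = (\<Sum>b\<in>B1. deriv (c1 b) s * tpow t b)" for t s
    have \<phi>y: "\<phi> y = fclass (\<lambda>t. \<Phi> t (frep y t))" and \<Phi>Ro: "(\<lambda>t. \<Phi> t (frep y t)) \<in> Ro"
      and \<Phi>'Ro: "(\<lambda>t. \<Phi>' t (frep y t)) \<in> Ro"
      if y: "y \<in> J1" "st y \<in> ball (st x) r1" for y
    proof -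
      show "\<phi> y = fclass (\<lambda>t. \<Phi> t (frep y t))"
        using c1 y unfolding nf_rep_def \<Phi>_def nf_def by blast
      show "(\<lambda>t. \<Phi> t (frep y t)) \<in> Ro" "(\<lambda>t. \<Phi>' t (frep y t)) \<in> Ro" unfolding \<Phi>_def \<Phi>'_def
        using nf_sum_Ro[OF nd1 frep_Ro[of y]] nf_sum_Ro[OF nf_data_deriv[OF nd1] frep_Ro[of y]] y by (auto simp: st_def)
    qed
    \<comment> \<open>The standard part of the image depends only on the standard part of the
      argument, through the real function \<open>\<Phi> 0\<close>, whose continuity then supplies
      the neighbourhood \<open>V\<close>.\<close>
    have st\<phi>: "st (\<phi> y) = \<Phi> 0 (st y)" if y: "y \<in> J1" "st y \<in> ball (st x) r1" for y
      using st_fclass[OF \<Phi>Ro[OF y]] \<phi>y[OF y] by (simp add: st_def)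
    have zx: "z = \<Phi> 0 (st x)" unfolding z_def using st\<phi>[OF x] r1 by simp
    have "isCont (\<Phi> 0) (st x)"
      unfolding \<Phi>_def using r1 by (intro continuous_intros DERIV_isCont[OF smooth1_DERIV[OF B1(3)]]) auto
    \<comment> \<open>Half of the radius is kept in reserve for the distance between
      \<open>\<Phi> 0 y\<close> and \<open>\<Phi> t y\<close>.\<close>
    then obtain d where d: "d > 0" "\<And>s. dist s (st x) < d \<Longrightarrow> dist (\<Phi> 0 s) z < r / 2"
      using r unfolding continuous_at_eps_delta zx by (meson half_gt_zero)
    \<comment> \<open>Strictly below both radii, so that even the closed ball lies in the domain of
      the coefficients \<open>c1\<close>.\<close>
    define r2 where "r2 = min d r1 / 2"
    have r2: "r2 > 0" "r2 < d" "r2 < r1" using d r1 unfolding r2_def by (auto simp: min_def)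
    define V where "V = ball (st x) r2"
    have V: "open V" "st x \<in> V" "V \<subseteq> cball (st x) r2" "cball (st x) r2 \<subseteq> ball (st x) r1" "V \<subseteq> ball (st x) r1"
      using r2 by (auto simp: V_def)
    have img: "\<Phi> 0 ` V \<subseteq> cball z (r / 2)"
    proof (rule image_subsetI)
      fix s assume "s \<in> V"
      then have "dist s (st x) < d" using r2(2) by (simp add: V_def dist_commute)
      from d(2)[OF this] show "\<Phi> 0 s \<in> cball z (r / 2)" by (simp add: dist_commute)
    qed
    have zr: "cball z (r / 2) \<subseteq> ball z r" using r by auto
    have \<Phi>fam: "sfam n V \<Phi>" for n unfolding \<Phi>_def
      using B1 by (intro sfam_sum sfam_mult sfam_param Ro_tpow sfam_static[OF B1(3) V(3) compact_cball V(4)]) auto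
    have \<Phi>'ex: "expandable V \<Phi>'" unfolding \<Phi>'_def
      using B1 by (intro expandable_sum expandable_mult expandable_tpow
        sfam_expandable[OF sfam_static[OF smooth1_deriv[OF B1(3)] V(3) compact_cball V(4), of 0]]) auto
    define G where "G t s = (\<Sum>b\<in>B. c b (\<Phi> t s) * tpow t b)" for t s
    define H where "H t s = (\<Sum>b\<in>B. deriv (c b) (\<Phi> t s) * tpow t b) * \<Phi>' t s" for t s
    have Gfam: "sfam n V G" for n unfolding G_def
    proof (intro sfam_sum sfam_mult sfam_param)
      fix b assume "b \<in> B"
      then show "(\<lambda>t. tpow t b) \<in> Ro" using B by (intro Ro_tpow) auto
      show "sfam n V (\<lambda>t s. c b (\<Phi> t s))" by (rule sfam_compose[where \<phi> = \<Phi> and V = V, OF compact_cball img zr open_ball B(2) \<Phi>fam])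
    qed
    have Hex: "expandable V H" unfolding H_def
    proof (intro expandable_mult expandable_sum \<Phi>'ex)
      fix b assume "b \<in> B"
      then show "expandable V (\<lambda>t y. tpow t b)" using B by (intro expandable_tpow) auto
      show "expandable V (\<lambda>t s. deriv (c b) (\<Phi> t s))"
        by (rule expandable_compose[where \<phi> = \<Phi> and K = V,
              OF sfam_expandable[OF \<Phi>fam[of 0]] compact_cball img zr open_ball smooth1_deriv[OF B(2)]])
    qed
    have "r / 2 > 0" using r by simp
    from expandable_near[OF sfam_expandable[OF \<Phi>fam[of 0]] this]
    have GH: "\<forall>\<^sub>F t in near0. \<forall>y\<in>V. (G t has_real_derivative H t y) (at y)"
    proof eventually_elim
      case (elim t)
      show ?case
      proof
        fix y assume y: "y \<in> V"
        have "dist z (\<Phi> t y) \<le> dist z (\<Phi> 0 y) + dist (\<Phi> 0 y) (\<Phi> t y)" by (rule dist_triangle)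
        moreover have "dist z (\<Phi> 0 y) \<le> r / 2" using img y by (auto simp: image_subset_iff)
        moreover have "dist (\<Phi> 0 y) (\<Phi> t y) < r / 2" using elim y by (auto simp: dist_real_def abs_minus_commute)
        ultimately have "\<Phi> t y \<in> ball z r" by simp
        then have D: "(c b has_real_derivative deriv (c b) (\<Phi> t y)) (at (\<Phi> t y))" for b by (rule smooth1_DERIV[OF B(2)])
        have "(\<Phi> t has_real_derivative \<Phi>' t y) (at y)"
          unfolding \<Phi>_def \<Phi>'_def using y V(5) by (intro DERIV_sum DERIV_cmult_right smooth1_DERIV[OF B1(3)]) auto
        then have "((\<lambda>y. c b (\<Phi> t y)) has_real_derivative deriv (c b) (\<Phi> t y) * \<Phi>' t y) (at y)" for b
          by (rule DERIV_chain2[of "c b" _ "\<Phi> t", OF D])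
        then have "(G t has_real_derivative (\<Sum>b\<in>B. deriv (c b) (\<Phi> t y) * \<Phi>' t y * tpow t b)) (at y)"
          unfolding G_def by (intro DERIV_sum DERIV_cmult_right)
        then show "(G t has_real_derivative H t y) (at y)"
          unfolding H_def sum_distrib_right by (simp add: mult_ac)
      qed
    qed
    show ?thesis
    proof (rule sfam_normal_form[OF V(1) Gfam Hex GH])
      fix E e assume e: "\<And>b. smooth1 V (e b)" "\<And>b. b \<notin> E \<Longrightarrow> e b = (\<lambda>_. 0)"
        and Ge: "uexp V G E e" and He: "uexp V H E (\<lambda>b. deriv (e b))"
      have nde: "nf_data V E e" using e V(1) Ge unfolding nf_data_def uexp_def by blast
      have "F (\<phi> y) = nf E e y" if y: "y \<in> J1" "st y \<in> V" for y
      proof -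
        have y1: "st y \<in> ball (st x) r1" using y V(5) by blast
        have "\<Phi> 0 (st y) \<in> ball z r" using img zr y(2) by blast
        then have in_r: "st (\<phi> y) \<in> ball z r" "\<Phi> 0 (frep y 0) \<in> ball z r" using st\<phi>[OF y(1) y1] by (auto simp: st_def)
        have "F (\<phi> y) = nf B c (\<phi> y)" using c \<phi>J y(1) in_r unfolding nf_rep_def by blast
        also have "\<dots> = fclass (\<lambda>t. G t (frep y t))"
          unfolding \<phi>y[OF y(1) y1] G_def by (rule nf_fclass[OF nd \<Phi>Ro[OF y(1) y1] in_r(2)])
        also have "\<dots> = nf E e y"
          using nf_uexp[OF V(1) Ge y(2)] nf_sum_Ro[OF nde frep_Ro, of y] y(2) by (simp add: st_def)
        finally show ?thesis .
      qed
      then have rep: "nf_rep J1 (\<lambda>s. F (\<phi> s)) V E e" using nde unfolding nf_rep_def by blast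
      have x1: "st x \<in> ball (st x) r1" using r1 by simp
      have in_r: "st (\<phi> x) \<in> ball z r" "\<Phi> 0 (frep x 0) \<in> ball z r" using r zx by (auto simp: z_def st_def)
      define d1 where "d1 t = (\<Sum>b\<in>B. deriv (c b) (\<Phi> t (frep x t)) * tpow t b)" for t
      have d1Ro: "d1 \<in> Ro" unfolding d1_def
        using nf_sum_Ro[OF nf_data_deriv[OF nd] \<Phi>Ro[OF x x1] in_r(2)] .
      have "fderiv J F (\<phi> x) = nf B (\<lambda>b. deriv (c b)) (\<phi> x)"
        by (rule fderiv_nf_rep[OF J c \<phi>x in_r(1)])
      also have "\<dots> = fclass d1"
        unfolding \<phi>y[OF x x1] d1_def by (rule nf_fclass[OF nf_data_deriv[OF nd] \<Phi>Ro[OF x x1] in_r(2)])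
      finally have D1: "fderiv J F (\<phi> x) = fclass d1" .
      have "fderiv J1 \<phi> x = nf B1 (\<lambda>b. deriv (c1 b)) x"
        by (rule fderiv_nf_rep[OF J1 c1 x x1])
      also have "\<dots> = fclass (\<lambda>t. \<Phi>' t (frep x t))" by (simp add: nf_def \<Phi>'_def)
      finally have "fmult (fderiv J F (\<phi> x)) (fderiv J1 \<phi> x) = fclass (\<lambda>t. d1 t * \<Phi>' t (frep x t))"
        unfolding D1 using fmult_fclass[OF d1Ro \<Phi>'Ro[OF x x1]] by simp
      also have "\<dots> = fclass (\<lambda>t. H t (frep x t))" by (simp add: H_def d1_def)
      also have "\<dots> = nf E (\<lambda>b. deriv (e b)) x"
        using nf_uexp[where G = H and c = "\<lambda>b. deriv (e b)", OF V(1) He V(2)]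
          nf_sum_Ro[OF nf_data_deriv[OF nde] frep_Ro, of x] V(2) by (simp add: st_def)
      finally show ?thesis using rep V(2) by (intro exI[of _ V] exI[of _ E] exI[of _ e]) simp
    qed
  qed
  show "fsmooth J1 (\<lambda>s. F (\<phi> s))" by (rule fsmoothI) (use key in blast)
  show "x \<in> J1 \<Longrightarrow> fderiv J1 (\<lambda>s. F (\<phi> s)) x = fmult (fderiv J F (\<phi> x)) (fderiv J1 \<phi> x)"
    using key fderiv_nf_rep[OF J1] by metis
qed

section \<open>Evaluation of the integral by an antiderivative\<close>

lemma local_rep_cong: "(\<And>y. y \<in> S \<Longrightarrow> f y = g y) \<Longrightarrow> local_rep S f = local_rep S g"
  unfolding local_rep_def by (intro ext) auto

lemma fint_eqI:
  assumes J: "skeleton J A" and u: "u \<in> J" and v: "v \<in> J" and I: "fsmooth J I" "I u = fconst 0" "\<And>x. x \<in> J \<Longrightarrow> fderiv J I x = f x"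
  shows "fint J f u v = I v"
proof -
  \<comment> \<open>\<open>fint\<close> singles out the antiderivative that equals
    \<open>fconst 0\<close> outside \<open>J\<close>. Cutting \<open>I\<close> off there changes
    neither smoothness nor derivative, as both depend only on the values on
    \<open>J\<close>.\<close>
  define I0 where "I0 x = (if x \<in> J then I x else fconst 0)" for x
  have eq: "local_rep J I0 = local_rep J I" by (rule local_rep_cong) (simp add: I0_def)
  have "fsmooth J I0" "fderiv J I0 = fderiv J I" using I(1) unfolding fsmooth_def fderiv_def eq by auto
  then have I0: "fsmooth J I0 \<and> I0 u = fconst 0 \<and> (\<forall>x\<in>J. fderiv J I0 x = f x) \<and> (\<forall>x. x \<notin> J \<longrightarrow> I0 x = fconst 0)"
    using I u by (simp add: I0_def)
  have "(THE I. fsmooth J I \<and> I u = fconst 0 \<and> (\<forall>x\<in>J. fderiv J I x = f x) \<and> (\<forall>x. x \<notin> J \<longrightarrow> I x = fconst 0)) = I0"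
  proof (rule the_equality[where a = I0], rule I0)
    fix I' assume I': "fsmooth J I' \<and> I' u = fconst 0 \<and> (\<forall>x\<in>J. fderiv J I' x = f x) \<and> (\<forall>x. x \<notin> J \<longrightarrow> I' x = fconst 0)"
    show "I' = I0"
    proof
      fix x show "I' x = I0 x"
        using antiderivative_unique[OF J, of I' I0 u x] I' I0 u by (cases "x \<in> J") auto
    qed
  qed
  then show ?thesis unfolding fint_def using v by (simp add: I0_def)
qed

theorem theorem19:
  fixes J J1 :: "fermat set" and u v :: fermat and \<phi> f :: "fermat \<Rightarrow> fermat"
  assumes "ninf_interval J" and "ninf_interval J1"
    and "u \<in> J1" and "v \<in> J1"
    and "\<phi> ` J1 \<subseteq> J"
    and "fsmooth J1 \<phi>" and "fsmooth J f"
  shows "fint J f (\<phi> u) (\<phi> v) = fint J1 (\<lambda>s. fmult (f (\<phi> s)) (fderiv J1 \<phi> s)) u v"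
proof -
  obtain A A1 where J: "skeleton J A" and J1: "skeleton J1 A1"
    using ninf_interval_skeleton assms(1,2) by metis
  have \<phi>: "\<phi> x \<in> J" if "x \<in> J1" for x using assms(5) that by blast
  obtain F where F: "fsmooth J F" "F (\<phi> u) = fconst 0" "\<And>x. x \<in> J \<Longrightarrow> fderiv J F x = f x"
    using antiderivative_exists[OF J assms(7) \<phi>[OF assms(3)]] by blast
  note chain = chain_rule[OF J J1 assms(5,6) F(1)]
  have "fint J f (\<phi> u) (\<phi> v) = F (\<phi> v)"
    by (rule fint_eqI[OF J \<phi>[OF assms(3)] \<phi>[OF assms(4)] F])
  also have "\<dots> = fint J1 (\<lambda>s. fmult (f (\<phi> s)) (fderiv J1 \<phi> s)) u v"
    by (rule fint_eqI[OF J1 assms(3,4) chain(1) F(2), symmetric]) (simp add: chain(2) F(3) \<phi>)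
  finally show ?thesis .
qed

end
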